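(* Let $R$ be a regular commutative ring and let $S$ be a commutative ring containing $R$ as a subring, such that $S$ is finitely generated and projective as an $R$-module. Let $\mathfrak{m}$ be a maximal ideal of $S$ and set $\mathfrak{n} = \mathfrak{m} \cap R$. Let $\mathfrak{n} S = Q_1\cap Q_2\cap\cdots \cap Q_c$ be a minimal primary decomposition of $\mathfrak{n} S$ in $S$, where $Q_1$ is $\mathfrak{m}$-primary. Then, as $R$-modules, \[ E_S\left(\frac{S}{\mathfrak{m}}\right) \cong E_R\left(\frac{R}{\mathfrak{n}}\right)^{\ell_R(S/Q_1)}. \]
   Context: A regular commutative ring is a commutative Noetherian ring all of whose localizations at prime ideals are regular local rings. $E_A(N)$ denotes the injective hull of the $A$-module $N$, and $\ell_R$ denotes length as an $R$-module. *)

theory Defs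
  imports "HOL-Algebra.Algebra" "HOL-Library.Extended_Nat"
begin

section \<open>Modules\<close>

text \<open>
  A module over a ring \<open>A\<close> is a record \<open>M\<close> satisfying the library locale
  \<^locale>\<open>module\<close>; its fields \<^const>\<open>monoid.mult\<close> and \<^const>\<open>monoid.one\<close> play no role.  Since the scalar
  multiplication is a function on the whole type of scalars, restriction of scalars along a
  subring inclusion leaves the record unchanged.
\<close>

definition ring_as_module :: "('a, 'r) ring_scheme \<Rightarrow> ('a, 'a) module" where
  "ring_as_module A =
     \<lparr>carrier = carrier A, monoid.mult = monoid.mult A, monoid.one = monoid.one A,
      ring.zero = ring.zero A, ring.add = ring.add A, smult = monoid.mult A\<rparr>"

definition quot_module :: "('a, 'b, 'm) module_scheme \<Rightarrow> 'b set \<Rightarrow> ('a, 'b set) module" where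
  "quot_module M U =
     \<lparr>carrier = a_rcosets\<^bsub>M\<^esub> U, monoid.mult = (\<lambda>_ _. U), monoid.one = U, ring.zero = U,
      ring.add = set_add M, smult = (\<lambda>r C. \<Union>x\<in>C. U +>\<^bsub>M\<^esub> (r \<odot>\<^bsub>M\<^esub> x))\<rparr>"

definition module_power :: "('a, 'b, 'm) module_scheme \<Rightarrow> nat \<Rightarrow> ('a, nat \<Rightarrow> 'b) module" where
  "module_power M l =
     \<lparr>carrier = {..<l} \<rightarrow>\<^sub>E carrier M,
      monoid.mult = (\<lambda>_ _. \<lambda>i\<in>{..<l}. \<zero>\<^bsub>M\<^esub>), monoid.one = (\<lambda>i\<in>{..<l}. \<zero>\<^bsub>M\<^esub>),
      ring.zero = (\<lambda>i\<in>{..<l}. \<zero>\<^bsub>M\<^esub>),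
      ring.add = (\<lambda>x y. \<lambda>i\<in>{..<l}. x i \<oplus>\<^bsub>M\<^esub> y i),
      smult = (\<lambda>r x. \<lambda>i\<in>{..<l}. r \<odot>\<^bsub>M\<^esub> x i)\<rparr>"

definition mod_hom ::
  "('a, 'r) ring_scheme \<Rightarrow> ('a, 'b, 'm) module_scheme \<Rightarrow> ('a, 'c, 'n) module_scheme \<Rightarrow> ('b \<Rightarrow> 'c) set"
where
  "mod_hom A M N =
     {h \<in> carrier M \<rightarrow> carrier N.
        (\<forall>x\<in>carrier M. \<forall>y\<in>carrier M. h (x \<oplus>\<^bsub>M\<^esub> y) = h x \<oplus>\<^bsub>N\<^esub> h y) \<and>
        (\<forall>r\<in>carrier A. \<forall>x\<in>carrier M. h (r \<odot>\<^bsub>M\<^esub> x) = r \<odot>\<^bsub>N\<^esub> h x)}"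

definition mod_isomorphic ::
  "('a, 'r) ring_scheme \<Rightarrow> ('a, 'b, 'm) module_scheme \<Rightarrow> ('a, 'c, 'n) module_scheme \<Rightarrow> bool"
where
  "mod_isomorphic A M N \<longleftrightarrow> (\<exists>h\<in>mod_hom A M N. bij_betw h (carrier M) (carrier N))"

definition fin_gen_module :: "('a, 'r) ring_scheme \<Rightarrow> ('a, 'b, 'm) module_scheme \<Rightarrow> bool" where
  "fin_gen_module A M \<longleftrightarrow>
     (\<exists>C. finite C \<and> C \<subseteq> carrier M \<and> \<Inter>{U. submodule U A M \<and> C \<subseteq> U} = carrier M)"

definition module_length :: "('a, 'r) ring_scheme \<Rightarrow> ('a, 'b, 'm) module_scheme \<Rightarrow> enat" where
  "module_length A M =
     Sup {enat n | n. \<exists>U. (\<forall>i\<le>n. submodule (U i) A M) \<and> (\<forall>i<n. U i \<subset> U (Suc i))}"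

text \<open>
  Projectivity and injectivity are the usual lifting and extension properties.  As one cannot
  quantify over types, the test modules live on fixed types, chosen large enough that the
  properties hold for test modules on arbitrary types: see \<open>projective_module_lift\<close> and
  \<open>injective_module_extend\<close> below.
\<close>

definition projective_module :: "('a, 'r) ring_scheme \<Rightarrow> ('a, 'p, 'm) module_scheme \<Rightarrow> bool" where
  "projective_module A P \<longleftrightarrow> module A P \<and>
     (\<forall>(M :: ('a, 'p \<Rightarrow> 'a) module) (N :: ('a, 'p) module) g f.
        module A M \<longrightarrow> module A N \<longrightarrow>
        g \<in> mod_hom A M N \<longrightarrow> g ` carrier M = carrier N \<longrightarrow> f \<in> mod_hom A P N \<longrightarrow>
        (\<exists>h\<in>mod_hom A P M. \<forall>x\<in>carrier P. g (h x) = f x))"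

definition injective_module :: "('a, 'r) ring_scheme \<Rightarrow> ('a, 'e, 'm) module_scheme \<Rightarrow> bool" where
  "injective_module A E \<longleftrightarrow> module A E \<and>
     (\<forall>(M :: ('a, 'a) module) (N :: ('a, 'a) module) i f.
        module A M \<longrightarrow> module A N \<longrightarrow>
        i \<in> mod_hom A M N \<longrightarrow> inj_on i (carrier M) \<longrightarrow> f \<in> mod_hom A M E \<longrightarrow>
        (\<exists>g\<in>mod_hom A N E. \<forall>x\<in>carrier M. g (i x) = f x))"

definition essential_submodule ::
  "('a, 'r) ring_scheme \<Rightarrow> 'e set \<Rightarrow> ('a, 'e, 'm) module_scheme \<Rightarrow> bool"
where
  "essential_submodule A V E \<longleftrightarrow> submodule V A E \<and>
     (\<forall>U. submodule U A E \<longrightarrow> U \<inter> V = {\<zero>\<^bsub>E\<^esub>} \<longrightarrow> U = {\<zero>\<^bsub>E\<^esub>})"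

text \<open>\<open>injective_hull A N E\<close>: the module \<open>E\<close> is an injective hull of \<open>N\<close> over \<open>A\<close>.\<close>

definition injective_hull ::
  "('a, 'r) ring_scheme \<Rightarrow> ('a, 'b, 'm) module_scheme \<Rightarrow> ('a, 'e, 'n) module_scheme \<Rightarrow> bool"
where
  "injective_hull A N E \<longleftrightarrow> injective_module A E \<and>
     (\<exists>j\<in>mod_hom A N E. inj_on j (carrier N) \<and> essential_submodule A (j ` carrier N) E)"


section \<open>Regular rings\<close>

definition krull_dim :: "('a, 'r) ring_scheme \<Rightarrow> enat" where
  "krull_dim A =
     Sup {enat n | n. \<exists>P. (\<forall>i\<le>n. primeideal (P i) A) \<and> (\<forall>i<n. P i \<subset> P (Suc i))}"

definition regular_local_ring :: "('a, 'r) ring_scheme \<Rightarrow> bool" where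
  "regular_local_ring A \<longleftrightarrow> cring A \<and> noetherian_ring A \<and> (\<exists>!M. maximalideal M A) \<and>
     (\<exists>C. finite C \<and> C \<subseteq> carrier A \<and> enat (card C) = krull_dim A \<and> maximalideal (Idl\<^bsub>A\<^esub> C) A)"

definition frac_rel :: "('a, 'r) ring_scheme \<Rightarrow> 'a set \<Rightarrow> (('a \<times> 'a) \<times> ('a \<times> 'a)) set" where
  "frac_rel A T =
     {((a, s), (b, t)). a \<in> carrier A \<and> b \<in> carrier A \<and> s \<in> T \<and> t \<in> T \<and>
        (\<exists>u\<in>T. u \<otimes>\<^bsub>A\<^esub> (a \<otimes>\<^bsub>A\<^esub> t) = u \<otimes>\<^bsub>A\<^esub> (b \<otimes>\<^bsub>A\<^esub> s))}"

definition loc_frac :: "('a, 'r) ring_scheme \<Rightarrow> 'a set \<Rightarrow> 'a \<Rightarrow> 'a \<Rightarrow> ('a \<times> 'a) set" where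
  "loc_frac A T a s = frac_rel A T `` {(a, s)}"

definition localization :: "('a, 'r) ring_scheme \<Rightarrow> 'a set \<Rightarrow> ('a \<times> 'a) set ring" where
  "localization A T =
     \<lparr>carrier = (carrier A \<times> T) // frac_rel A T,
      monoid.mult = (\<lambda>C D. \<Union>(a, s)\<in>C. \<Union>(b, t)\<in>D. loc_frac A T (a \<otimes>\<^bsub>A\<^esub> b) (s \<otimes>\<^bsub>A\<^esub> t)),
      monoid.one = loc_frac A T \<one>\<^bsub>A\<^esub> \<one>\<^bsub>A\<^esub>,
      ring.zero = loc_frac A T \<zero>\<^bsub>A\<^esub> \<one>\<^bsub>A\<^esub>,
      ring.add = (\<lambda>C D. \<Union>(a, s)\<in>C. \<Union>(b, t)\<in>D.
               loc_frac A T ((a \<otimes>\<^bsub>A\<^esub> t) \<oplus>\<^bsub>A\<^esub> (b \<otimes>\<^bsub>A\<^esub> s)) (s \<otimes>\<^bsub>A\<^esub> t))\<rparr>"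

definition regular_ring :: "('a, 'r) ring_scheme \<Rightarrow> bool" where
  "regular_ring A \<longleftrightarrow> cring A \<and> noetherian_ring A \<and>
     (\<forall>P. primeideal P A \<longrightarrow> regular_local_ring (localization A (carrier A - P)))"


section \<open>Primary decomposition\<close>

definition radical_ideal :: "('a, 'r) ring_scheme \<Rightarrow> 'a set \<Rightarrow> 'a set" where
  "radical_ideal A I = {a \<in> carrier A. \<exists>n::nat. a [^]\<^bsub>A\<^esub> n \<in> I}"

definition primary_ideal :: "('a, 'r) ring_scheme \<Rightarrow> 'a set \<Rightarrow> bool" where
  "primary_ideal A Q \<longleftrightarrow> ideal Q A \<and> Q \<noteq> carrier A \<and>
     (\<forall>a\<in>carrier A. \<forall>b\<in>carrier A.
        a \<otimes>\<^bsub>A\<^esub> b \<in> Q \<longrightarrow> a \<in> Q \<or> (\<exists>n::nat. b [^]\<^bsub>A\<^esub> n \<in> Q))"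

text \<open>The intersections are taken inside the ring, so that the empty one is the unit ideal.\<close>

definition minimal_primary_decomposition ::
  "('a, 'r) ring_scheme \<Rightarrow> 'a set \<Rightarrow> (nat \<Rightarrow> 'a set) \<Rightarrow> nat \<Rightarrow> bool"
where
  "minimal_primary_decomposition A I Q c \<longleftrightarrow>
     (\<forall>i\<in>{1..c}. primary_ideal A (Q i)) \<and>
     I = carrier A \<inter> (\<Inter>i\<in>{1..c}. Q i) \<and>
     inj_on (\<lambda>i. radical_ideal A (Q i)) {1..c} \<and>
     (\<forall>j\<in>{1..c}. \<not> carrier A \<inter> (\<Inter>i\<in>{1..c} - {j}. Q i) \<subseteq> Q j)"


section \<open>Well-definedness of the constructions\<close>

lemma module_module_power:
  assumes "module A M" shows "module A (module_power M l)"
proof -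
  interpret M: module A M by fact
  show ?thesis
  proof (rule moduleI[OF M.is_cring])
    show "abelian_group (module_power M l)"
    proof (rule abelian_groupI)
      fix x assume "x \<in> carrier (module_power M l)"
      then show "\<exists>y\<in>carrier (module_power M l). y \<oplus>\<^bsub>module_power M l\<^esub> x = \<zero>\<^bsub>module_power M l\<^esub>"
        by (intro bexI[of _ "\<lambda>i\<in>{..<l}. \<ominus>\<^bsub>M\<^esub> x i"])
          (auto simp: module_power_def PiE_def Pi_def M.l_neg intro!: restrict_ext)
    qed (auto simp: module_power_def PiE_def Pi_def extensional_def M.a_ac fun_eq_iff restrict_def)
  qed (auto simp: module_power_def PiE_def Pi_def extensional_def fun_eq_iff restrict_def
         M.smult_l_distr M.smult_r_distr M.smult_assoc1)
qed

lemma module_quot_module: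
  assumes "module A M" and U: "submodule U A M" shows "module A (quot_module M U)"
proof -
  interpret M: module A M by fact
  interpret U: submodule U A M by fact
  interpret S: abelian_subgroup U M
    by (rule abelian_subgroupI3) (use U.subgroup_axioms in \<open>auto intro: additive_subgroup.intro M.abelian_group_axioms\<close>)
  have sm: "r \<odot>\<^bsub>quot_module M U\<^esub> (U +>\<^bsub>M\<^esub> x) = U +>\<^bsub>M\<^esub> (r \<odot>\<^bsub>M\<^esub> x)"
    if r: "r \<in> carrier A" and x: "x \<in> carrier M" for r x
  proof -
    have *: "U +>\<^bsub>M\<^esub> (r \<odot>\<^bsub>M\<^esub> z) = U +>\<^bsub>M\<^esub> (r \<odot>\<^bsub>M\<^esub> x)" if z: "z \<in> U +>\<^bsub>M\<^esub> x" for z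
    proof -
      obtain u where u: "u \<in> U" "z = u \<oplus>\<^bsub>M\<^esub> x" using z by (auto simp: a_r_coset_def')
      have "r \<odot>\<^bsub>M\<^esub> z = r \<odot>\<^bsub>M\<^esub> u \<oplus>\<^bsub>M\<^esub> r \<odot>\<^bsub>M\<^esub> x"
        using u r x S.a_subset by (simp add: M.smult_r_distr subset_iff)
      then have "r \<odot>\<^bsub>M\<^esub> z \<in> U +>\<^bsub>M\<^esub> (r \<odot>\<^bsub>M\<^esub> x)"
        using u r by (auto simp: a_r_coset_def')
      then show ?thesis using S.a_repr_independence'[symmetric] r x by simp
    qed
    have "x \<in> U +>\<^bsub>M\<^esub> x" using x by (rule S.a_rcos_self)
    moreover have "(\<Union>z\<in>U +>\<^bsub>M\<^esub> x. U +>\<^bsub>M\<^esub> (r \<odot>\<^bsub>M\<^esub> z)) = (\<Union>z\<in>U +>\<^bsub>M\<^esub> x. U +>\<^bsub>M\<^esub> (r \<odot>\<^bsub>M\<^esub> x))"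
      by (intro SUP_cong refl *)
    ultimately show ?thesis unfolding quot_module_def by auto
  qed
  have ad: "(U +>\<^bsub>M\<^esub> x) \<oplus>\<^bsub>quot_module M U\<^esub> (U +>\<^bsub>M\<^esub> y) = U +>\<^bsub>M\<^esub> (x \<oplus>\<^bsub>M\<^esub> y)"
    if "x \<in> carrier M" "y \<in> carrier M" for x y
    using that S.a_rcos_sum by (simp add: quot_module_def)
  have ze: "\<zero>\<^bsub>quot_module M U\<^esub> = U +>\<^bsub>M\<^esub> \<zero>\<^bsub>M\<^esub>"
    using S.a_subset by (simp add: quot_module_def)
  have ca: "carrier (quot_module M U) = (\<lambda>x. U +>\<^bsub>M\<^esub> x) ` carrier M"
    by (auto simp: quot_module_def A_RCOSETS_def')
  show ?thesis
  proof (rule moduleI[OF M.is_cring])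
    show "abelian_group (quot_module M U)"
    proof (rule abelian_groupI)
      fix C assume "C \<in> carrier (quot_module M U)"
      then obtain x where "x \<in> carrier M" "C = U +>\<^bsub>M\<^esub> x" by (auto simp: ca)
      then show "\<exists>D\<in>carrier (quot_module M U). D \<oplus>\<^bsub>quot_module M U\<^esub> C = \<zero>\<^bsub>quot_module M U\<^esub>"
        by (intro bexI[of _ "U +>\<^bsub>M\<^esub> (\<ominus>\<^bsub>M\<^esub> x)"]) (auto simp: ca ad ze M.l_neg)
    qed (auto simp: ca ad ze M.a_ac)
  qed (auto simp: ca sm ad M.smult_l_distr M.smult_r_distr M.smult_assoc1)
qed

lemma UN2_const:
  assumes "x \<in> C" "y \<in> D"
    and "\<And>a s b t. (a, s) \<in> C \<Longrightarrow> (b, t) \<in> D \<Longrightarrow> g a s b t = k"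
  shows "(\<Union>(a, s)\<in>C. \<Union>(b, t)\<in>D. g a s b t) = k"
proof -
  have "(\<Union>(a, s)\<in>C. \<Union>(b, t)\<in>D. g a s b t) = (\<Union>p\<in>C. \<Union>q\<in>D. k)"
    by (intro SUP_cong refl) (auto simp: assms(3))
  then show ?thesis using assms(1,2) by auto
qed

lemma cring_localization:
  assumes A: "cring A" and T: "submonoid T A"
  shows "cring (localization A T)"
proof -
  interpret cring A by fact
  interpret T: submonoid T A by fact
  have Tc: "\<And>t. t \<in> T \<Longrightarrow> t \<in> carrier A" using T.subset by auto
  let ?f = "loc_frac A T"
  have E: "equiv (carrier A \<times> T) (frac_rel A T)"
  proof (rule equivI)
    show "frac_rel A T \<subseteq> (carrier A \<times> T) \<times> (carrier A \<times> T)" by (auto simp: frac_rel_def)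
    show "refl_on (carrier A \<times> T) (frac_rel A T)"
      using T.one_closed by (auto simp: refl_on_def frac_rel_def)
    show "sym (frac_rel A T)" by (force simp: sym_def frac_rel_def)
    show "trans (frac_rel A T)"
    proof (rule transI, clarify)
      fix a s b t c v
      assume 1: "((a, s), (b, t)) \<in> frac_rel A T" and 2: "((b, t), (c, v)) \<in> frac_rel A T"
      obtain x where x: "x \<in> T" "x \<otimes>\<^bsub>A\<^esub> (a \<otimes>\<^bsub>A\<^esub> t) = x \<otimes>\<^bsub>A\<^esub> (b \<otimes>\<^bsub>A\<^esub> s)" using 1 by (auto simp: frac_rel_def)
      obtain y where y: "y \<in> T" "y \<otimes>\<^bsub>A\<^esub> (b \<otimes>\<^bsub>A\<^esub> v) = y \<otimes>\<^bsub>A\<^esub> (c \<otimes>\<^bsub>A\<^esub> t)" using 2 by (auto simp: frac_rel_def)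
      have c: "a \<in> carrier A" "b \<in> carrier A" "c \<in> carrier A" "s \<in> T" "t \<in> T" "v \<in> T"
        "s \<in> carrier A" "t \<in> carrier A" "v \<in> carrier A" "x \<in> carrier A" "y \<in> carrier A"
        using 1 2 x y Tc by (auto simp: frac_rel_def)
      have "(t \<otimes>\<^bsub>A\<^esub> (x \<otimes>\<^bsub>A\<^esub> y)) \<otimes>\<^bsub>A\<^esub> (a \<otimes>\<^bsub>A\<^esub> v) = (y \<otimes>\<^bsub>A\<^esub> v) \<otimes>\<^bsub>A\<^esub> (x \<otimes>\<^bsub>A\<^esub> (a \<otimes>\<^bsub>A\<^esub> t))"
        using c by (simp add: m_ac)
      also have "\<dots> = (x \<otimes>\<^bsub>A\<^esub> s) \<otimes>\<^bsub>A\<^esub> (y \<otimes>\<^bsub>A\<^esub> (b \<otimes>\<^bsub>A\<^esub> v))" unfolding x(2) using c by (simp add: m_ac)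
      also have "\<dots> = (t \<otimes>\<^bsub>A\<^esub> (x \<otimes>\<^bsub>A\<^esub> y)) \<otimes>\<^bsub>A\<^esub> (c \<otimes>\<^bsub>A\<^esub> s)" unfolding y(2) using c by (simp add: m_ac)
      finally show "((a, s), (c, v)) \<in> frac_rel A T"
        using c x(1) y(1) by (auto simp: frac_rel_def intro!: bexI[of _ "t \<otimes>\<^bsub>A\<^esub> (x \<otimes>\<^bsub>A\<^esub> y)"])
    qed
  qed
  have eqI: "?f a s = ?f b t"
    if "a \<in> carrier A" "b \<in> carrier A" "s \<in> T" "t \<in> T" "u \<in> T"
      "u \<otimes>\<^bsub>A\<^esub> (a \<otimes>\<^bsub>A\<^esub> t) = u \<otimes>\<^bsub>A\<^esub> (b \<otimes>\<^bsub>A\<^esub> s)" for a b s t u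
    unfolding loc_frac_def
    by (rule equiv_class_eq[OF E]) (use that in \<open>unfold frac_rel_def, blast\<close>)
  have eqI1: "?f a s = ?f b t"
    if "a \<in> carrier A" "b \<in> carrier A" "s \<in> T" "t \<in> T" "a \<otimes>\<^bsub>A\<^esub> t = b \<otimes>\<^bsub>A\<^esub> s" for a b s t
    by (rule eqI[OF that(1-4) T.one_closed]) (simp add: that(5))
  have self: "(a, s) \<in> ?f a s" if "a \<in> carrier A" "s \<in> T" for a s
    unfolding loc_frac_def using that by (intro equiv_class_self[OF E]) auto
  have in_f: "\<exists>u\<in>T. a' \<in> carrier A \<and> s' \<in> T \<and> u \<otimes>\<^bsub>A\<^esub> (a \<otimes>\<^bsub>A\<^esub> s') = u \<otimes>\<^bsub>A\<^esub> (a' \<otimes>\<^bsub>A\<^esub> s)"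
    if "(a', s') \<in> ?f a s" for a s a' s'
    using that by (auto simp: loc_frac_def frac_rel_def)
  have ml: "?f a s \<otimes>\<^bsub>localization A T\<^esub> ?f b t = ?f (a \<otimes>\<^bsub>A\<^esub> b) (s \<otimes>\<^bsub>A\<^esub> t)"
    if c: "a \<in> carrier A" "b \<in> carrier A" "s \<in> T" "t \<in> T" for a b s t
  proof -
    have "?f (a' \<otimes>\<^bsub>A\<^esub> b') (s' \<otimes>\<^bsub>A\<^esub> t') = ?f (a \<otimes>\<^bsub>A\<^esub> b) (s \<otimes>\<^bsub>A\<^esub> t)"
      if as: "(a', s') \<in> ?f a s" and bt: "(b', t') \<in> ?f b t" for a' s' b' t'
    proof -
      obtain u where u: "u \<in> T" "a' \<in> carrier A" "s' \<in> T" "u \<otimes>\<^bsub>A\<^esub> (a \<otimes>\<^bsub>A\<^esub> s') = u \<otimes>\<^bsub>A\<^esub> (a' \<otimes>\<^bsub>A\<^esub> s)"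
        using in_f[OF as] by blast
      obtain v where v: "v \<in> T" "b' \<in> carrier A" "t' \<in> T" "v \<otimes>\<^bsub>A\<^esub> (b \<otimes>\<^bsub>A\<^esub> t') = v \<otimes>\<^bsub>A\<^esub> (b' \<otimes>\<^bsub>A\<^esub> t)"
        using in_f[OF bt] by blast
      note cc = c u(1-3) v(1-3) Tc[OF c(3)] Tc[OF c(4)] Tc[OF u(1)] Tc[OF v(1)] Tc[OF u(3)] Tc[OF v(3)]
      have "(u \<otimes>\<^bsub>A\<^esub> v) \<otimes>\<^bsub>A\<^esub> ((a' \<otimes>\<^bsub>A\<^esub> b') \<otimes>\<^bsub>A\<^esub> (s \<otimes>\<^bsub>A\<^esub> t)) = (u \<otimes>\<^bsub>A\<^esub> (a' \<otimes>\<^bsub>A\<^esub> s)) \<otimes>\<^bsub>A\<^esub> (v \<otimes>\<^bsub>A\<^esub> (b' \<otimes>\<^bsub>A\<^esub> t))"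
        using cc by (simp add: m_ac)
      also have "\<dots> = (u \<otimes>\<^bsub>A\<^esub> v) \<otimes>\<^bsub>A\<^esub> ((a \<otimes>\<^bsub>A\<^esub> b) \<otimes>\<^bsub>A\<^esub> (s' \<otimes>\<^bsub>A\<^esub> t'))"
        unfolding u(4)[symmetric] v(4)[symmetric] using cc by (simp add: m_ac)
      finally show ?thesis using cc by (intro eqI[of _ _ _ _ "u \<otimes>\<^bsub>A\<^esub> v"]) auto
    qed
    then show ?thesis
      unfolding localization_def by (simp add: UN2_const[OF self[OF c(1,3)] self[OF c(2,4)]])
  qed
  have ad: "?f a s \<oplus>\<^bsub>localization A T\<^esub> ?f b t = ?f ((a \<otimes>\<^bsub>A\<^esub> t) \<oplus>\<^bsub>A\<^esub> (b \<otimes>\<^bsub>A\<^esub> s)) (s \<otimes>\<^bsub>A\<^esub> t)"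
    if c: "a \<in> carrier A" "b \<in> carrier A" "s \<in> T" "t \<in> T" for a b s t
  proof -
    have "?f ((a' \<otimes>\<^bsub>A\<^esub> t') \<oplus>\<^bsub>A\<^esub> (b' \<otimes>\<^bsub>A\<^esub> s')) (s' \<otimes>\<^bsub>A\<^esub> t') = ?f ((a \<otimes>\<^bsub>A\<^esub> t) \<oplus>\<^bsub>A\<^esub> (b \<otimes>\<^bsub>A\<^esub> s)) (s \<otimes>\<^bsub>A\<^esub> t)"
      if as: "(a', s') \<in> ?f a s" and bt: "(b', t') \<in> ?f b t" for a' s' b' t'
    proof -
      obtain u where u: "u \<in> T" "a' \<in> carrier A" "s' \<in> T" "u \<otimes>\<^bsub>A\<^esub> (a \<otimes>\<^bsub>A\<^esub> s') = u \<otimes>\<^bsub>A\<^esub> (a' \<otimes>\<^bsub>A\<^esub> s)"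
        using in_f[OF as] by blast
      obtain v where v: "v \<in> T" "b' \<in> carrier A" "t' \<in> T" "v \<otimes>\<^bsub>A\<^esub> (b \<otimes>\<^bsub>A\<^esub> t') = v \<otimes>\<^bsub>A\<^esub> (b' \<otimes>\<^bsub>A\<^esub> t)"
        using in_f[OF bt] by blast
      note cc = c u(1-3) v(1-3) Tc[OF c(3)] Tc[OF c(4)] Tc[OF u(1)] Tc[OF v(1)] Tc[OF u(3)] Tc[OF v(3)]
      have "(u \<otimes>\<^bsub>A\<^esub> v) \<otimes>\<^bsub>A\<^esub> (((a' \<otimes>\<^bsub>A\<^esub> t') \<oplus>\<^bsub>A\<^esub> (b' \<otimes>\<^bsub>A\<^esub> s')) \<otimes>\<^bsub>A\<^esub> (s \<otimes>\<^bsub>A\<^esub> t)) =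
        (v \<otimes>\<^bsub>A\<^esub> t \<otimes>\<^bsub>A\<^esub> t') \<otimes>\<^bsub>A\<^esub> (u \<otimes>\<^bsub>A\<^esub> (a' \<otimes>\<^bsub>A\<^esub> s)) \<oplus>\<^bsub>A\<^esub> (u \<otimes>\<^bsub>A\<^esub> s \<otimes>\<^bsub>A\<^esub> s') \<otimes>\<^bsub>A\<^esub> (v \<otimes>\<^bsub>A\<^esub> (b' \<otimes>\<^bsub>A\<^esub> t))"
        using cc by (simp add: m_ac l_distr r_distr)
      also have "\<dots> = (u \<otimes>\<^bsub>A\<^esub> v) \<otimes>\<^bsub>A\<^esub> (((a \<otimes>\<^bsub>A\<^esub> t) \<oplus>\<^bsub>A\<^esub> (b \<otimes>\<^bsub>A\<^esub> s)) \<otimes>\<^bsub>A\<^esub> (s' \<otimes>\<^bsub>A\<^esub> t'))"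
        unfolding u(4)[symmetric] v(4)[symmetric] using cc by (simp add: m_ac l_distr r_distr)
      finally show ?thesis using cc by (intro eqI[of _ _ _ _ "u \<otimes>\<^bsub>A\<^esub> v"]) auto
    qed
    then show ?thesis
      unfolding localization_def by (simp add: UN2_const[OF self[OF c(1,3)] self[OF c(2,4)]])
  qed
  have on: "\<one>\<^bsub>localization A T\<^esub> = ?f \<one>\<^bsub>A\<^esub> \<one>\<^bsub>A\<^esub>" and ze: "\<zero>\<^bsub>localization A T\<^esub> = ?f \<zero>\<^bsub>A\<^esub> \<one>\<^bsub>A\<^esub>"
    by (simp_all add: localization_def)
  have ca: "carrier (localization A T) = {?f a s | a s. a \<in> carrier A \<and> s \<in> T}"
    by (auto simp: localization_def quotient_def loc_frac_def)
  have caI: "?f a s \<in> carrier (localization A T)" if "a \<in> carrier A" "s \<in> T" for a s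
    using that by (auto simp: ca)
  have ag: "abelian_group (localization A T)"
  proof (rule abelian_groupI)
    fix x assume "x \<in> carrier (localization A T)"
    then obtain a s where x: "x = ?f a s" "a \<in> carrier A" "s \<in> T" by (auto simp: ca)
    have "(\<ominus>\<^bsub>A\<^esub> a \<otimes>\<^bsub>A\<^esub> s) \<oplus>\<^bsub>A\<^esub> (a \<otimes>\<^bsub>A\<^esub> s) = \<zero>\<^bsub>A\<^esub>"
      using x Tc by (metis l_distr l_neg l_null a_inv_closed)
    then have "?f (\<ominus>\<^bsub>A\<^esub> a) s \<oplus>\<^bsub>localization A T\<^esub> x = \<zero>\<^bsub>localization A T\<^esub>"
      unfolding ze x(1) using x eqI1[of "\<zero>\<^bsub>A\<^esub>" "\<zero>\<^bsub>A\<^esub>" "s \<otimes>\<^bsub>A\<^esub> s" "\<one>\<^bsub>A\<^esub>"] Tc by (simp add: ad)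
    then show "\<exists>y\<in>carrier (localization A T). y \<oplus>\<^bsub>localization A T\<^esub> x = \<zero>\<^bsub>localization A T\<^esub>"
      using x by (intro bexI[of _ "?f (\<ominus>\<^bsub>A\<^esub> a) s"]) (auto simp: ca)
  next
    fix x y assume "x \<in> carrier (localization A T)" "y \<in> carrier (localization A T)"
    then obtain a s b t where x: "x = ?f a s" "a \<in> carrier A" "s \<in> T" "s \<in> carrier A"
      and y: "y = ?f b t" "b \<in> carrier A" "t \<in> T" "t \<in> carrier A" using Tc by (auto simp: ca)
    show "x \<oplus>\<^bsub>localization A T\<^esub> y \<in> carrier (localization A T)"
      using x y by (simp add: ad caI)
    show "x \<oplus>\<^bsub>localization A T\<^esub> y = y \<oplus>\<^bsub>localization A T\<^esub> x"
      using x y by (simp add: ad m_ac a_ac)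
    fix z assume "z \<in> carrier (localization A T)"
    then obtain c v where z: "z = ?f c v" "c \<in> carrier A" "v \<in> T" "v \<in> carrier A" using Tc by (auto simp: ca)
    show "(x \<oplus>\<^bsub>localization A T\<^esub> y) \<oplus>\<^bsub>localization A T\<^esub> z = x \<oplus>\<^bsub>localization A T\<^esub> (y \<oplus>\<^bsub>localization A T\<^esub> z)"
      using x y z by (simp add: ad l_distr r_distr m_ac a_ac)
  next
    show "\<zero>\<^bsub>localization A T\<^esub> \<in> carrier (localization A T)" by (simp add: ze caI)
    fix x assume "x \<in> carrier (localization A T)"
    then obtain a s where x: "x = ?f a s" "a \<in> carrier A" "s \<in> T" "s \<in> carrier A" using Tc by (auto simp: ca)
    show "\<zero>\<^bsub>localization A T\<^esub> \<oplus>\<^bsub>localization A T\<^esub> x = x" using x by (simp add: ze ad)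
  qed
  have cm: "comm_monoid (localization A T)"
  proof (rule comm_monoidI)
    show "\<one>\<^bsub>localization A T\<^esub> \<in> carrier (localization A T)" by (simp add: on caI)
    fix x assume "x \<in> carrier (localization A T)"
    then obtain a s where x: "x = ?f a s" "a \<in> carrier A" "s \<in> T" "s \<in> carrier A" using Tc by (auto simp: ca)
    show "\<one>\<^bsub>localization A T\<^esub> \<otimes>\<^bsub>localization A T\<^esub> x = x" using x by (simp add: on ml)
    fix y assume "y \<in> carrier (localization A T)"
    then obtain b t where y: "y = ?f b t" "b \<in> carrier A" "t \<in> T" "t \<in> carrier A" using Tc by (auto simp: ca)
    show "x \<otimes>\<^bsub>localization A T\<^esub> y \<in> carrier (localization A T)"
      using x y by (simp add: ml caI)
    show "x \<otimes>\<^bsub>localization A T\<^esub> y = y \<otimes>\<^bsub>localization A T\<^esub> x"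
      using x y by (simp add: ml m_ac)
    fix z assume "z \<in> carrier (localization A T)"
    then obtain c v where z: "z = ?f c v" "c \<in> carrier A" "v \<in> T" "v \<in> carrier A" using Tc by (auto simp: ca)
    show "(x \<otimes>\<^bsub>localization A T\<^esub> y) \<otimes>\<^bsub>localization A T\<^esub> z = x \<otimes>\<^bsub>localization A T\<^esub> (y \<otimes>\<^bsub>localization A T\<^esub> z)"
      using x y z by (simp add: ml m_ac)
  qed
  show ?thesis
  proof (rule cringI[OF ag cm])
    fix x y z assume "x \<in> carrier (localization A T)" "y \<in> carrier (localization A T)" "z \<in> carrier (localization A T)"
    then obtain a s b t c v where x: "x = ?f a s" "a \<in> carrier A" "s \<in> T" "s \<in> carrier A"
      and y: "y = ?f b t" "b \<in> carrier A" "t \<in> T" "t \<in> carrier A"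
      and z: "z = ?f c v" "c \<in> carrier A" "v \<in> T" "v \<in> carrier A" using Tc by (auto simp: ca)
    show "(x \<oplus>\<^bsub>localization A T\<^esub> y) \<otimes>\<^bsub>localization A T\<^esub> z = x \<otimes>\<^bsub>localization A T\<^esub> z \<oplus>\<^bsub>localization A T\<^esub> y \<otimes>\<^bsub>localization A T\<^esub> z"
      unfolding x(1) y(1) z(1) using x y z
      by (simp add: ad ml, intro eqI1) (simp_all add: l_distr r_distr m_ac)
  qed
qed


section \<open>Independence of the types of the test modules\<close>

lemma mod_homD:
  assumes "h \<in> mod_hom A M N"
  shows "x \<in> carrier M \<Longrightarrow> h x \<in> carrier N"
    and "x \<in> carrier M \<Longrightarrow> y \<in> carrier M \<Longrightarrow> h (x \<oplus>\<^bsub>M\<^esub> y) = h x \<oplus>\<^bsub>N\<^esub> h y"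
    and "r \<in> carrier A \<Longrightarrow> x \<in> carrier M \<Longrightarrow> h (r \<odot>\<^bsub>M\<^esub> x) = r \<odot>\<^bsub>N\<^esub> h x"
  using assms by (auto simp: mod_hom_def)

lemma mod_hom_zero:
  assumes "module A M" "module A N" "h \<in> mod_hom A M N"
  shows "h \<zero>\<^bsub>M\<^esub> = \<zero>\<^bsub>N\<^esub>"
proof -
  interpret M: module A M by fact
  interpret N: module A N by fact
  have "h (\<zero>\<^bsub>A\<^esub> \<odot>\<^bsub>M\<^esub> \<zero>\<^bsub>M\<^esub>) = \<zero>\<^bsub>A\<^esub> \<odot>\<^bsub>N\<^esub> h \<zero>\<^bsub>M\<^esub>"
    using mod_homD[OF assms(3)] by blast
  then show ?thesis using mod_homD(1)[OF assms(3)] by simp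
qed

lemma module_ring_as_module:
  assumes "cring A" shows "module A (ring_as_module A)"
proof -
  interpret cring A by fact
  show ?thesis
    by (rule moduleI)
      (auto simp: ring_as_module_def assms l_distr r_distr m_assoc a_ac
        intro!: abelian_groupI intro: bexI[of _ "\<ominus>\<^bsub>A\<^esub> x" for x] l_neg)
qed

lemma injective_module_extend:
  fixes E :: "('a, 'e, 'm) module_scheme"
    and M :: "('a, 'b, 'k) module_scheme" and N :: "('a, 'c, 'l) module_scheme"
  assumes inj: "injective_module A E"
    and M: "module A M" and N: "module A N"
    and i: "i \<in> mod_hom A M N" "inj_on i (carrier M)" and f: "f \<in> mod_hom A M E"
  shows "\<exists>g\<in>mod_hom A N E. \<forall>x\<in>carrier M. g (i x) = f x"
proof -
  have E: "module A E" using inj by (simp add: injective_module_def)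
  interpret M: module A M by fact
  interpret N: module A N by fact
  interpret E: module A E by fact
  define B where "B = (\<lambda>x. (i x, f x)) ` carrier M"
  define ok where "ok G \<longleftrightarrow> G \<subseteq> carrier N \<times> carrier E \<and> B \<subseteq> G \<and>
     (\<forall>x y z w. (x, y) \<in> G \<longrightarrow> (z, w) \<in> G \<longrightarrow> (x \<oplus>\<^bsub>N\<^esub> z, y \<oplus>\<^bsub>E\<^esub> w) \<in> G) \<and>
     (\<forall>r\<in>carrier A. \<forall>x y. (x, y) \<in> G \<longrightarrow> (r \<odot>\<^bsub>N\<^esub> x, r \<odot>\<^bsub>E\<^esub> y) \<in> G) \<and>
     (\<forall>z. (\<zero>\<^bsub>N\<^esub>, z) \<in> G \<longrightarrow> z = \<zero>\<^bsub>E\<^esub>)" for G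
  note ext = inj[unfolded injective_module_def, THEN conjunct2, rule_format]
  have okD: "\<And>G. ok G \<Longrightarrow> G \<subseteq> carrier N \<times> carrier E" "\<And>G. ok G \<Longrightarrow> B \<subseteq> G"
    "\<And>G x y z w. ok G \<Longrightarrow> (x, y) \<in> G \<Longrightarrow> (z, w) \<in> G \<Longrightarrow> (x \<oplus>\<^bsub>N\<^esub> z, y \<oplus>\<^bsub>E\<^esub> w) \<in> G"
    "\<And>G r x y. ok G \<Longrightarrow> r \<in> carrier A \<Longrightarrow> (x, y) \<in> G \<Longrightarrow> (r \<odot>\<^bsub>N\<^esub> x, r \<odot>\<^bsub>E\<^esub> y) \<in> G"
    "\<And>G z. ok G \<Longrightarrow> (\<zero>\<^bsub>N\<^esub>, z) \<in> G \<Longrightarrow> z = \<zero>\<^bsub>E\<^esub>"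
    by (simp_all add: ok_def)
  note iD = mod_homD[OF i(1)] and fD = mod_homD[OF f]
  have B0: "(\<zero>\<^bsub>N\<^esub>, \<zero>\<^bsub>E\<^esub>) \<in> B"
    using mod_hom_zero[OF M N i(1)] mod_hom_zero[OF M E f]
    by (auto simp: B_def intro!: image_eqI[of _ _ "\<zero>\<^bsub>M\<^esub>"])
  have okB: "ok B"
    unfolding ok_def
  proof (intro conjI allI impI ballI)
    show "B \<subseteq> carrier N \<times> carrier E" unfolding B_def by (intro image_subsetI SigmaI iD(1) fD(1))
    show "(x \<oplus>\<^bsub>N\<^esub> z, y \<oplus>\<^bsub>E\<^esub> w) \<in> B" if b: "(x, y) \<in> B" "(z, w) \<in> B" for x y z w
    proof -
      obtain m where "m \<in> carrier M" "x = i m" "y = f m"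
        using b(1) unfolding B_def by (elim imageE) simp
      moreover obtain n where "n \<in> carrier M" "z = i n" "w = f n"
        using b(2) unfolding B_def by (elim imageE) simp
      ultimately show ?thesis
        unfolding B_def by (intro image_eqI[of _ _ "m \<oplus>\<^bsub>M\<^esub> n"]) (simp_all add: iD(2) fD(2))
    qed
    show "(r \<odot>\<^bsub>N\<^esub> x, r \<odot>\<^bsub>E\<^esub> y) \<in> B" if b: "r \<in> carrier A" "(x, y) \<in> B" for r x y
    proof -
      obtain m where "m \<in> carrier M" "x = i m" "y = f m"
        using b(2) unfolding B_def by (elim imageE) simp
      then show ?thesis using b(1)
        unfolding B_def by (intro image_eqI[of _ _ "r \<odot>\<^bsub>M\<^esub> m"]) (simp_all add: iD(3) fD(3))
    qed
    show "z = \<zero>\<^bsub>E\<^esub>" if b: "(\<zero>\<^bsub>N\<^esub>, z) \<in> B" for z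
    proof -
      obtain x where x: "x \<in> carrier M" "i x = \<zero>\<^bsub>N\<^esub>" "f x = z"
        using b unfolding B_def by (elim imageE) simp
      then have "x = \<zero>\<^bsub>M\<^esub>"
        using i(2) mod_hom_zero[OF M N i(1)] by (auto simp: inj_on_def)
      then show ?thesis using x mod_hom_zero[OF M E f] by simp
    qed
  qed simp
  obtain G where okG: "ok G" and max: "\<And>G'. ok G' \<Longrightarrow> G \<subseteq> G' \<Longrightarrow> G' = G"
  proof -
    have "\<exists>G\<in>Collect ok. \<forall>G'\<in>Collect ok. G \<subseteq> G' \<longrightarrow> G' = G"
    proof (rule subset_Zorn_nonempty)
      show "Collect ok \<noteq> {}" using okB by auto
      fix \<C> assume C0: "\<C> \<noteq> {}" and C: "subset.chain (Collect ok) \<C>"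
      then have ok: "\<And>G. G \<in> \<C> \<Longrightarrow> ok G" by (auto simp: subset.chain_def)
      have dir: "\<exists>K\<in>\<C>. G \<subseteq> K \<and> H \<subseteq> K" if "G \<in> \<C>" "H \<in> \<C>" for G H
        using C that subset_chain_def by (metis order_refl)
      have "ok (\<Union>\<C>)"
        unfolding ok_def
      proof (intro conjI allI impI ballI)
        show "\<Union>\<C> \<subseteq> carrier N \<times> carrier E" using ok okD(1) by (intro Union_least) simp
        show "B \<subseteq> \<Union>\<C>" using ok C0 okD(2) by (metis Union_upper all_not_in_conv order_trans)
        show "(x \<oplus>\<^bsub>N\<^esub> z, y \<oplus>\<^bsub>E\<^esub> w) \<in> \<Union>\<C>" if b: "(x, y) \<in> \<Union>\<C>" "(z, w) \<in> \<Union>\<C>" for x y z w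
        proof -
          obtain G H where GH: "G \<in> \<C>" "(x, y) \<in> G" "H \<in> \<C>" "(z, w) \<in> H" using b by auto
          then obtain K where "K \<in> \<C>" "G \<subseteq> K" "H \<subseteq> K" using dir by blast
          with GH have "(x \<oplus>\<^bsub>N\<^esub> z, y \<oplus>\<^bsub>E\<^esub> w) \<in> K"
            by (intro okD(3)[OF ok]) (auto dest: subsetD)
          then show ?thesis using \<open>K \<in> \<C>\<close> by (rule UnionI[rotated])
        qed
        show "(r \<odot>\<^bsub>N\<^esub> x, r \<odot>\<^bsub>E\<^esub> y) \<in> \<Union>\<C>" if "r \<in> carrier A" "(x, y) \<in> \<Union>\<C>" for r x y
          using that okD(4)[OF ok] by (elim UnionE) (rule UnionI)
        show "z = \<zero>\<^bsub>E\<^esub>" if "(\<zero>\<^bsub>N\<^esub>, z) \<in> \<Union>\<C>" for z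
          using that okD(5)[OF ok] by (elim UnionE)
      qed
      then show "\<Union>\<C> \<in> Collect ok" by simp
    qed
    then show thesis using that by blast
  qed
  have sub: "\<And>x y. (x, y) \<in> G \<Longrightarrow> x \<in> carrier N \<and> y \<in> carrier E"
    and BG: "B \<subseteq> G"
    and add: "\<And>x y z w. (x, y) \<in> G \<Longrightarrow> (z, w) \<in> G \<Longrightarrow> (x \<oplus>\<^bsub>N\<^esub> z, y \<oplus>\<^bsub>E\<^esub> w) \<in> G"
    and smult: "\<And>r x y. r \<in> carrier A \<Longrightarrow> (x, y) \<in> G \<Longrightarrow> (r \<odot>\<^bsub>N\<^esub> x, r \<odot>\<^bsub>E\<^esub> y) \<in> G"
    and zero: "\<And>z. (\<zero>\<^bsub>N\<^esub>, z) \<in> G \<Longrightarrow> z = \<zero>\<^bsub>E\<^esub>"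
    using okD[OF okG] by (simp_all add: subset_iff)
  have neg: "(\<ominus>\<^bsub>N\<^esub> x, \<ominus>\<^bsub>E\<^esub> y) \<in> G" if "(x, y) \<in> G" for x y
    using smult[OF _ that, of "\<ominus>\<^bsub>A\<^esub> \<one>\<^bsub>A\<^esub>"] sub[OF that]
    by (simp add: N.smult_l_minus E.smult_l_minus)
  have uniq: "y = z" if "(x, y) \<in> G" "(x, z) \<in> G" for x y z
  proof -
    have "(x \<oplus>\<^bsub>N\<^esub> \<ominus>\<^bsub>N\<^esub> x, y \<oplus>\<^bsub>E\<^esub> \<ominus>\<^bsub>E\<^esub> z) \<in> G" using add neg that by blast
    then have "y \<oplus>\<^bsub>E\<^esub> \<ominus>\<^bsub>E\<^esub> z = \<zero>\<^bsub>E\<^esub>" using zero sub that by (simp add: N.r_neg)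
    then show ?thesis using sub that by (metis E.minus_equality E.minus_minus E.a_inv_closed)
  qed
  have total: "\<exists>e. (y, e) \<in> G" if y: "y \<in> carrier N" for y
  proof -
    let ?A = "ring_as_module A"
    define J where "J = {r \<in> carrier A. \<exists>e. (r \<odot>\<^bsub>N\<^esub> y, e) \<in> G}"
    define k where "k r = (THE e. (r \<odot>\<^bsub>N\<^esub> y, e) \<in> G)" for r
    have k: "(r \<odot>\<^bsub>N\<^esub> y, k r) \<in> G" if "r \<in> J" for r
      using that uniq unfolding J_def k_def by (auto intro: theI2)
    have kI: "k r = e" if "(r \<odot>\<^bsub>N\<^esub> y, e) \<in> G" for r e
      using that uniq unfolding k_def by blast
    have A: "module A ?A" by (rule module_ring_as_module[OF M.is_cring])
    interpret A: module A ?A by (rule A)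
    have G0: "(\<zero>\<^bsub>N\<^esub>, \<zero>\<^bsub>E\<^esub>) \<in> G" using B0 BG by blast
    have J: "submodule J A ?A"
    proof (rule A.submoduleI)
      show "J \<subseteq> carrier ?A" by (auto simp: J_def ring_as_module_def)
      show "\<zero>\<^bsub>?A\<^esub> \<in> J" using G0 y by (auto simp: J_def ring_as_module_def)
      have "r \<otimes>\<^bsub>A\<^esub> a \<in> J" if "r \<in> carrier A" "a \<in> J" for r a
        using that smult[of r] y by (auto simp: J_def N.smult_assoc1)
      then show sm: "r \<odot>\<^bsub>?A\<^esub> a \<in> J" if "r \<in> carrier A" "a \<in> J" for r a
        using that by (simp add: ring_as_module_def)
      show "a \<oplus>\<^bsub>?A\<^esub> b \<in> J" if "a \<in> J" "b \<in> J" for a b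
        using that add y by (fastforce simp: J_def ring_as_module_def N.smult_l_distr)
      show "\<ominus>\<^bsub>?A\<^esub> a \<in> J" if "a \<in> J" for a
      proof -
        have "a \<in> carrier ?A" using that by (auto simp: J_def ring_as_module_def)
        then have "\<ominus>\<^bsub>?A\<^esub> a = (\<ominus>\<^bsub>A\<^esub> \<one>\<^bsub>A\<^esub>) \<odot>\<^bsub>?A\<^esub> a" by (simp add: A.smult_l_minus)
        then show ?thesis using sm that by simp
      qed
    qed
    have MJ: "module A (?A\<lparr>carrier := J\<rparr>)" by (rule submodule.submodule_is_module[OF J A])
    have ksub: "k \<in> mod_hom A (?A\<lparr>carrier := J\<rparr>) E"
    proof -
      have "k (a \<oplus>\<^bsub>A\<^esub> b) = k a \<oplus>\<^bsub>E\<^esub> k b" if "a \<in> J" "b \<in> J" for a b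
        using add[OF k k, OF that] that y by (intro kI) (simp add: J_def N.smult_l_distr)
      moreover have "k (r \<otimes>\<^bsub>A\<^esub> a) = r \<odot>\<^bsub>E\<^esub> k a" if "r \<in> carrier A" "a \<in> J" for r a
        using smult[OF that(1) k[OF that(2)]] that y by (intro kI) (simp add: J_def N.smult_assoc1)
      moreover have "k a \<in> carrier E" if "a \<in> J" for a
        using sub[OF k[OF that]] by simp
      ultimately show ?thesis by (simp add: mod_hom_def ring_as_module_def)
    qed
    have "J \<subseteq> carrier A" by (auto simp: J_def)
    then have id: "id \<in> mod_hom A (?A\<lparr>carrier := J\<rparr>) ?A"
      by (auto simp: mod_hom_def ring_as_module_def)
    have "\<exists>h\<in>mod_hom A ?A E. \<forall>x\<in>carrier (?A\<lparr>carrier := J\<rparr>). h (id x) = k x"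
      using ext[OF MJ A id inj_on_id ksub] .
    then obtain h where h: "h \<in> mod_hom A ?A E" and hk: "\<And>r. r \<in> J \<Longrightarrow> h r = k r"
      by (elim bexE) simp
    define e where "e = h \<one>\<^bsub>A\<^esub>"
    have e: "e \<in> carrier E" using mod_homD(1)[OF h] by (simp add: e_def ring_as_module_def)
    have he: "h r = r \<odot>\<^bsub>E\<^esub> e" if "r \<in> carrier A" for r
      using mod_homD(3)[OF h, of r "\<one>\<^bsub>A\<^esub>"] that by (simp add: e_def ring_as_module_def)
    define G' where "G' = {(d \<oplus>\<^bsub>N\<^esub> r \<odot>\<^bsub>N\<^esub> y, z \<oplus>\<^bsub>E\<^esub> r \<odot>\<^bsub>E\<^esub> e) | d z r. (d, z) \<in> G \<and> r \<in> carrier A}"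
    have GG': "G \<subseteq> G'"
    proof safe
      fix d z assume dz: "(d, z) \<in> G"
      have "(d \<oplus>\<^bsub>N\<^esub> \<zero>\<^bsub>A\<^esub> \<odot>\<^bsub>N\<^esub> y, z \<oplus>\<^bsub>E\<^esub> \<zero>\<^bsub>A\<^esub> \<odot>\<^bsub>E\<^esub> e) \<in> G'"
        unfolding G'_def using dz M.R.zero_closed by blast
      then show "(d, z) \<in> G'" using sub[OF dz] y e by simp
    qed
    have "ok G'"
      unfolding ok_def
    proof (intro conjI allI impI ballI)
      show "G' \<subseteq> carrier N \<times> carrier E" using sub y e by (auto simp: G'_def)
      show "B \<subseteq> G'" using BG GG' by blast
      show "(x \<oplus>\<^bsub>N\<^esub> z, u \<oplus>\<^bsub>E\<^esub> w) \<in> G'" if xz: "(x, u) \<in> G'" "(z, w) \<in> G'" for x u z w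
      proof -
        obtain d1 z1 r1 d2 z2 r2 where *: "(d1, z1) \<in> G" "(d2, z2) \<in> G" "r1 \<in> carrier A" "r2 \<in> carrier A"
          "x = d1 \<oplus>\<^bsub>N\<^esub> r1 \<odot>\<^bsub>N\<^esub> y" "u = z1 \<oplus>\<^bsub>E\<^esub> r1 \<odot>\<^bsub>E\<^esub> e"
          "z = d2 \<oplus>\<^bsub>N\<^esub> r2 \<odot>\<^bsub>N\<^esub> y" "w = z2 \<oplus>\<^bsub>E\<^esub> r2 \<odot>\<^bsub>E\<^esub> e"
          using xz by (auto simp: G'_def)
        have "x \<oplus>\<^bsub>N\<^esub> z = (d1 \<oplus>\<^bsub>N\<^esub> d2) \<oplus>\<^bsub>N\<^esub> (r1 \<oplus>\<^bsub>A\<^esub> r2) \<odot>\<^bsub>N\<^esub> y"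
          using * sub y by (simp add: N.smult_l_distr N.a_ac)
        moreover have "u \<oplus>\<^bsub>E\<^esub> w = (z1 \<oplus>\<^bsub>E\<^esub> z2) \<oplus>\<^bsub>E\<^esub> (r1 \<oplus>\<^bsub>A\<^esub> r2) \<odot>\<^bsub>E\<^esub> e"
          using * sub e by (simp add: E.smult_l_distr E.a_ac)
        moreover have "(d1 \<oplus>\<^bsub>N\<^esub> d2, z1 \<oplus>\<^bsub>E\<^esub> z2) \<in> G" "r1 \<oplus>\<^bsub>A\<^esub> r2 \<in> carrier A" using * add by auto
        ultimately show ?thesis unfolding G'_def by blast
      qed
      show "(r \<odot>\<^bsub>N\<^esub> x, r \<odot>\<^bsub>E\<^esub> u) \<in> G'" if r: "r \<in> carrier A" and x: "(x, u) \<in> G'" for r x u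
      proof -
        obtain d1 z1 r1 where *: "(d1, z1) \<in> G" "r1 \<in> carrier A"
          "x = d1 \<oplus>\<^bsub>N\<^esub> r1 \<odot>\<^bsub>N\<^esub> y" "u = z1 \<oplus>\<^bsub>E\<^esub> r1 \<odot>\<^bsub>E\<^esub> e"
          using x by (auto simp: G'_def)
        have "r \<odot>\<^bsub>N\<^esub> x = r \<odot>\<^bsub>N\<^esub> d1 \<oplus>\<^bsub>N\<^esub> (r \<otimes>\<^bsub>A\<^esub> r1) \<odot>\<^bsub>N\<^esub> y"
          using * sub y r by (simp add: N.smult_r_distr N.smult_assoc1)
        moreover have "r \<odot>\<^bsub>E\<^esub> u = r \<odot>\<^bsub>E\<^esub> z1 \<oplus>\<^bsub>E\<^esub> (r \<otimes>\<^bsub>A\<^esub> r1) \<odot>\<^bsub>E\<^esub> e"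
          using * sub e r by (simp add: E.smult_r_distr E.smult_assoc1)
        moreover have "(r \<odot>\<^bsub>N\<^esub> d1, r \<odot>\<^bsub>E\<^esub> z1) \<in> G" "r \<otimes>\<^bsub>A\<^esub> r1 \<in> carrier A" using * smult r by auto
        ultimately show ?thesis unfolding G'_def by blast
      qed
      show "w = \<zero>\<^bsub>E\<^esub>" if x: "(\<zero>\<^bsub>N\<^esub>, w) \<in> G'" for w
      proof -
        obtain d z r where *: "(d, z) \<in> G" "r \<in> carrier A"
          "\<zero>\<^bsub>N\<^esub> = d \<oplus>\<^bsub>N\<^esub> r \<odot>\<^bsub>N\<^esub> y" "w = z \<oplus>\<^bsub>E\<^esub> r \<odot>\<^bsub>E\<^esub> e"
          using x by (auto simp: G'_def)
        have "r \<odot>\<^bsub>N\<^esub> y = \<ominus>\<^bsub>N\<^esub> d"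
          using * sub[OF *(1)] y by (metis N.minus_equality N.a_comm N.smult_closed)
        then have "(r \<odot>\<^bsub>N\<^esub> y, \<ominus>\<^bsub>E\<^esub> z) \<in> G" using neg[OF *(1)] by simp
        then have "r \<in> J" "k r = \<ominus>\<^bsub>E\<^esub> z" using * kI by (auto simp: J_def)
        then have "r \<odot>\<^bsub>E\<^esub> e = \<ominus>\<^bsub>E\<^esub> z" using hk[of r] he[of r] *(2) by metis
        then show ?thesis using * sub[OF *(1)] by (simp add: E.r_neg)
      qed
    qed
    then have "G' = G" using max GG' by blast
    moreover have "(\<zero>\<^bsub>N\<^esub> \<oplus>\<^bsub>N\<^esub> \<one>\<^bsub>A\<^esub> \<odot>\<^bsub>N\<^esub> y, \<zero>\<^bsub>E\<^esub> \<oplus>\<^bsub>E\<^esub> \<one>\<^bsub>A\<^esub> \<odot>\<^bsub>E\<^esub> e) \<in> G'"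
      unfolding G'_def using G0 M.R.one_closed by blast
    ultimately show ?thesis using y by (auto intro: exI)
  qed
  define g where "g y = (THE e. (y, e) \<in> G)" for y
  have g: "(y, g y) \<in> G" if "y \<in> carrier N" for y
    using total[OF that] uniq unfolding g_def by (auto intro: theI2)
  have "g \<in> mod_hom A N E"
    unfolding mod_hom_def
  proof (intro CollectI conjI ballI Pi_I)
    show "g x \<in> carrier E" if "x \<in> carrier N" for x using sub[OF g[OF that]] by simp
    show "g (x \<oplus>\<^bsub>N\<^esub> y) = g x \<oplus>\<^bsub>E\<^esub> g y" if "x \<in> carrier N" "y \<in> carrier N" for x y
      using uniq[OF g add[OF g g]] that by simp
    show "g (r \<odot>\<^bsub>N\<^esub> x) = r \<odot>\<^bsub>E\<^esub> g x" if "r \<in> carrier A" "x \<in> carrier N" for r x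
      using uniq[OF g smult[OF _ g]] that by simp
  qed
  moreover have "g (i x) = f x" if "x \<in> carrier M" for x
    proof -
    have "(i x, f x) \<in> G" using BG that by (auto simp: B_def)
    with uniq[OF g] iD(1)[OF that] show ?thesis by blast
  qed
  ultimately show ?thesis by blast
qed

lemma mod_hom_finsum:
  assumes M: "module A M" and N: "module A N" and h: "h \<in> mod_hom A M N"
    and "finite T" "f \<in> T \<rightarrow> carrier M"
  shows "h (finsum M f T) = finsum N (\<lambda>t. h (f t)) T"
proof -
  interpret M: module A M by fact
  interpret N: module A N by fact
  show ?thesis using assms(4,5)
  proof (induction T rule: finite_induct)
    case empty then show ?case using mod_hom_zero[OF M N h] by simp
  next
    case (insert t T)
    then have "f \<in> T \<rightarrow> carrier M" "f t \<in> carrier M" by auto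
    moreover from this have "(\<lambda>t. h (f t)) \<in> T \<rightarrow> carrier N" "h (f t) \<in> carrier N"
      using mod_homD(1)[OF h] by auto
    ultimately show ?case using insert mod_homD(2)[OF h] M.finsum_closed by simp
  qed
qed

definition free_module :: "('a, 'r) ring_scheme \<Rightarrow> 'p set \<Rightarrow> ('a, 'p \<Rightarrow> 'a) module" where
  "free_module A I =
     \<lparr>carrier = {x. (\<forall>p. x p \<in> carrier A) \<and> (\<forall>p. p \<notin> I \<longrightarrow> x p = \<zero>\<^bsub>A\<^esub>) \<and> finite {p. x p \<noteq> \<zero>\<^bsub>A\<^esub>}},
      monoid.mult = (\<lambda>_ _ _. \<zero>\<^bsub>A\<^esub>), monoid.one = (\<lambda>_. \<zero>\<^bsub>A\<^esub>), ring.zero = (\<lambda>_. \<zero>\<^bsub>A\<^esub>),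
      ring.add = (\<lambda>x y p. x p \<oplus>\<^bsub>A\<^esub> y p), smult = (\<lambda>r x p. r \<otimes>\<^bsub>A\<^esub> x p)\<rparr>"

lemma module_free_module:
  fixes A :: "('a, 'r) ring_scheme" and I :: "'p set"
  assumes "cring A" shows "module A (free_module A I)"
proof -
  interpret cring A by fact
  have add: "finite {p. x p \<oplus>\<^bsub>A\<^esub> y p \<noteq> \<zero>\<^bsub>A\<^esub>}"
    if "finite {p. x p \<noteq> \<zero>\<^bsub>A\<^esub>}" "finite {p. y p \<noteq> \<zero>\<^bsub>A\<^esub>}" for x y :: "'p \<Rightarrow> 'a"
    by (rule finite_subset[OF _ finite_UnI[OF that]]) auto
  have neg: "finite {p. \<ominus>\<^bsub>A\<^esub> x p \<noteq> \<zero>\<^bsub>A\<^esub>}"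
    if "finite {p. x p \<noteq> \<zero>\<^bsub>A\<^esub>}" for x :: "'p \<Rightarrow> 'a"
    by (rule finite_subset[OF _ that]) auto
  have smult: "finite {p. r \<otimes>\<^bsub>A\<^esub> x p \<noteq> \<zero>\<^bsub>A\<^esub>}"
    if "finite {p. x p \<noteq> \<zero>\<^bsub>A\<^esub>}" "r \<in> carrier A" for x :: "'p \<Rightarrow> 'a" and r
    by (rule finite_subset[OF _ that(1)]) (use that(2) in auto)
  have "abelian_group (free_module A I)"
  proof (rule abelian_groupI)
    fix x assume "x \<in> carrier (free_module A I)"
    then show "\<exists>y\<in>carrier (free_module A I). y \<oplus>\<^bsub>free_module A I\<^esub> x = \<zero>\<^bsub>free_module A I\<^esub>"
      by (intro bexI[of _ "\<lambda>p. \<ominus>\<^bsub>A\<^esub> x p"]) (simp_all add: free_module_def l_neg neg)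
  qed (simp_all add: free_module_def add a_ac)
  then show ?thesis
    by (rule moduleI[OF assms])
      (simp_all add: free_module_def smult l_distr r_distr m_assoc)
qed

definition lin_ext :: "('a, 'r) ring_scheme \<Rightarrow> ('a, 'b, 'm) module_scheme \<Rightarrow> ('p \<Rightarrow> 'b) \<Rightarrow> ('p \<Rightarrow> 'a) \<Rightarrow> 'b" where
  "lin_ext A M h x = finsum M (\<lambda>p. x p \<odot>\<^bsub>M\<^esub> h p) {p. x p \<noteq> \<zero>\<^bsub>A\<^esub>}"

lemma lin_ext_eq:
  assumes "module A M" "h \<in> I \<rightarrow> carrier M" "x \<in> carrier (free_module A I)"
    and T: "finite T" "T \<subseteq> I" "{p. x p \<noteq> \<zero>\<^bsub>A\<^esub>} \<subseteq> T"
  shows "lin_ext A M h x = finsum M (\<lambda>p. x p \<odot>\<^bsub>M\<^esub> h p) T"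
proof -
  interpret M: module A M by fact
  have x: "\<And>p. x p \<in> carrier A" using assms(3) by (simp add: free_module_def)
  have h: "h p \<in> carrier M" if "p \<in> T" for p using that assms(2) T by auto
  show ?thesis unfolding lin_ext_def
    by (rule M.add.finprod_mono_neutral_cong_left[OF T(1,3)]) (use x h in auto)
qed

lemma lin_ext_hom:
  assumes M: "module A M" and h: "h \<in> I \<rightarrow> carrier M"
  shows "lin_ext A M h \<in> mod_hom A (free_module A I) M"
proof -
  interpret M: module A M by fact
  have F: "module A (free_module A I)" by (rule module_free_module[OF M.is_cring])
  interpret F: module A "free_module A I" by (rule F)
  let ?supp = "\<lambda>x. {p. x p \<noteq> \<zero>\<^bsub>A\<^esub>}"
  have c: "x p \<in> carrier A" "finite (?supp x)" "?supp x \<subseteq> I"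
    if "x \<in> carrier (free_module A I)" for x p
    using that by (auto simp: free_module_def)
  have h': "h p \<in> carrier M" if "p \<in> I" for p using that h by auto
  show ?thesis
    unfolding mod_hom_def
  proof (intro CollectI conjI ballI Pi_I)
    fix x assume x: "x \<in> carrier (free_module A I)"
    show "lin_ext A M h x \<in> carrier M"
      unfolding lin_ext_def using c[OF x] h' by (intro M.finsum_closed) auto
    { fix y assume y: "y \<in> carrier (free_module A I)"
      let ?T = "?supp x \<union> ?supp y"
      have xy: "x \<oplus>\<^bsub>free_module A I\<^esub> y = (\<lambda>p. x p \<oplus>\<^bsub>A\<^esub> y p)" by (simp add: free_module_def)
      have xyc: "(\<lambda>p. x p \<oplus>\<^bsub>A\<^esub> y p) \<in> carrier (free_module A I)"
        using F.a_closed[OF x y] by (simp add: xy)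
      have T: "finite ?T" "?T \<subseteq> I" using c x y by auto
      have "{p. x p \<oplus>\<^bsub>A\<^esub> y p \<noteq> \<zero>\<^bsub>A\<^esub>} \<subseteq> ?T" by auto
      then have "lin_ext A M h (\<lambda>p. x p \<oplus>\<^bsub>A\<^esub> y p) = finsum M (\<lambda>p. (x p \<oplus>\<^bsub>A\<^esub> y p) \<odot>\<^bsub>M\<^esub> h p) ?T"
        by (rule lin_ext_eq[OF M h xyc T])
      also have "\<dots> = finsum M (\<lambda>p. x p \<odot>\<^bsub>M\<^esub> h p \<oplus>\<^bsub>M\<^esub> y p \<odot>\<^bsub>M\<^esub> h p) ?T"
        using c[OF x] c[OF y] h' T by (intro M.finsum_cong') (auto simp: M.smult_l_distr subset_iff)
      also have "\<dots> = finsum M (\<lambda>p. x p \<odot>\<^bsub>M\<^esub> h p) ?T \<oplus>\<^bsub>M\<^esub> finsum M (\<lambda>p. y p \<odot>\<^bsub>M\<^esub> h p) ?T"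
        using c[OF x] c[OF y] h' T by (intro M.finsum_addf) auto
      also have "\<dots> = lin_ext A M h x \<oplus>\<^bsub>M\<^esub> lin_ext A M h y"
        using lin_ext_eq[OF M h x T] lin_ext_eq[OF M h y T] by simp
      finally show "lin_ext A M h (x \<oplus>\<^bsub>free_module A I\<^esub> y) = lin_ext A M h x \<oplus>\<^bsub>M\<^esub> lin_ext A M h y"
        by (simp add: xy) }
    { fix r assume r: "r \<in> carrier A"
      have rx: "r \<odot>\<^bsub>free_module A I\<^esub> x = (\<lambda>p. r \<otimes>\<^bsub>A\<^esub> x p)" by (simp add: free_module_def)
      have rxc: "(\<lambda>p. r \<otimes>\<^bsub>A\<^esub> x p) \<in> carrier (free_module A I)"
        using F.smult_closed[OF r x] by (simp add: rx)
      have "{p. r \<otimes>\<^bsub>A\<^esub> x p \<noteq> \<zero>\<^bsub>A\<^esub>} \<subseteq> ?supp x" using r by auto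
      then have "lin_ext A M h (\<lambda>p. r \<otimes>\<^bsub>A\<^esub> x p) = finsum M (\<lambda>p. (r \<otimes>\<^bsub>A\<^esub> x p) \<odot>\<^bsub>M\<^esub> h p) (?supp x)"
        by (rule lin_ext_eq[OF M h rxc c(2,3)[OF x]])
      also have "\<dots> = finsum M (\<lambda>p. r \<odot>\<^bsub>M\<^esub> (x p \<odot>\<^bsub>M\<^esub> h p)) (?supp x)"
        using c[OF x] h' r by (intro M.finsum_cong') (auto simp: M.smult_assoc1 subset_iff)
      also have "\<dots> = r \<odot>\<^bsub>M\<^esub> lin_ext A M h x"
        unfolding lin_ext_def using c[OF x] h' r
        by (intro M.finsum_smult_ldistr[symmetric]) auto
      finally show "lin_ext A M h (r \<odot>\<^bsub>free_module A I\<^esub> x) = r \<odot>\<^bsub>M\<^esub> lin_ext A M h x"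
        by (simp add: rx) }
  qed
qed

lemma mod_hom_lin_ext:
  assumes M: "module A M" and N: "module A N" and g: "g \<in> mod_hom A M N"
    and h: "h \<in> I \<rightarrow> carrier M" and x: "x \<in> carrier (free_module A I)"
  shows "g (lin_ext A M h x) = lin_ext A N (\<lambda>p. g (h p)) x"
proof -
  interpret M: module A M by fact
  interpret N: module A N by fact
  have c: "x p \<in> carrier A" "finite {p. x p \<noteq> \<zero>\<^bsub>A\<^esub>}" "{p. x p \<noteq> \<zero>\<^bsub>A\<^esub>} \<subseteq> I" for p
    using x by (auto simp: free_module_def)
  have h': "h p \<in> carrier M" if "p \<in> I" for p using that h by auto
  have "g (lin_ext A M h x) = finsum N (\<lambda>p. g (x p \<odot>\<^bsub>M\<^esub> h p)) {p. x p \<noteq> \<zero>\<^bsub>A\<^esub>}"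
    unfolding lin_ext_def using c h' by (intro mod_hom_finsum[OF M N g]) auto
  also have "\<dots> = lin_ext A N (\<lambda>p. g (h p)) x"
    unfolding lin_ext_def using c h' mod_homD[OF g]
    by (intro N.finsum_cong') (auto simp: subset_iff)
  finally show ?thesis .
qed

lemma projective_module_lift:
  fixes P :: "('a, 'p, 'm) module_scheme"
    and M :: "('a, 'b, 'k) module_scheme" and N :: "('a, 'c, 'l) module_scheme"
  assumes proj: "projective_module A P"
    and M: "module A M" and N: "module A N"
    and g: "g \<in> mod_hom A M N" "g ` carrier M = carrier N" and f: "f \<in> mod_hom A P N"
  shows "\<exists>h\<in>mod_hom A P M. \<forall>x\<in>carrier P. g (h x) = f x"
proof -
  have P: "module A P" using proj by (simp add: projective_module_def)
  interpret P: module A P by fact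
  let ?F = "free_module A (carrier P)"
  let ?P = "\<lparr>carrier = carrier P, monoid.mult = monoid.mult P, monoid.one = monoid.one P,
    ring.zero = ring.zero P, ring.add = ring.add P, smult = module.smult P\<rparr>"
  let ?e = "lin_ext A P (\<lambda>p. p)"
  have F: "module A ?F" by (rule module_free_module[OF P.is_cring])
  have P': "module A ?P"
    by (rule moduleI[OF P.is_cring])
      (auto intro!: abelian_groupI simp: P.smult_l_distr P.smult_r_distr P.smult_assoc1 P.a_ac
        intro: bexI[of _ "\<ominus>\<^bsub>P\<^esub> x" for x] P.l_neg)
  have e: "?e \<in> mod_hom A ?F P" by (rule lin_ext_hom[OF P]) auto
  then have e': "?e \<in> mod_hom A ?F ?P" by (simp add: mod_hom_def)
  have surj: "?e ` carrier ?F = carrier ?P"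
  proof (intro equalityI subsetI)
    fix p assume "p \<in> carrier ?P"
    then have p: "p \<in> carrier P" by simp
    let ?x = "\<lambda>q. if q = p then \<one>\<^bsub>A\<^esub> else \<zero>\<^bsub>A\<^esub>"
    have sub: "{q. ?x q \<noteq> \<zero>\<^bsub>A\<^esub>} \<subseteq> {p}" by auto
    have x: "?x \<in> carrier ?F" using p finite_subset[OF sub] by (auto simp: free_module_def)
    have "?e ?x = finsum P (\<lambda>q. ?x q \<odot>\<^bsub>P\<^esub> q) {p}"
      by (rule lin_ext_eq[OF P _ x _ _ sub]) (use p in auto)
    also have "\<dots> = p" using p by simp
    finally show "p \<in> ?e ` carrier ?F" using x by (metis image_eqI)
  qed (use mod_homD(1)[OF e] in auto)
  have idP: "(\<lambda>p. p) \<in> mod_hom A P ?P" by (simp add: mod_hom_def)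
  obtain s where s: "s \<in> mod_hom A P ?F" and es: "\<And>p. p \<in> carrier P \<Longrightarrow> ?e (s p) = p"
    using proj[unfolded projective_module_def, THEN conjunct2, rule_format, OF F P' e' surj idP]
    by blast
  define h0 where "h0 p = (SOME m. m \<in> carrier M \<and> g m = f p)" for p
  have h0: "h0 p \<in> carrier M \<and> g (h0 p) = f p" if "p \<in> carrier P" for p
  proof -
    have "\<exists>m. m \<in> carrier M \<and> g m = f p" using g(2) mod_homD(1)[OF f that] by (metis imageE)
    then show ?thesis unfolding h0_def by (rule someI_ex)
  qed
  have h0': "h0 \<in> carrier P \<rightarrow> carrier M" using h0 by auto
  define h where "h p = lin_ext A M h0 (s p)" for p
  note L = mod_homD[OF lin_ext_hom[OF M h0']] and sD = mod_homD[OF s]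
  have "h \<in> mod_hom A P M"
    unfolding mod_hom_def h_def by (intro CollectI conjI ballI Pi_I) (simp_all add: L sD)
  moreover have "g (h p) = f p" if p: "p \<in> carrier P" for p
  proof -
    have "g (h p) = lin_ext A N (\<lambda>q. g (h0 q)) (s p)"
      unfolding h_def by (rule mod_hom_lin_ext[OF M N g(1) h0' sD(1)[OF p]])
    also have "\<dots> = lin_ext A N f (s p)"
    proof -
      interpret N: module A N by fact
      have "s p q \<in> carrier A" "{q. s p q \<noteq> \<zero>\<^bsub>A\<^esub>} \<subseteq> carrier P" for q
        using sD(1)[OF p] by (auto simp: free_module_def)
      then show ?thesis unfolding lin_ext_def using h0 mod_homD(1)[OF f]
        by (intro N.finsum_cong') (auto simp: subset_iff)
    qed
    also have "\<dots> = f (?e (s p))"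
      by (rule mod_hom_lin_ext[OF P N f _ sD(1)[OF p], symmetric]) auto
    finally show ?thesis using es[OF p] by simp
  qed
  ultimately show ?thesis by blast
qed

end

theory Submission
  imports Defs
begin

text \<open>
  Write \<open>E\<close> for \<open>E\<^sub>S(S/\<mm>)\<close> and \<open>F\<close> for \<open>E\<^sub>R(R/\<nn>)\<close>.  Every element of \<open>\<mm>\<close> acts locally nilpotently on \<open>E\<close>, so the annihilator \<open>V\<close> of \<open>\<nn>\<close>
  in \<open>E\<close> is essential in \<open>E\<close> over \<open>R\<close>; an element of \<open>Q\<^sub>2 \<inter> \<dots> \<inter> Q\<^sub>c\<close> outside \<open>\<mm>\<close> is injective on
  \<open>E\<close>, so \<open>V\<close> is also the annihilator of \<open>Q\<^sub>1\<close>.  Matlis duality over \<open>S\<close>, in the form of a count along a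
  chain of ideals from \<open>Q\<^sub>1\<close> to \<open>S\<close> with factors \<open>S/\<mm>\<close>, shows that \<open>V\<close> and \<open>S/Q\<^sub>1\<close> have the same length \<open>l\<close>
  over \<open>R\<close>.  As \<open>V\<close> is a vector space over \<open>R/\<nn>\<close>, it is mapped isomorphically onto the socle of \<open>F\<^sup>l\<close> by
  an \<open>R\<close>-linear map \<open>E \<rightarrow> F\<^sup>l\<close>, which is injective because \<open>V\<close> is essential.  Since \<open>S\<close> is projective over
  \<open>R\<close>, the module \<open>E\<close> satisfies Baer's criterion over \<open>R\<close>, and since its image in \<open>F\<^sup>l\<close> is essential, the map
  is onto.
\<close>

section \<open>Submodules and noetherian modules\<close>

text \<open>Lengths over \<open>R\<close> are counted by concatenating explicit chains
  (\<open>simple_chain\<close>). Each ideal step contributes the \<open>R\<close>-length of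
  \<open>S/\<mm>\<close> both to \<open>S/Q 1\<close> and to \<open>V\<close>, so that this number
  never has to be computed. The obstacle to surjectivity is that \<open>E\<close> is injective over
  \<open>S\<close>, while the extension is wanted over \<open>R\<close>. A dual basis of
  \<open>S\<close> turns an \<open>R\<close>-linear map from an ideal of \<open>R\<close> into an
  \<open>S\<close>-linear map from an ideal of \<open>S\<close>. The element of
  \<open>Q 2, ..., Q c\<close> outside \<mm> exists by incomparability: a component inside \<mm>
  would have radical \<mm>, as \<open>Q 1\<close> has. Incomparability and the maximality of \<nn>
  are facts about integral extensions; here they come from chains of \<open>R\<close>-submodules of
  \<open>S\<close>, which are stationary or of bounded length, and no integral equation is written
  down. The hulls are handled through a single element each, the image of \<open>1\<close>
  (\<open>essential_generator\<close>).\<close>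

definition adjoin ::
  "('a, 'r) ring_scheme \<Rightarrow> ('a, 'b, 'm) module_scheme \<Rightarrow> 'b set \<Rightarrow> 'b \<Rightarrow> 'b set" where
  "adjoin A M W b = {w \<oplus>\<^bsub>M\<^esub> r \<odot>\<^bsub>M\<^esub> b | w r. w \<in> W \<and> r \<in> carrier A}"

text \<open>The ascending chain condition, in the form that ideals of a noetherian ring satisfy by
  \<open>ideal_chain_is_trivial\<close>: a nonempty chain contains its union. The passage from
  submodules to ideals of coefficients is then immediate.\<close>

definition noetherian_submodule ::
  "('a, 'r) ring_scheme \<Rightarrow> ('a, 'b, 'm) module_scheme \<Rightarrow> 'b set \<Rightarrow> bool" where
  "noetherian_submodule A M W \<longleftrightarrow>
     (\<forall>\<C>. \<C> \<noteq> {} \<longrightarrow> subset.chain {U. submodule U A M \<and> U \<subseteq> W} \<C> \<longrightarrow> \<Union>\<C> \<in> \<C>)"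

lemma adjoinI: "w \<in> W \<Longrightarrow> r \<in> carrier A \<Longrightarrow> w \<oplus>\<^bsub>M\<^esub> r \<odot>\<^bsub>M\<^esub> b \<in> adjoin A M W b"
  by (auto simp: adjoin_def)

lemma adjoinE:
  assumes "x \<in> adjoin A M W b"
  obtains w r where "w \<in> W" "r \<in> carrier A" "x = w \<oplus>\<^bsub>M\<^esub> r \<odot>\<^bsub>M\<^esub> b"
  using assms by (auto simp: adjoin_def)

lemma ring_as_module_simps [simp]:
  "carrier (ring_as_module A) = carrier A"
  "\<zero>\<^bsub>ring_as_module A\<^esub> = \<zero>\<^bsub>A\<^esub>"
  "x \<oplus>\<^bsub>ring_as_module A\<^esub> y = x \<oplus>\<^bsub>A\<^esub> y"
  "r \<odot>\<^bsub>ring_as_module A\<^esub> x = r \<otimes>\<^bsub>A\<^esub> x"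
  by (simp_all add: ring_as_module_def)

lemma mod_homI:
  assumes "\<And>x. x \<in> carrier M \<Longrightarrow> h x \<in> carrier N"
    and "\<And>x y. x \<in> carrier M \<Longrightarrow> y \<in> carrier M \<Longrightarrow> h (x \<oplus>\<^bsub>M\<^esub> y) = h x \<oplus>\<^bsub>N\<^esub> h y"
    and "\<And>r x. r \<in> carrier A \<Longrightarrow> x \<in> carrier M \<Longrightarrow> h (r \<odot>\<^bsub>M\<^esub> x) = r \<odot>\<^bsub>N\<^esub> h x"
  shows "h \<in> mod_hom A M N"
  using assms by (auto simp: mod_hom_def)

context module
begin

lemma submoduleD:
  assumes "submodule U R M"
  shows "x \<in> U \<Longrightarrow> x \<in> carrier M" "\<zero>\<^bsub>M\<^esub> \<in> U" "x \<in> U \<Longrightarrow> y \<in> U \<Longrightarrow> x \<oplus>\<^bsub>M\<^esub> y \<in> U"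
    "r \<in> carrier R \<Longrightarrow> x \<in> U \<Longrightarrow> r \<odot>\<^bsub>M\<^esub> x \<in> U" "x \<in> U \<Longrightarrow> \<ominus>\<^bsub>M\<^esub> x \<in> U"
    "x \<in> U \<Longrightarrow> y \<in> U \<Longrightarrow> x \<ominus>\<^bsub>M\<^esub> y \<in> U"
proof -
  show 1: "x \<in> U \<Longrightarrow> x \<in> carrier M" for x using submoduleE(1)[OF assms] by auto
  show "x \<in> U \<Longrightarrow> y \<in> U \<Longrightarrow> x \<oplus>\<^bsub>M\<^esub> y \<in> U" "r \<in> carrier R \<Longrightarrow> x \<in> U \<Longrightarrow> r \<odot>\<^bsub>M\<^esub> x \<in> U"
    "x \<in> U \<Longrightarrow> \<ominus>\<^bsub>M\<^esub> x \<in> U" "x \<in> U \<Longrightarrow> y \<in> U \<Longrightarrow> x \<ominus>\<^bsub>M\<^esub> y \<in> U"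
    using submoduleE[OF assms] by (auto simp: a_minus_def)
  show "\<zero>\<^bsub>M\<^esub> \<in> U"
    using submoduleE(2)[OF assms] submoduleE(4)[OF assms, of "\<zero>\<^bsub>R\<^esub>"] 1 by (metis all_not_in_conv R.zero_closed smult_l_null)
qed

lemma submoduleI':
  assumes "\<And>x. x \<in> H \<Longrightarrow> x \<in> carrier M" "\<zero>\<^bsub>M\<^esub> \<in> H"
    and "\<And>a b. a \<in> H \<Longrightarrow> b \<in> H \<Longrightarrow> a \<oplus>\<^bsub>M\<^esub> b \<in> H"
    and "\<And>r x. r \<in> carrier R \<Longrightarrow> x \<in> H \<Longrightarrow> r \<odot>\<^bsub>M\<^esub> x \<in> H"
  shows "submodule H R M"
proof (rule submoduleI)
  show "\<ominus>\<^bsub>M\<^esub> a \<in> H" if "a \<in> H" for a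
    using assms(4)[of "\<ominus>\<^bsub>R\<^esub> \<one>\<^bsub>R\<^esub>" a] that assms(1) by (simp add: smult_l_minus)
qed (use assms in auto)

lemma zero_submodule: "submodule {\<zero>\<^bsub>M\<^esub>} R M"
  by (rule submoduleI') auto

lemma submodule_Int:
  assumes "submodule U R M" "submodule V R M"
  shows "submodule (U \<inter> V) R M"
  by (rule submoduleI') (use submoduleD[OF assms(1)] submoduleD[OF assms(2)] in auto)

lemma smult_diff:
  assumes "r \<in> carrier R" "s \<in> carrier R" "x \<in> carrier M"
  shows "(r \<ominus>\<^bsub>R\<^esub> s) \<odot>\<^bsub>M\<^esub> x = r \<odot>\<^bsub>M\<^esub> x \<ominus>\<^bsub>M\<^esub> s \<odot>\<^bsub>M\<^esub> x"
  using assms by (simp add: R.minus_eq M.minus_eq smult_l_distr smult_l_minus)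

lemma add_diff_cancel:
  "x \<in> carrier M \<Longrightarrow> y \<in> carrier M \<Longrightarrow> (x \<oplus>\<^bsub>M\<^esub> y) \<ominus>\<^bsub>M\<^esub> y = x"
  by (simp add: M.minus_eq M.a_assoc M.r_neg)

lemma adjoin_submodule:
  assumes W: "submodule W R M" and b: "b \<in> carrier M"
  shows "submodule (adjoin R M W b) R M"
proof (rule submoduleI')
  note D = submoduleD[OF W]
  fix x assume x: "x \<in> adjoin R M W b"
  then obtain w r where 1: "w \<in> W" "r \<in> carrier R" "x = w \<oplus>\<^bsub>M\<^esub> r \<odot>\<^bsub>M\<^esub> b" by (rule adjoinE)
  show "x \<in> carrier M" using 1 D b by simp
  { fix y assume "y \<in> adjoin R M W b"
    then obtain v s where 2: "v \<in> W" "s \<in> carrier R" "y = v \<oplus>\<^bsub>M\<^esub> s \<odot>\<^bsub>M\<^esub> b" by (rule adjoinE)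
    have "x \<oplus>\<^bsub>M\<^esub> y = (w \<oplus>\<^bsub>M\<^esub> v) \<oplus>\<^bsub>M\<^esub> (r \<oplus>\<^bsub>R\<^esub> s) \<odot>\<^bsub>M\<^esub> b"
      using 1 2 D(1) b by (simp add: smult_l_distr M.a_ac)
    then show "x \<oplus>\<^bsub>M\<^esub> y \<in> adjoin R M W b" using 1 2 D by (auto intro: adjoinI) }
  { fix s assume s: "s \<in> carrier R"
    have "s \<odot>\<^bsub>M\<^esub> x = s \<odot>\<^bsub>M\<^esub> w \<oplus>\<^bsub>M\<^esub> (s \<otimes>\<^bsub>R\<^esub> r) \<odot>\<^bsub>M\<^esub> b"
      using 1 s D(1) b by (simp add: smult_r_distr smult_assoc1)
    then show "s \<odot>\<^bsub>M\<^esub> x \<in> adjoin R M W b" using 1 s D by (auto intro: adjoinI) }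
next
  have "\<zero>\<^bsub>M\<^esub> \<oplus>\<^bsub>M\<^esub> \<zero>\<^bsub>R\<^esub> \<odot>\<^bsub>M\<^esub> b \<in> adjoin R M W b" by (intro adjoinI submoduleD[OF W]) simp
  then show "\<zero>\<^bsub>M\<^esub> \<in> adjoin R M W b" using b by simp
qed

lemma subset_adjoin:
  assumes "submodule W R M" and "b \<in> carrier M"
  shows "W \<subseteq> adjoin R M W b"
proof
  fix w assume w: "w \<in> W"
  have "w \<oplus>\<^bsub>M\<^esub> \<zero>\<^bsub>R\<^esub> \<odot>\<^bsub>M\<^esub> b \<in> adjoin R M W b" by (intro adjoinI w) simp
  then show "w \<in> adjoin R M W b" using assms(2) submoduleD(1)[OF assms(1) w] by simp
qed

lemma adjoin_self:
  assumes "submodule W R M" and "b \<in> carrier M"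
  shows "b \<in> adjoin R M W b"
proof -
  have "\<zero>\<^bsub>M\<^esub> \<oplus>\<^bsub>M\<^esub> \<one>\<^bsub>R\<^esub> \<odot>\<^bsub>M\<^esub> b \<in> adjoin R M W b" by (intro adjoinI submoduleD[OF assms(1)]) simp
  then show ?thesis using assms(2) by simp
qed

lemma adjoin_least:
  assumes "submodule U R M" "W \<subseteq> U" "b \<in> U"
  shows "adjoin R M W b \<subseteq> U"
  using submoduleD[OF assms(1)] assms(2,3) by (auto simp: adjoin_def)

text \<open>Finite generation, defined by an intersection, gives no expressions for elements.
  Adjoining the generators one at a time leads to a submodule that contains them all, and such a
  submodule is everything. The start \<open>W0\<close> is arbitrary so that chains above a given
  submodule can be built too.\<close>

lemma fin_gen_module_induct:
  assumes fg: "fin_gen_module R M" and W0: "submodule W0 R M" "P W0"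
    and step: "\<And>W b. submodule W R M \<Longrightarrow> W0 \<subseteq> W \<Longrightarrow> P W \<Longrightarrow> b \<in> carrier M \<Longrightarrow> P (adjoin R M W b)"
  shows "P (carrier M)"
proof -
  obtain C where C: "finite C" "C \<subseteq> carrier M" "\<Inter>{U. submodule U R M \<and> C \<subseteq> U} = carrier M"
    using fg by (auto simp: fin_gen_module_def)
  from C(1,2) have "\<exists>W. submodule W R M \<and> W0 \<subseteq> W \<and> P W \<and> C \<subseteq> W"
  proof (induction C rule: finite_induct)
    case empty then show ?case using W0 by auto
  next
    case (insert x C)
    then obtain W where W: "submodule W R M" "W0 \<subseteq> W" "P W" "C \<subseteq> W" by auto
    have x: "x \<in> carrier M" using insert by simp
    show ?case
      using step[OF W(1-3) x] adjoin_submodule[OF W(1) x] subset_adjoin[OF W(1) x] adjoin_self[OF W(1) x] W(2,4)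
      by (intro exI[of _ "adjoin R M W x"]) auto
  qed
  then obtain W where W: "submodule W R M" "P W" "C \<subseteq> W" by auto
  then have "W = carrier M" using C(3) submoduleD(1)[OF W(1)] by blast
  then show ?thesis using W(2) by simp
qed

lemma noetherian_submodule_zero: "noetherian_submodule R M {\<zero>\<^bsub>M\<^esub>}"
  unfolding noetherian_submodule_def
proof (intro allI impI)
  fix \<C> :: "'c set set" assume "\<C> \<noteq> {}" and "subset.chain {U. submodule U R M \<and> U \<subseteq> {\<zero>\<^bsub>M\<^esub>}} \<C>"
  then have "U = {\<zero>\<^bsub>M\<^esub>}" if "U \<in> \<C>" for U
    using that submoduleD(2) by (fastforce simp: subset_chain_def)
  then have "\<C> = {{\<zero>\<^bsub>M\<^esub>}}" using \<open>\<C> \<noteq> {}\<close> by auto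
  then show "\<Union>\<C> \<in> \<C>" by simp
qed

lemma idealI':
  assumes "\<And>x. x \<in> I \<Longrightarrow> x \<in> carrier R" "\<zero>\<^bsub>R\<^esub> \<in> I"
    and "\<And>a b. a \<in> I \<Longrightarrow> b \<in> I \<Longrightarrow> a \<oplus>\<^bsub>R\<^esub> b \<in> I"
    and "\<And>r x. r \<in> carrier R \<Longrightarrow> x \<in> I \<Longrightarrow> r \<otimes>\<^bsub>R\<^esub> x \<in> I"
  shows "ideal I R"
proof (rule idealI)
  show "subgroup I (add_monoid R)"
  proof (rule R.add.subgroupI)
    show "\<ominus>\<^bsub>R\<^esub> a \<in> I" if "a \<in> I" for a
      using assms(4)[of "\<ominus>\<^bsub>R\<^esub> \<one>\<^bsub>R\<^esub>" a] that assms(1) by (simp add: R.l_minus)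
  qed (use assms in auto)
  show "x \<otimes>\<^bsub>R\<^esub> a \<in> I" if "a \<in> I" "x \<in> carrier R" for a x using assms(4) that by simp
  show "a \<otimes>\<^bsub>R\<^esub> x \<in> I" if "a \<in> I" "x \<in> carrier R" for a x
    using assms(4)[of x a] assms(1) that by (simp add: R.m_comm)
qed (rule R.ring_axioms)

text \<open>Two nested submodules of \<open>W + Rb\<close> coincide once they have the same ideal of
  coefficients at \<open>b\<close> and the same intersection with \<open>W\<close>. Both families
  are chains that attain their union, the first because \<open>R\<close> is noetherian, the second
  by the assumption on \<open>W\<close>.\<close>

lemma noetherian_submodule_adjoin:
  assumes R: "noetherian_ring R" and W: "submodule W R M" "noetherian_submodule R M W" and b: "b \<in> carrier M"
  shows "noetherian_submodule R M (adjoin R M W b)"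
  unfolding noetherian_submodule_def
proof (intro allI impI)
  interpret noetherian_ring R by fact
  fix \<C> assume ne: "\<C> \<noteq> {}" and "subset.chain {U. submodule U R M \<and> U \<subseteq> adjoin R M W b} \<C>"
  then have sub: "\<And>U. U \<in> \<C> \<Longrightarrow> submodule U R M" "\<And>U. U \<in> \<C> \<Longrightarrow> U \<subseteq> adjoin R M W b"
    and tot: "\<And>U V. U \<in> \<C> \<Longrightarrow> V \<in> \<C> \<Longrightarrow> U \<subseteq> V \<or> V \<subseteq> U"
    by (auto simp: subset_chain_def)
  note WD = submoduleD[OF W(1)]
  \<comment> \<open>The ideal of coefficients: the preimage, under
    \<open>r \<mapsto> r b + W\<close>, of the image of \<open>U\<close> in
    \<open>(W + Rb)/W\<close>.\<close>
  define J where "J U = {r \<in> carrier R. \<exists>w\<in>W. w \<oplus>\<^bsub>M\<^esub> r \<odot>\<^bsub>M\<^esub> b \<in> U}" for U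
  have mono: "J U \<subseteq> J V" if "U \<subseteq> V" for U V using that by (auto simp: J_def)
  have J: "ideal (J U) R" if "U \<in> \<C>" for U
  proof (rule idealI')
    note UD = submoduleD[OF sub(1)[OF that]]
    show "\<zero>\<^bsub>R\<^esub> \<in> J U" using UD(2) WD(2) b by (auto simp: J_def intro!: bexI[of _ "\<zero>\<^bsub>M\<^esub>"])
    show "x \<in> carrier R" if "x \<in> J U" for x using that by (simp add: J_def)
    fix r assume "r \<in> J U"
    then obtain w where r: "r \<in> carrier R" "w \<in> W" "w \<oplus>\<^bsub>M\<^esub> r \<odot>\<^bsub>M\<^esub> b \<in> U" by (auto simp: J_def)
    { fix s assume "s \<in> J U"
      then obtain v where s: "s \<in> carrier R" "v \<in> W" "v \<oplus>\<^bsub>M\<^esub> s \<odot>\<^bsub>M\<^esub> b \<in> U" by (auto simp: J_def)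
      have "(w \<oplus>\<^bsub>M\<^esub> v) \<oplus>\<^bsub>M\<^esub> (r \<oplus>\<^bsub>R\<^esub> s) \<odot>\<^bsub>M\<^esub> b = (w \<oplus>\<^bsub>M\<^esub> r \<odot>\<^bsub>M\<^esub> b) \<oplus>\<^bsub>M\<^esub> (v \<oplus>\<^bsub>M\<^esub> s \<odot>\<^bsub>M\<^esub> b)"
        using r s WD(1) b by (simp add: smult_l_distr M.a_ac)
      then have "(w \<oplus>\<^bsub>M\<^esub> v) \<oplus>\<^bsub>M\<^esub> (r \<oplus>\<^bsub>R\<^esub> s) \<odot>\<^bsub>M\<^esub> b \<in> U" using UD(3)[OF r(3) s(3)] by simp
      then show "r \<oplus>\<^bsub>R\<^esub> s \<in> J U" using r s WD(3) by (auto simp: J_def) }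
    { fix s assume s: "s \<in> carrier R"
      have "s \<odot>\<^bsub>M\<^esub> w \<oplus>\<^bsub>M\<^esub> (s \<otimes>\<^bsub>R\<^esub> r) \<odot>\<^bsub>M\<^esub> b = s \<odot>\<^bsub>M\<^esub> (w \<oplus>\<^bsub>M\<^esub> r \<odot>\<^bsub>M\<^esub> b)"
        using r s WD(1) b by (simp add: smult_r_distr smult_assoc1)
      then have "s \<odot>\<^bsub>M\<^esub> w \<oplus>\<^bsub>M\<^esub> (s \<otimes>\<^bsub>R\<^esub> r) \<odot>\<^bsub>M\<^esub> b \<in> U" using UD(4)[OF s r(3)] by simp
      then show "s \<otimes>\<^bsub>R\<^esub> r \<in> J U" using r s WD(4) by (auto simp: J_def) }
  qed
  have "\<Union>(J ` \<C>) \<in> J ` \<C>"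
  proof (rule ideal_chain_is_trivial)
    show "subset.chain {I. ideal I R} (J ` \<C>)"
      unfolding subset_chain_def
    proof (intro conjI ballI)
      fix I1 I2 assume "I1 \<in> J ` \<C>" "I2 \<in> J ` \<C>"
      then obtain V1 V2 where "V1 \<in> \<C>" "V2 \<in> \<C>" "I1 = J V1" "I2 = J V2" by auto
      then show "I1 \<subseteq> I2 \<or> I2 \<subseteq> I1" using tot[of V1 V2] mono by auto
    qed (use J in auto)
  qed (use ne in auto)
  then obtain U1 where U1: "U1 \<in> \<C>" "\<Union>(J ` \<C>) = J U1" by auto
  have "\<Union>((\<lambda>U. U \<inter> W) ` \<C>) \<in> (\<lambda>U. U \<inter> W) ` \<C>"
  proof (rule W(2)[unfolded noetherian_submodule_def, rule_format])
    show "subset.chain {U. submodule U R M \<and> U \<subseteq> W} ((\<lambda>U. U \<inter> W) ` \<C>)"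
      unfolding subset_chain_def
    proof (intro conjI ballI)
      fix I1 I2 assume "I1 \<in> (\<lambda>U. U \<inter> W) ` \<C>" "I2 \<in> (\<lambda>U. U \<inter> W) ` \<C>"
      then obtain V1 V2 where "V1 \<in> \<C>" "V2 \<in> \<C>" "I1 = V1 \<inter> W" "I2 = V2 \<inter> W" by auto
      then show "I1 \<subseteq> I2 \<or> I2 \<subseteq> I1" using tot[of V1 V2] by auto
    qed (use submodule_Int[OF sub(1) W(1)] in auto)
  qed (use ne in auto)
  then obtain U2 where U2: "U2 \<in> \<C>" "\<Union>((\<lambda>U. U \<inter> W) ` \<C>) = U2 \<inter> W" by blast
  define V where "V = (if U1 \<subseteq> U2 then U2 else U1)"
  have V: "V \<in> \<C>" "U1 \<subseteq> V" "U2 \<subseteq> V" using U1(1) U2(1) tot[OF U1(1) U2(1)] by (auto simp: V_def)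
  note VD = submoduleD[OF sub(1)[OF V(1)]]
  have "U \<subseteq> V" if U: "U \<in> \<C>" for U
  proof (rule ccontr)
    assume "\<not> U \<subseteq> V"
    then have VU: "V \<subseteq> U" using tot U V by blast
    obtain u where u: "u \<in> U" "u \<notin> V" using \<open>\<not> U \<subseteq> V\<close> by auto
    note UD = submoduleD[OF sub(1)[OF U]]
    obtain w r where 1: "w \<in> W" "r \<in> carrier R" "u = w \<oplus>\<^bsub>M\<^esub> r \<odot>\<^bsub>M\<^esub> b"
      using u sub(2)[OF U] by (meson adjoinE subsetD)
    have "r \<in> J U" using 1 u by (auto simp: J_def)
    then have "r \<in> J V" using U U1(2) mono[OF V(2)] by auto
    then obtain v where v: "v \<in> W" "v \<oplus>\<^bsub>M\<^esub> r \<odot>\<^bsub>M\<^esub> b \<in> V" by (auto simp: J_def)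
    \<comment> \<open>\<open>u\<close> and \<open>v + r b\<close> have the same coefficient at
      \<open>b\<close>, so their difference \<open>w - v\<close> lies in
      \<open>U \<inter> W\<close>, which is contained in \<open>U2 \<inter> W\<close> and hence in
      \<open>V\<close>.\<close>
    have sum: "(w \<ominus>\<^bsub>M\<^esub> v) \<oplus>\<^bsub>M\<^esub> (v \<oplus>\<^bsub>M\<^esub> r \<odot>\<^bsub>M\<^esub> b) = u"
      using 1 v WD(1) b by (simp add: M.minus_eq M.a_assoc M.r_neg1)
    then have eq: "w \<ominus>\<^bsub>M\<^esub> v = u \<ominus>\<^bsub>M\<^esub> (v \<oplus>\<^bsub>M\<^esub> r \<odot>\<^bsub>M\<^esub> b)"
      using add_diff_cancel[of "w \<ominus>\<^bsub>M\<^esub> v" "v \<oplus>\<^bsub>M\<^esub> r \<odot>\<^bsub>M\<^esub> b"] 1 v WD(1) b by simp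
    have "w \<ominus>\<^bsub>M\<^esub> v \<in> U" unfolding eq using UD(6) u v VU by auto
    then have "w \<ominus>\<^bsub>M\<^esub> v \<in> U2 \<inter> W" using U2(2) U WD(6)[OF 1(1) v(1)] by blast
    then have "w \<ominus>\<^bsub>M\<^esub> v \<in> V" using V by auto
    then have "(w \<ominus>\<^bsub>M\<^esub> v) \<oplus>\<^bsub>M\<^esub> (v \<oplus>\<^bsub>M\<^esub> r \<odot>\<^bsub>M\<^esub> b) \<in> V" using VD(3) v(2) by blast
    then show False using u sum by simp
  qed
  then have "\<Union>\<C> = V" using V(1) by blast
  then show "\<Union>\<C> \<in> \<C>" using V(1) by simp
qed

lemma noetherian_submodule_carrier:
  assumes "noetherian_ring R" "fin_gen_module R M"
  shows "noetherian_submodule R M (carrier M)"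
  by (rule fin_gen_module_induct[where P = "noetherian_submodule R M", OF assms(2) zero_submodule noetherian_submodule_zero])
    (rule noetherian_submodule_adjoin[OF assms(1)])

end

lemma ideal_exists_maximal:
  assumes "noetherian_ring A" "\<A> \<noteq> {}" "\<And>I. I \<in> \<A> \<Longrightarrow> ideal I A"
  obtains I where "I \<in> \<A>" "\<And>J. J \<in> \<A> \<Longrightarrow> I \<subseteq> J \<Longrightarrow> J = I"
proof -
  interpret noetherian_ring A by fact
  have "\<exists>I\<in>\<A>. \<forall>J\<in>\<A>. I \<subseteq> J \<longrightarrow> J = I"
  proof (rule subset_Zorn_nonempty[OF assms(2)])
    fix \<C> assume C: "\<C> \<noteq> {}" "subset.chain \<A> \<C>"
    then have "subset.chain {I. ideal I A} \<C>" using assms(3) by (auto simp: subset_chain_def)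
    then have "\<Union>\<C> \<in> \<C>" using C ideal_chain_is_trivial by blast
    then show "\<Union>\<C> \<in> \<A>" using C by (auto simp: subset_chain_def)
  qed
  then show thesis using that by blast
qed

section \<open>Chains with simple factors\<close>

text \<open>A composition series above \<open>W0\<close>. For a maximal ideal \<open>I\<close> each
  factor is isomorphic to \<open>A/I\<close>, because the new element lies outside \<open>W\<close>
  and is killed by \<open>I\<close> modulo \<open>W\<close>. As a relation indexed by the number of
  steps it can be concatenated and transported by induction.\<close>

inductive simple_chain ::
  "('a, 'r) ring_scheme \<Rightarrow> ('a, 'b, 'm) module_scheme \<Rightarrow> 'a set \<Rightarrow> 'b set \<Rightarrow> nat \<Rightarrow> 'b set \<Rightarrow> bool"
  for A M I W0 where
  zero: "simple_chain A M I W0 0 W0"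
| step: "simple_chain A M I W0 l W \<Longrightarrow> b \<in> carrier M \<Longrightarrow> b \<notin> W \<Longrightarrow> (\<And>r. r \<in> I \<Longrightarrow> r \<odot>\<^bsub>M\<^esub> b \<in> W) \<Longrightarrow>
    simple_chain A M I W0 (Suc l) (adjoin A M W b)"

lemma simple_chain_trans:
  assumes "simple_chain A M I W1 q W2" "simple_chain A M I W0 p W1"
  shows "simple_chain A M I W0 (p + q) W2"
  using assms by (induction rule: simple_chain.induct) (auto intro: simple_chain.intros)

text \<open>Division in the field \<open>A/I\<close>, phrased as a congruence so that no quotient
  ring is formed: \<open>I + Aa\<close> is the unit ideal.\<close>

lemma maximalideal_inverse:
  assumes "cring A" "maximalideal I A" "a \<in> carrier A" "a \<notin> I"
  obtains b where "b \<in> carrier A" "b \<otimes>\<^bsub>A\<^esub> a \<ominus>\<^bsub>A\<^esub> \<one>\<^bsub>A\<^esub> \<in> I"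
proof -
  interpret cring A by fact
  interpret maximalideal I A by fact
  have A: "module A (ring_as_module A)" by (rule module_ring_as_module) fact
  interpret A: module A "ring_as_module A" by (rule A)
  let ?J = "adjoin A (ring_as_module A) I a"
  have I: "submodule I A (ring_as_module A)"
    by (rule A.submoduleI') (auto intro: I_l_closed)
  have J: "submodule ?J A (ring_as_module A)" "I \<subseteq> ?J" "a \<in> ?J"
    using A.adjoin_submodule[OF I] A.subset_adjoin[OF I] A.adjoin_self[OF I] assms(3) by auto
  have "ideal ?J A" by (rule A.idealI') (use A.submoduleD[OF J(1)] in auto)
  then have "?J = carrier A" using I_maximal[of ?J] J A.submoduleD(1)[OF J(1)] assms(4) by auto
  then obtain i b where b: "i \<in> I" "b \<in> carrier A" "\<one>\<^bsub>A\<^esub> = i \<oplus>\<^bsub>A\<^esub> b \<otimes>\<^bsub>A\<^esub> a"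
    using adjoinE[of "\<one>\<^bsub>A\<^esub>" A "ring_as_module A" I a] by auto
  have "b \<otimes>\<^bsub>A\<^esub> a \<ominus>\<^bsub>A\<^esub> \<one>\<^bsub>A\<^esub> = \<ominus>\<^bsub>A\<^esub> i"
    unfolding b(3) using b(1,2) assms(3) by (simp add: minus_eq minus_add r_neg1 a_comm Icarr)
      (simp add: Icarr a_lcomm r_neg)
  then show thesis using that b by simp
qed

context module
begin

lemma simple_chain_submodule:
  assumes "simple_chain R M I W0 l W" "submodule W0 R M"
  shows "submodule W R M \<and> W0 \<subseteq> W"
  using assms by (induction rule: simple_chain.induct) (use adjoin_submodule subset_adjoin in blast)+

text \<open>By \<open>ker\<close> the map induces an injection of \<open>M/W0\<close> into
  \<open>N/N0\<close>, and this carries simple factors to simple factors. The summand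
  \<open>N0\<close> is there because the image of \<open>W\<close> alone need not contain
  \<open>N0\<close>.\<close>

lemma simple_chain_map:
  assumes N: "module R N" and h: "h \<in> mod_hom R M N"
    and W0: "submodule W0 R M" and N0: "submodule N0 R N"
    and ker: "\<And>x. x \<in> carrier M \<Longrightarrow> h x \<in> N0 \<longleftrightarrow> x \<in> W0"
    and ch: "simple_chain R M I W0 l W" and I: "I \<subseteq> carrier R"
  shows "simple_chain R N I N0 l {y \<oplus>\<^bsub>N\<^esub> h w | y w. y \<in> N0 \<and> w \<in> W}"
proof -
  interpret N: module R N by fact
  note hD = mod_homD[OF h] and ND = N.submoduleD[OF N0]
  define T where "T W = {y \<oplus>\<^bsub>N\<^esub> h w | y w. y \<in> N0 \<and> w \<in> W}" for W
  have "simple_chain R N I N0 l (T W)" using ch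
  proof (induction rule: simple_chain.induct)
    case zero
    have "T W0 = N0"
    proof (intro equalityI subsetI)
      show "x \<in> N0" if "x \<in> T W0" for x
        using that ker submoduleD(1)[OF W0] ND(3) by (auto simp: T_def)
      show "x \<in> T W0" if x: "x \<in> N0" for x
      proof -
        have "h \<zero>\<^bsub>M\<^esub> = \<zero>\<^bsub>N\<^esub>" by (rule mod_hom_zero[OF module_axioms N h])
        then have "x = x \<oplus>\<^bsub>N\<^esub> h \<zero>\<^bsub>M\<^esub>" using ND(1)[OF x] by simp
        then show ?thesis unfolding T_def using x submoduleD(2)[OF W0] by blast
      qed
    qed
    then show ?case by (simp add: simple_chain.zero)
  next
    case (step l W b)
    have W: "submodule W R M" "W0 \<subseteq> W" using simple_chain_submodule[OF step(1) W0] by auto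
    note WD = submoduleD[OF W(1)]
    have "T (adjoin R M W b) = adjoin R N (T W) (h b)"
    proof (intro equalityI subsetI)
      fix x assume "x \<in> T (adjoin R M W b)"
      then obtain y w r where 1: "y \<in> N0" "w \<in> W" "r \<in> carrier R" "x = y \<oplus>\<^bsub>N\<^esub> h (w \<oplus>\<^bsub>M\<^esub> r \<odot>\<^bsub>M\<^esub> b)"
        by (auto simp: T_def adjoin_def)
      then have "x = (y \<oplus>\<^bsub>N\<^esub> h w) \<oplus>\<^bsub>N\<^esub> r \<odot>\<^bsub>N\<^esub> h b"
        using hD WD(1) ND(1) step by (simp add: N.a_assoc)
      then show "x \<in> adjoin R N (T W) (h b)" using 1 by (auto simp: T_def intro: adjoinI)
    next
      fix x assume "x \<in> adjoin R N (T W) (h b)"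
      then obtain y w r where 1: "y \<in> N0" "w \<in> W" "r \<in> carrier R" "x = (y \<oplus>\<^bsub>N\<^esub> h w) \<oplus>\<^bsub>N\<^esub> r \<odot>\<^bsub>N\<^esub> h b"
        by (auto simp: T_def adjoin_def)
      then have "x = y \<oplus>\<^bsub>N\<^esub> h (w \<oplus>\<^bsub>M\<^esub> r \<odot>\<^bsub>M\<^esub> b)"
        using hD WD(1) ND(1) step by (simp add: N.a_assoc)
      then show "x \<in> T (adjoin R M W b)" using 1 by (auto simp: T_def intro: adjoinI)
    qed
    moreover have "simple_chain R N I N0 (Suc l) (adjoin R N (T W) (h b))"
    proof (rule simple_chain.step[OF step.IH])
      show "h b \<in> carrier N" using hD step by simp
      \<comment> \<open>If \<open>h b = y + h w\<close>, then \<open>b - w\<close> is mapped into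
        \<open>N0\<close>, so it lies in \<open>W0 \<subseteq> W\<close>, and \<open>b\<close> would
        lie in \<open>W\<close>.\<close>
      show "h b \<notin> T W"
      proof
        assume "h b \<in> T W"
        then obtain y w where 1: "y \<in> N0" "w \<in> W" "h b = y \<oplus>\<^bsub>N\<^esub> h w" by (auto simp: T_def)
        have hm: "h (\<ominus>\<^bsub>M\<^esub> w) = \<ominus>\<^bsub>N\<^esub> h w"
          using hD(3)[of "\<ominus>\<^bsub>R\<^esub> \<one>\<^bsub>R\<^esub>" w] hD(1)[of w] WD(1)[OF 1(2)] by (simp add: smult_l_minus N.smult_l_minus)
        have "h (b \<ominus>\<^bsub>M\<^esub> w) = (y \<oplus>\<^bsub>N\<^esub> h w) \<ominus>\<^bsub>N\<^esub> h w"
          using hD WD(1)[OF 1(2)] step hm 1(3) by (simp add: M.minus_eq N.minus_eq)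
        then have "h (b \<ominus>\<^bsub>M\<^esub> w) = y" using N.add_diff_cancel[of y "h w"] ND(1) 1 WD(1) hD by simp
        then have "b \<ominus>\<^bsub>M\<^esub> w \<in> W" using ker 1 WD(1) step W(2) by auto
        then have "(b \<ominus>\<^bsub>M\<^esub> w) \<oplus>\<^bsub>M\<^esub> w \<in> W" using WD(3) 1 by blast
        then show False using step 1 WD(1) by (simp add: M.minus_eq M.a_assoc M.l_neg)
      qed
      show "r \<odot>\<^bsub>N\<^esub> h b \<in> T W" if "r \<in> I" for r
      proof -
        have "r \<odot>\<^bsub>N\<^esub> h b = \<zero>\<^bsub>N\<^esub> \<oplus>\<^bsub>N\<^esub> h (r \<odot>\<^bsub>M\<^esub> b)" using hD that step I by auto
        then show ?thesis using step(4)[OF that] ND(2) unfolding T_def by blast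
      qed
    qed
    ultimately show ?case by simp
  qed
  then show ?thesis by (simp add: T_def)
qed

text \<open>Adjoining a generator either changes nothing or adds exactly one simple factor, since
  \<open>I\<close> maps all of \<open>M\<close> into \<open>W0\<close>.\<close>

lemma simple_chain_exists:
  assumes fg: "fin_gen_module R M" and W0: "submodule W0 R M"
    and I: "\<And>r x. r \<in> I \<Longrightarrow> x \<in> carrier M \<Longrightarrow> r \<odot>\<^bsub>M\<^esub> x \<in> W0"
  obtains l where "simple_chain R M I W0 l (carrier M)"
proof -
  have "\<exists>l. simple_chain R M I W0 l (carrier M)"
  proof (rule fin_gen_module_induct[where P = "\<lambda>W. \<exists>l. simple_chain R M I W0 l W", OF fg W0])
    show "\<exists>l. simple_chain R M I W0 l W0" using simple_chain.zero by blast
    fix W b assume W: "submodule W R M" "W0 \<subseteq> W" "\<exists>l. simple_chain R M I W0 l W" and b: "b \<in> carrier M"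
    show "\<exists>l. simple_chain R M I W0 l (adjoin R M W b)"
    proof (cases "b \<in> W")
      case True
      then have "adjoin R M W b = W"
        using adjoin_least[OF W(1) order_refl True] subset_adjoin[OF W(1) b] by auto
      then show ?thesis using W(3) by simp
    next
      case False
      then show ?thesis using W I[OF _ b] b by (blast intro: simple_chain.step)
    qed
  qed
  then show thesis using that by blast
qed

text \<open>\<open>(W + Rb)/W\<close> is at most one-dimensional over the field \<open>R/I\<close>,
  so each nonzero vector \<open>u = w + r b\<close> generates it; \<open>s\<close> is an inverse of
  \<open>r\<close> modulo \<open>I\<close>.\<close>

lemma adjoin_simple:
  assumes I: "maximalideal I R" and W: "submodule W R M" and b: "b \<in> carrier M"
    and Ib: "\<And>r. r \<in> I \<Longrightarrow> r \<odot>\<^bsub>M\<^esub> b \<in> W" and u: "u \<in> adjoin R M W b" "u \<notin> W"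
  obtains s where "s \<in> carrier R" "b \<ominus>\<^bsub>M\<^esub> s \<odot>\<^bsub>M\<^esub> u \<in> W"
proof -
  note WD = submoduleD[OF W]
  obtain w r where w: "w \<in> W" "r \<in> carrier R" "u = w \<oplus>\<^bsub>M\<^esub> r \<odot>\<^bsub>M\<^esub> b" using u(1) by (rule adjoinE)
  have "r \<notin> I" using w u(2) Ib WD(3) by auto
  then obtain s where s: "s \<in> carrier R" "s \<otimes>\<^bsub>R\<^esub> r \<ominus>\<^bsub>R\<^esub> \<one>\<^bsub>R\<^esub> \<in> I"
    using maximalideal_inverse[OF R.is_cring I w(2)] by blast
  define z where "z = (s \<otimes>\<^bsub>R\<^esub> r) \<odot>\<^bsub>M\<^esub> b \<ominus>\<^bsub>M\<^esub> b"
  have z: "z \<in> W" using Ib[OF s(2)] s w b smult_diff[of "s \<otimes>\<^bsub>R\<^esub> r" "\<one>\<^bsub>R\<^esub>" b] by (simp add: z_def)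
  have "s \<odot>\<^bsub>M\<^esub> u = s \<odot>\<^bsub>M\<^esub> w \<oplus>\<^bsub>M\<^esub> (s \<otimes>\<^bsub>R\<^esub> r) \<odot>\<^bsub>M\<^esub> b"
    using s w b WD(1) by (simp add: smult_r_distr smult_assoc1)
  moreover have "(s \<otimes>\<^bsub>R\<^esub> r) \<odot>\<^bsub>M\<^esub> b = z \<oplus>\<^bsub>M\<^esub> b"
    using s w b by (simp add: z_def M.minus_eq M.a_assoc M.l_neg)
  ultimately have su: "s \<odot>\<^bsub>M\<^esub> u = (s \<odot>\<^bsub>M\<^esub> w \<oplus>\<^bsub>M\<^esub> z) \<oplus>\<^bsub>M\<^esub> b"
    using s w b WD(1) z by (simp add: M.a_assoc)
  have "b \<ominus>\<^bsub>M\<^esub> s \<odot>\<^bsub>M\<^esub> u = \<ominus>\<^bsub>M\<^esub> (s \<odot>\<^bsub>M\<^esub> w \<oplus>\<^bsub>M\<^esub> z)"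
    unfolding su using s w b WD(1) z
    by (simp add: M.minus_eq M.minus_add M.a_lcomm[of b] M.r_neg)
  then show thesis using that[OF s(1)] WD z s w by simp
qed

text \<open>The bound in the Jordan-Hoelder theorem. A chain inside \<open>W + Rb\<close> is
  intersected with \<open>W\<close>; this destroys at most one inclusion, because a member not
  contained in \<open>W\<close> already contains a generator of \<open>W + Rb\<close> modulo
  \<open>W\<close>.\<close>

lemma simple_chain_length_le:
  assumes I: "maximalideal I R" and W0: "submodule W0 R M"
  shows "simple_chain R M I W0 l W \<Longrightarrow>
    (\<And>i. i \<le> p \<Longrightarrow> submodule (C i) R M \<and> W0 \<subseteq> C i \<and> C i \<subseteq> W) \<Longrightarrow> (\<And>i. i < p \<Longrightarrow> C i \<subset> C (Suc i)) \<Longrightarrow> p \<le> l"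
proof (induction arbitrary: p C rule: simple_chain.induct)
  case zero
  show ?case
  proof (rule ccontr)
    assume "\<not> p \<le> 0"
    then have "C 0 \<subset> C (Suc 0)" "W0 \<subseteq> C 0" "C (Suc 0) \<subseteq> W0"
      using zero(1)[of 0] zero(1)[of "Suc 0"] zero(2)[of 0] by auto
    then show False by auto
  qed
next
  case (step l W b)
  have W: "submodule W R M" "W0 \<subseteq> W" using simple_chain_submodule[OF step(1) W0] by auto
  note WD = submoduleD[OF W(1)]
  have mono: "C i \<subseteq> C j" if "i \<le> j" "j \<le> p" for i j
    using that by (induction j rule: dec_induct) (use step.prems(2) in \<open>auto dest!: less_imp_le\<close>, (meson Suc_leD order_refl psubsetE subsetD less_eq_Suc_le)+)
  \<comment> \<open>An element \<open>x\<close> of \<open>C (Suc j)\<close> outside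
    \<open>C j\<close> is moved into \<open>W\<close> by subtracting a multiple \<open>v\<close> of
    \<open>u\<close>. As \<open>v\<close> lies in \<open>C j\<close>, the difference still lies
    outside \<open>C j\<close>.\<close>
  have strict: "C j \<inter> W \<subset> C (Suc j) \<inter> W" if j: "j < p" "\<not> C j \<subseteq> W" for j
  proof -
    have sub: "submodule (C j) R M" "C j \<subseteq> adjoin R M W b" "submodule (C (Suc j)) R M"
      "C (Suc j) \<subseteq> adjoin R M W b" "C j \<subset> C (Suc j)"
      using step.prems(1)[of j] step.prems(1)[of "Suc j"] step.prems(2)[of j] j by auto
    note jD = submoduleD[OF sub(1)] and sD = submoduleD[OF sub(3)]
    obtain u where u: "u \<in> C j" "u \<notin> W" using j by auto
    obtain s where s: "s \<in> carrier R" "b \<ominus>\<^bsub>M\<^esub> s \<odot>\<^bsub>M\<^esub> u \<in> W"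
      using adjoin_simple[OF I W(1) step(2,4) _ u(2)] u sub(2) by blast
    obtain x where x: "x \<in> C (Suc j)" "x \<notin> C j" using sub(5) by auto
    obtain w r where w: "w \<in> W" "r \<in> carrier R" "x = w \<oplus>\<^bsub>M\<^esub> r \<odot>\<^bsub>M\<^esub> b"
      using x(1) sub(4) by (meson adjoinE subsetD)
    define v where "v = (r \<otimes>\<^bsub>R\<^esub> s) \<odot>\<^bsub>M\<^esub> u"
    have v: "v \<in> C j" "v \<in> carrier M" using u(1) w(2) s(1) jD by (auto simp: v_def)
    have "w \<oplus>\<^bsub>M\<^esub> r \<odot>\<^bsub>M\<^esub> (b \<ominus>\<^bsub>M\<^esub> s \<odot>\<^bsub>M\<^esub> u) = x \<ominus>\<^bsub>M\<^esub> v"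
      using w s u(1) jD(1) WD(1) step(2)
      by (simp add: v_def M.minus_eq smult_r_distr smult_r_minus smult_assoc1 M.a_assoc)
    moreover have "w \<oplus>\<^bsub>M\<^esub> r \<odot>\<^bsub>M\<^esub> (b \<ominus>\<^bsub>M\<^esub> s \<odot>\<^bsub>M\<^esub> u) \<in> W" using w s WD by blast
    ultimately have 1: "x \<ominus>\<^bsub>M\<^esub> v \<in> W" by simp
    have 2: "x \<ominus>\<^bsub>M\<^esub> v \<in> C (Suc j)" using x v sub(5) sD(6) by blast
    have "x \<ominus>\<^bsub>M\<^esub> v \<notin> C j"
    proof
      assume "x \<ominus>\<^bsub>M\<^esub> v \<in> C j"
      then have "(x \<ominus>\<^bsub>M\<^esub> v) \<oplus>\<^bsub>M\<^esub> v \<in> C j" using v jD(3) by blast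
      then show False using x v sD(1) by (simp add: M.minus_eq M.a_assoc M.l_neg)
    qed
    then show ?thesis using 1 2 sub(5) by blast
  qed
  consider "p = 0" | "C p \<subseteq> W" | "p > 0" "\<not> C p \<subseteq> W" by auto
  then show ?case
  proof cases
    case 2
    have "p \<le> l"
    proof (rule step.IH)
      show "submodule (C i) R M \<and> W0 \<subseteq> C i \<and> C i \<subseteq> W" if "i \<le> p" for i
        using step.prems(1)[OF that] mono[OF that order_refl] 2 by auto
    qed (rule step.prems(2))
    then show ?thesis by simp
  next
    case 3
    note p = 3(1) and False = 3(2)
    define k where "k = (LEAST i. \<not> C i \<subseteq> W)"
    have k: "\<not> C k \<subseteq> W" "k \<le> p" and lt: "\<And>i. i < k \<Longrightarrow> C i \<subseteq> W"
      unfolding k_def using LeastI[where P = "\<lambda>i. \<not> C i \<subseteq> W", OF False]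
        Least_le[where P = "\<lambda>i. \<not> C i \<subseteq> W", OF False] not_less_Least[where P = "\<lambda>i. \<not> C i \<subseteq> W"] by blast+
    have ge: "\<not> C i \<subseteq> W" if "k \<le> i" "i \<le> p" for i using mono[OF that] k by auto
    \<comment> \<open>The first member that leaves \<open>W\<close> is skipped: before
      \<open>k\<close> nothing changes, from \<open>k\<close> on the index is shifted by one. One
      inclusion is lost, hence the bound on \<open>p - 1\<close>.\<close>
    define D where "D i = (if i < k then C i else C (Suc i) \<inter> W)" for i
    have "p - 1 \<le> l"
    proof (rule step.IH)
      fix i assume i: "i \<le> p - 1"
      show "submodule (D i) R M \<and> W0 \<subseteq> D i \<and> D i \<subseteq> W"
      proof (cases "i < k")
        case True
        then show ?thesis using lt[OF True] step.prems(1)[of i] i k(2) by (auto simp: D_def)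
      next
        case False
        then show ?thesis using p step.prems(1)[of "Suc i"] i W submodule_Int by (auto simp: D_def)
      qed
    next
      fix i assume i: "i < p - 1"
      then have ip: "i < p" "Suc i < p" by simp_all
      consider "Suc i < k" | "Suc i = k" | "k \<le> i" by linarith
      then show "D i \<subset> D (Suc i)"
      proof cases
        case 1
        then show ?thesis using step.prems(2)[of i] ip by (auto simp: D_def)
      next
        case 2
        have "C i \<subseteq> C k \<inter> W" using lt[of i] step.prems(2)[of i] ip 2 by auto
        then show ?thesis using strict[of k] k(1) ip 2 by (auto simp: D_def)
      next
        case 3
        then show ?thesis using strict[of "Suc i"] ge[of "Suc i"] ip by (auto simp: D_def)
      qed
    qed
    then show ?thesis by simp
  qed simp
qed

lemma simple_chain_strict_chain:
  assumes W0: "submodule W0 R M"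
  shows "simple_chain R M I W0 l W \<Longrightarrow>
    \<exists>C. (\<forall>i\<le>l. submodule (C i) R M \<and> W0 \<subseteq> C i \<and> C i \<subseteq> W) \<and> (\<forall>i<l. C i \<subset> C (Suc i)) \<and> C l = W"
proof (induction rule: simple_chain.induct)
  case zero then show ?case using W0 by (intro exI[of _ "\<lambda>_. W0"]) auto
next
  case (step l W b)
  then obtain C where C: "\<forall>i\<le>l. submodule (C i) R M \<and> W0 \<subseteq> C i \<and> C i \<subseteq> W" "\<forall>i<l. C i \<subset> C (Suc i)" "C l = W"
    by auto
  have W: "submodule W R M" "W0 \<subseteq> W" using simple_chain_submodule[OF step(1) W0] by auto
  have W': "submodule (adjoin R M W b) R M" "W \<subset> adjoin R M W b"
    using adjoin_submodule[OF W(1) step(2)] subset_adjoin[OF W(1) step(2)] adjoin_self[OF W(1) step(2)] step(3)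
    by auto
  show ?case
  proof (intro exI[of _ "C(Suc l := adjoin R M W b)"] conjI allI impI)
    fix i
    { assume "i \<le> Suc l"
      then consider "i \<le> l" | "i = Suc l" by linarith
      then have "submodule ((C(Suc l := adjoin R M W b)) i) R M \<and> W0 \<subseteq> (C(Suc l := adjoin R M W b)) i
        \<and> (C(Suc l := adjoin R M W b)) i \<subseteq> adjoin R M W b"
        using C(1)[rule_format, of i] W' W by cases (simp, blast, simp)
      then show "submodule ((C(Suc l := adjoin R M W b)) i) R M"
        "W0 \<subseteq> (C(Suc l := adjoin R M W b)) i" "(C(Suc l := adjoin R M W b)) i \<subseteq> adjoin R M W b" by auto }
    { assume "i < Suc l"
      then consider "i < l" | "i = l" by linarith
      then show "(C(Suc l := adjoin R M W b)) i \<subset> (C(Suc l := adjoin R M W b)) (Suc i)"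
        using C(2,3) W'(2) by cases auto }
  qed simp
qed


section \<open>Homomorphisms, quotients and the length of a quotient\<close>

lemma hom_image_submodule:
  assumes N: "module R N" and h: "h \<in> mod_hom R M N" and U: "submodule U R M"
  shows "submodule (h ` U) R N"
proof -
  interpret N: module R N by fact
  note hD = mod_homD[OF h] and UD = submoduleD[OF U]
  show ?thesis
  proof (rule N.submoduleI')
    show "x \<in> h ` U \<Longrightarrow> x \<in> carrier N" for x using hD(1) UD(1) by auto
    show "\<zero>\<^bsub>N\<^esub> \<in> h ` U"
      using mod_hom_zero[OF module_axioms N h] UD(2) by (metis imageI)
    show "a \<oplus>\<^bsub>N\<^esub> b \<in> h ` U" if "a \<in> h ` U" "b \<in> h ` U" for a b
      using that hD(2)[symmetric] UD(1,3) by auto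
    show "r \<odot>\<^bsub>N\<^esub> x \<in> h ` U" if "r \<in> carrier R" "x \<in> h ` U" for r x
      using that hD(3)[symmetric] UD(1,4) by auto
  qed
qed

lemma hom_vimage_submodule:
  assumes N: "module R N" and h: "h \<in> mod_hom R M N" and V: "submodule V R N"
  shows "submodule {x \<in> carrier M. h x \<in> V} R M"
proof -
  interpret N: module R N by fact
  note hD = mod_homD[OF h] and VD = N.submoduleD[OF V]
  show ?thesis
    by (rule submoduleI') (use hD VD mod_hom_zero[OF module_axioms N h] in auto)
qed

lemma hom_diff:
  assumes N: "module R N" and h: "h \<in> mod_hom R M N" and "x \<in> carrier M" "y \<in> carrier M"
  shows "h (x \<ominus>\<^bsub>M\<^esub> y) = h x \<ominus>\<^bsub>N\<^esub> h y"
proof -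
  interpret N: module R N by fact
  note hD = mod_homD[OF h]
  have "h (\<ominus>\<^bsub>M\<^esub> y) = \<ominus>\<^bsub>N\<^esub> h y"
    using hD(3)[of "\<ominus>\<^bsub>R\<^esub> \<one>\<^bsub>R\<^esub>" y] hD(1) assms by (simp add: smult_l_minus N.smult_l_minus)
  then show ?thesis using hD assms by (simp add: M.minus_eq N.minus_eq)
qed

lemma diff_add_cancel: "x \<in> carrier M \<Longrightarrow> y \<in> carrier M \<Longrightarrow> (x \<ominus>\<^bsub>M\<^esub> y) \<oplus>\<^bsub>M\<^esub> y = x"
  by (simp add: M.minus_eq M.a_assoc M.l_neg)

lemma diff_eq_zero_iff:
  assumes "x \<in> carrier M" "y \<in> carrier M"
  shows "x \<ominus>\<^bsub>M\<^esub> y = \<zero>\<^bsub>M\<^esub> \<longleftrightarrow> x = y"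
proof
  assume "x \<ominus>\<^bsub>M\<^esub> y = \<zero>\<^bsub>M\<^esub>"
  then show "x = y" using diff_add_cancel[OF assms] assms(2) by simp
qed (use assms in \<open>simp add: M.minus_eq M.r_neg\<close>)

text \<open>\<open>N\<close> plays the role of \<open>M/W0\<close>, presented by a surjection with
  kernel \<open>W0\<close>. Preimages turn a strict chain in \<open>N\<close> into one above
  \<open>W0\<close>, which bounds the supremum by \<open>l\<close>; images of the members of the
  simple chain attain it.\<close>

lemma simple_chain_module_length:
  assumes I: "maximalideal I R" and W0: "submodule W0 R M" and ch: "simple_chain R M I W0 l (carrier M)"
    and N: "module R N" and h: "h \<in> mod_hom R M N" "h ` carrier M = carrier N"
    and ker: "\<And>x. x \<in> carrier M \<Longrightarrow> h x = \<zero>\<^bsub>N\<^esub> \<longleftrightarrow> x \<in> W0"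
  shows "module_length R N = enat l"
proof -
  interpret N: module R N by fact
  note hD = mod_homD[OF h(1)]
  \<comment> \<open>\<open>U\<close> contains the kernel, so it is the full preimage of its image.
    Strict inclusions therefore survive the passage to images.\<close>
  have inj: "x \<in> U" if U: "submodule U R M" "W0 \<subseteq> U" and x: "x \<in> carrier M" "h x \<in> h ` U" for U x
  proof -
    note UD = submoduleD[OF U(1)]
    obtain y where y: "y \<in> U" "h x = h y" using x(2) by auto
    then have "h (x \<ominus>\<^bsub>M\<^esub> y) = \<zero>\<^bsub>N\<^esub>"
      using hom_diff[OF N h(1) x(1) UD(1)[OF y(1)]] hD(1) UD(1) by (simp add: N.diff_eq_zero_iff)
    then have "x \<ominus>\<^bsub>M\<^esub> y \<in> U" using ker[of "x \<ominus>\<^bsub>M\<^esub> y"] x(1) UD(1)[OF y(1)] U(2) by auto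
    then have "(x \<ominus>\<^bsub>M\<^esub> y) \<oplus>\<^bsub>M\<^esub> y \<in> U" using UD(3) y by blast
    then show "x \<in> U" using diff_add_cancel x(1) UD(1)[OF y(1)] by simp
  qed
  have bound: "n \<le> l" if "\<forall>i\<le>n. submodule (U i) R N" "\<forall>i<n. U i \<subset> U (Suc i)" for n U
  proof -
    have U: "\<And>i. i \<le> n \<Longrightarrow> submodule (U i) R N" "\<And>i. i < n \<Longrightarrow> U i \<subset> U (Suc i)"
      using that by simp_all
    show ?thesis
    proof (rule simple_chain_length_le[OF I W0 ch, where C = "\<lambda>i. {x \<in> carrier M. h x \<in> U i}"])
      show "submodule {x \<in> carrier M. h x \<in> U i} R M \<and> W0 \<subseteq> {x \<in> carrier M. h x \<in> U i}
        \<and> {x \<in> carrier M. h x \<in> U i} \<subseteq> carrier M" if "i \<le> n" for i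
      proof (intro conjI subsetI)
        show "submodule {x \<in> carrier M. h x \<in> U i} R M" by (rule hom_vimage_submodule[OF N h(1) U(1)[OF that]])
        show "x \<in> {x \<in> carrier M. h x \<in> U i}" if x: "x \<in> W0" for x
          using ker[of x] submoduleD(1)[OF W0 x] x N.submoduleD(2)[OF U(1)[OF \<open>i \<le> n\<close>]] by simp
      qed simp
      show "{x \<in> carrier M. h x \<in> U i} \<subset> {x \<in> carrier M. h x \<in> U (Suc i)}" if i: "i < n" for i
      proof -
        obtain y where y: "y \<in> U (Suc i)" "y \<notin> U i" using U(2)[OF i] by auto
        then have "y \<in> carrier N" using N.submoduleD(1)[OF U(1)[of "Suc i"]] i by simp
        then obtain x where "x \<in> carrier M" "y = h x" using h(2) by blast
        then show ?thesis using y U(2)[OF i] by blast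
      qed
    qed
  qed
  have attained: "\<exists>U. (\<forall>i\<le>l. submodule (U i) R N) \<and> (\<forall>i<l. U i \<subset> U (Suc i))"
  proof -
    from simple_chain_strict_chain[OF W0 ch]
    obtain C where "\<forall>i\<le>l. submodule (C i) R M \<and> W0 \<subseteq> C i \<and> C i \<subseteq> carrier M" "\<forall>i<l. C i \<subset> C (Suc i)"
      by (elim exE conjE)
    then have C: "\<And>i. i \<le> l \<Longrightarrow> submodule (C i) R M \<and> W0 \<subseteq> C i" "\<And>i. i < l \<Longrightarrow> C i \<subset> C (Suc i)"
      by simp_all
    show ?thesis
    proof (intro exI[of _ "\<lambda>i. h ` C i"] conjI allI impI)
      show "submodule (h ` C i) R N" if "i \<le> l" for i using hom_image_submodule[OF N h(1)] C(1) that by blast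
      show "h ` C i \<subset> h ` C (Suc i)" if i: "i < l" for i
      proof -
        obtain x where x: "x \<in> C (Suc i)" "x \<notin> C i" using C(2)[OF i] by auto
        then have "h x \<notin> h ` C i" using inj[of "C i" x] C(1)[of i] C(1)[of "Suc i"] submoduleD(1)[of "C (Suc i)" x] i by auto
        then show ?thesis using x C(2)[OF i] by blast
      qed
    qed
  qed
  show ?thesis
    unfolding module_length_def
  proof (rule antisym[OF Sup_least Sup_upper])
    show "x \<le> enat l"
      if "x \<in> {enat n | n. \<exists>U. (\<forall>i\<le>n. submodule (U i) R N) \<and> (\<forall>i<n. U i \<subset> U (Suc i))}" for x
      using that by (elim CollectE exE conjE) (drule (1) bound, simp)
    show "enat l \<in> {enat n | n. \<exists>U. (\<forall>i\<le>n. submodule (U i) R N) \<and> (\<forall>i<n. U i \<subset> U (Suc i))}"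
      by (rule CollectI, rule exI[of _ l], rule conjI[OF refl attained])
  qed
qed

text \<open>Later arguments use a quotient only through these three properties of its projection, so
  that cosets are not unfolded again.\<close>

lemma quot_module_proj:
  assumes U: "submodule U R M"
  shows "(\<lambda>x. U +>\<^bsub>M\<^esub> x) \<in> mod_hom R M (quot_module M U)"
    and "(\<lambda>x. U +>\<^bsub>M\<^esub> x) ` carrier M = carrier (quot_module M U)"
    and "x \<in> carrier M \<Longrightarrow> U +>\<^bsub>M\<^esub> x = \<zero>\<^bsub>quot_module M U\<^esub> \<longleftrightarrow> x \<in> U"
proof -
  interpret U: submodule U R M by fact
  interpret S: abelian_subgroup U M
    by (rule abelian_subgroupI3) (use U.subgroup_axioms in \<open>auto intro: additive_subgroup.intro M.abelian_group_axioms\<close>)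
  note UD = submoduleD[OF U]
  show ca: "(\<lambda>x. U +>\<^bsub>M\<^esub> x) ` carrier M = carrier (quot_module M U)"
    by (auto simp: quot_module_def A_RCOSETS_def')
  show "(\<lambda>x. U +>\<^bsub>M\<^esub> x) \<in> mod_hom R M (quot_module M U)"
  proof (rule mod_homI)
    show "U +>\<^bsub>M\<^esub> x \<in> carrier (quot_module M U)" if "x \<in> carrier M" for x using that ca by blast
    show "U +>\<^bsub>M\<^esub> (x \<oplus>\<^bsub>M\<^esub> y) = (U +>\<^bsub>M\<^esub> x) \<oplus>\<^bsub>quot_module M U\<^esub> (U +>\<^bsub>M\<^esub> y)"
      if "x \<in> carrier M" "y \<in> carrier M" for x y using that S.a_rcos_sum by (simp add: quot_module_def)
    show "U +>\<^bsub>M\<^esub> (r \<odot>\<^bsub>M\<^esub> x) = r \<odot>\<^bsub>quot_module M U\<^esub> (U +>\<^bsub>M\<^esub> x)"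
      if r: "r \<in> carrier R" and x: "x \<in> carrier M" for r x
    proof -
      have *: "U +>\<^bsub>M\<^esub> (r \<odot>\<^bsub>M\<^esub> z) = U +>\<^bsub>M\<^esub> (r \<odot>\<^bsub>M\<^esub> x)" if "z \<in> U +>\<^bsub>M\<^esub> x" for z
      proof -
        obtain u where u: "u \<in> U" "z = u \<oplus>\<^bsub>M\<^esub> x" using \<open>z \<in> _\<close> by (auto simp: a_r_coset_def')
        have "r \<odot>\<^bsub>M\<^esub> z = r \<odot>\<^bsub>M\<^esub> u \<oplus>\<^bsub>M\<^esub> r \<odot>\<^bsub>M\<^esub> x"
          using u r x UD(1) by (simp add: smult_r_distr)
        then have "r \<odot>\<^bsub>M\<^esub> z \<in> U +>\<^bsub>M\<^esub> (r \<odot>\<^bsub>M\<^esub> x)" using u r by (auto simp: a_r_coset_def')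
        then show ?thesis using S.a_repr_independence'[symmetric] r x by simp
      qed
      have "x \<in> U +>\<^bsub>M\<^esub> x" using x by (rule S.a_rcos_self)
      moreover have "(\<Union>z\<in>U +>\<^bsub>M\<^esub> x. U +>\<^bsub>M\<^esub> (r \<odot>\<^bsub>M\<^esub> z)) = (\<Union>z\<in>U +>\<^bsub>M\<^esub> x. U +>\<^bsub>M\<^esub> (r \<odot>\<^bsub>M\<^esub> x))"
        by (intro SUP_cong refl *)
      ultimately show ?thesis unfolding quot_module_def by auto
    qed
  qed
  show "U +>\<^bsub>M\<^esub> x = \<zero>\<^bsub>quot_module M U\<^esub> \<longleftrightarrow> x \<in> U" if x: "x \<in> carrier M" for x
    using M.a_coset_join2[OF x U.subgroup_axioms] S.a_rcos_self[OF x] by (auto simp: quot_module_def)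
qed

text \<open>The map \<open>w + r b \<mapsto> r y\<close> on \<open>W + Rb\<close> is well defined by
  \<open>comp\<close>, and injectivity extends it to \<open>M\<close>. This is the source of
  functionals that separate \<open>b\<close> from \<open>W\<close>.\<close>

lemma injective_module_functional:
  assumes G: "injective_module R G" and W: "submodule W R M" and b: "b \<in> carrier M" and y: "y \<in> carrier G"
    and comp: "\<And>r. r \<in> carrier R \<Longrightarrow> r \<odot>\<^bsub>M\<^esub> b \<in> W \<Longrightarrow> r \<odot>\<^bsub>G\<^esub> y = \<zero>\<^bsub>G\<^esub>"
  obtains g where "g \<in> mod_hom R M G" "\<And>w. w \<in> W \<Longrightarrow> g w = \<zero>\<^bsub>G\<^esub>" "g b = y"
proof -
  interpret G: module R G using G by (simp add: injective_module_def)
  note WD = submoduleD[OF W]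
  let ?U = "adjoin R M W b"
  have U: "submodule ?U R M" by (rule adjoin_submodule[OF W b])
  define f where "f z = (THE v. \<exists>w\<in>W. \<exists>r\<in>carrier R. z = w \<oplus>\<^bsub>M\<^esub> r \<odot>\<^bsub>M\<^esub> b \<and> v = r \<odot>\<^bsub>G\<^esub> y)" for z
  \<comment> \<open>The difference of two representations puts \<open>(r - s) b\<close> into
    \<open>W\<close>, so \<open>comp\<close> makes \<open>r y\<close> and \<open>s y\<close>
    agree.\<close>
  have uniq: "r \<odot>\<^bsub>G\<^esub> y = s \<odot>\<^bsub>G\<^esub> y"
    if "w \<in> W" "v \<in> W" "r \<in> carrier R" "s \<in> carrier R" "w \<oplus>\<^bsub>M\<^esub> r \<odot>\<^bsub>M\<^esub> b = v \<oplus>\<^bsub>M\<^esub> s \<odot>\<^bsub>M\<^esub> b" for w v r s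
  proof -
    have "(r \<ominus>\<^bsub>R\<^esub> s) \<odot>\<^bsub>M\<^esub> b = v \<ominus>\<^bsub>M\<^esub> w"
    proof -
      have c: "w \<in> carrier M" "v \<in> carrier M" "r \<odot>\<^bsub>M\<^esub> b \<in> carrier M" "s \<odot>\<^bsub>M\<^esub> b \<in> carrier M"
        using that WD(1) b by auto
      have "r \<odot>\<^bsub>M\<^esub> b = \<ominus>\<^bsub>M\<^esub> w \<oplus>\<^bsub>M\<^esub> (v \<oplus>\<^bsub>M\<^esub> s \<odot>\<^bsub>M\<^esub> b)"
        unfolding that(5)[symmetric] using c by (simp add: M.r_neg1)
      also have "\<dots> = (v \<ominus>\<^bsub>M\<^esub> w) \<oplus>\<^bsub>M\<^esub> s \<odot>\<^bsub>M\<^esub> b" using c by (simp add: M.minus_eq M.a_ac)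
      finally have "r \<odot>\<^bsub>M\<^esub> b \<ominus>\<^bsub>M\<^esub> s \<odot>\<^bsub>M\<^esub> b = v \<ominus>\<^bsub>M\<^esub> w"
        using add_diff_cancel[of "v \<ominus>\<^bsub>M\<^esub> w" "s \<odot>\<^bsub>M\<^esub> b"] c by simp
      then show ?thesis using that b by (simp add: smult_diff)
    qed
    then have "(r \<ominus>\<^bsub>R\<^esub> s) \<odot>\<^bsub>G\<^esub> y = \<zero>\<^bsub>G\<^esub>" using comp[of "r \<ominus>\<^bsub>R\<^esub> s"] that WD(6) by simp
    then show ?thesis using that y by (simp add: G.smult_diff G.diff_eq_zero_iff)
  qed
  have f: "f (w \<oplus>\<^bsub>M\<^esub> r \<odot>\<^bsub>M\<^esub> b) = r \<odot>\<^bsub>G\<^esub> y" if "w \<in> W" "r \<in> carrier R" for w r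
    unfolding f_def
  proof (rule the_equality)
    show "\<exists>w'\<in>W. \<exists>r'\<in>carrier R. w \<oplus>\<^bsub>M\<^esub> r \<odot>\<^bsub>M\<^esub> b = w' \<oplus>\<^bsub>M\<^esub> r' \<odot>\<^bsub>M\<^esub> b \<and> r \<odot>\<^bsub>G\<^esub> y = r' \<odot>\<^bsub>G\<^esub> y"
      using that by (intro bexI[of _ w] bexI[of _ r] conjI refl)
    show "v = r \<odot>\<^bsub>G\<^esub> y"
      if "\<exists>w'\<in>W. \<exists>r'\<in>carrier R. w \<oplus>\<^bsub>M\<^esub> r \<odot>\<^bsub>M\<^esub> b = w' \<oplus>\<^bsub>M\<^esub> r' \<odot>\<^bsub>M\<^esub> b \<and> v = r' \<odot>\<^bsub>G\<^esub> y" for v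
    proof -
      from that obtain w' r' where w': "w' \<in> W" "r' \<in> carrier R"
        "w \<oplus>\<^bsub>M\<^esub> r \<odot>\<^bsub>M\<^esub> b = w' \<oplus>\<^bsub>M\<^esub> r' \<odot>\<^bsub>M\<^esub> b" "v = r' \<odot>\<^bsub>G\<^esub> y"
        by (elim bexE conjE)
      show ?thesis unfolding w'(4) using uniq[OF \<open>w \<in> W\<close> w'(1) \<open>r \<in> carrier R\<close> w'(2,3)] by simp
    qed
  qed
  have "f \<in> mod_hom R (M\<lparr>carrier := ?U\<rparr>) G"
  proof (rule mod_homI)
    fix x assume "x \<in> carrier (M\<lparr>carrier := ?U\<rparr>)"
    then obtain w r where x: "w \<in> W" "r \<in> carrier R" "x = w \<oplus>\<^bsub>M\<^esub> r \<odot>\<^bsub>M\<^esub> b" by (auto elim: adjoinE)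
    show "f x \<in> carrier G" using x f y by simp
    { fix z assume "z \<in> carrier (M\<lparr>carrier := ?U\<rparr>)"
      then obtain v s where z: "v \<in> W" "s \<in> carrier R" "z = v \<oplus>\<^bsub>M\<^esub> s \<odot>\<^bsub>M\<^esub> b" by (auto elim: adjoinE)
      have "x \<oplus>\<^bsub>M\<^esub> z = (w \<oplus>\<^bsub>M\<^esub> v) \<oplus>\<^bsub>M\<^esub> (r \<oplus>\<^bsub>R\<^esub> s) \<odot>\<^bsub>M\<^esub> b"
        using x z WD(1) b by (simp add: smult_l_distr M.a_ac)
      then have "f (x \<oplus>\<^bsub>M\<^esub> z) = (r \<oplus>\<^bsub>R\<^esub> s) \<odot>\<^bsub>G\<^esub> y" using f x z WD(3) by simp
      then show "f (x \<oplus>\<^bsub>M\<lparr>carrier := ?U\<rparr>\<^esub> z) = f x \<oplus>\<^bsub>G\<^esub> f z" using f x z y by (simp add: G.smult_l_distr) }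
    { fix s assume s: "s \<in> carrier R"
      have "s \<odot>\<^bsub>M\<^esub> x = s \<odot>\<^bsub>M\<^esub> w \<oplus>\<^bsub>M\<^esub> (s \<otimes>\<^bsub>R\<^esub> r) \<odot>\<^bsub>M\<^esub> b"
        using x s WD(1) b by (simp add: smult_r_distr smult_assoc1)
      then have "f (s \<odot>\<^bsub>M\<^esub> x) = (s \<otimes>\<^bsub>R\<^esub> r) \<odot>\<^bsub>G\<^esub> y" using f x s WD(4) by simp
      then show "f (s \<odot>\<^bsub>M\<lparr>carrier := ?U\<rparr>\<^esub> x) = s \<odot>\<^bsub>G\<^esub> f x" using f x s y by (simp add: G.smult_assoc1) }
  qed
  moreover have "module R (M\<lparr>carrier := ?U\<rparr>)" by (rule submodule.submodule_is_module[OF U module_axioms])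
  moreover have "id \<in> mod_hom R (M\<lparr>carrier := ?U\<rparr>) M"
    using submoduleD(1)[OF U] by (auto simp: mod_hom_def)
  ultimately obtain g where g: "g \<in> mod_hom R M G" "\<And>x. x \<in> ?U \<Longrightarrow> g x = f x"
    using injective_module_extend[OF G _ module_axioms, of "M\<lparr>carrier := ?U\<rparr>" id f] by auto
  have "g w = \<zero>\<^bsub>G\<^esub>" if w: "w \<in> W" for w
  proof -
    have "g w = f (w \<oplus>\<^bsub>M\<^esub> \<zero>\<^bsub>R\<^esub> \<odot>\<^bsub>M\<^esub> b)" using g(2)[of w] subset_adjoin[OF W b] w WD(1) b by auto
    then show ?thesis using f[OF w, of "\<zero>\<^bsub>R\<^esub>"] y by simp
  qed
  moreover have "g b = y"
  proof -
    have "g b = f (\<zero>\<^bsub>M\<^esub> \<oplus>\<^bsub>M\<^esub> \<one>\<^bsub>R\<^esub> \<odot>\<^bsub>M\<^esub> b)" using g(2)[of b] adjoin_self[OF W b] b by auto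
    then show ?thesis using f[OF WD(2), of "\<one>\<^bsub>R\<^esub>"] y by simp
  qed
  ultimately show thesis using that g(1) by blast
qed

end

section \<open>Injective hulls of cyclic modules\<close>

text \<open>An essential embedding of \<open>A/I\<close>, reduced to the image \<open>e\<close> of
  \<open>1\<close>: the annihilator of \<open>e\<close> is \<open>I\<close>, and essentiality is
  tested on cyclic submodules only. For maximal \<open>I\<close>, the submodule \<open>Ae\<close> is
  the socle, that is, the set of elements killed by \<open>I\<close>.\<close>

definition essential_generator ::
  "('a, 'r) ring_scheme \<Rightarrow> 'a set \<Rightarrow> ('a, 'e, 'm) module_scheme \<Rightarrow> 'e \<Rightarrow> bool" where
  "essential_generator A I E e \<longleftrightarrow> e \<in> carrier E \<and> (\<forall>a\<in>carrier A. a \<odot>\<^bsub>E\<^esub> e = \<zero>\<^bsub>E\<^esub> \<longleftrightarrow> a \<in> I) \<and>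
     (\<forall>x\<in>carrier E. x \<noteq> \<zero>\<^bsub>E\<^esub> \<longrightarrow> (\<exists>a\<in>carrier A. \<exists>b\<in>carrier A. a \<odot>\<^bsub>E\<^esub> x = b \<odot>\<^bsub>E\<^esub> e \<and> a \<odot>\<^bsub>E\<^esub> x \<noteq> \<zero>\<^bsub>E\<^esub>))"

lemma injective_hull_essential_generator:
  assumes A: "cring A" and I: "ideal I A" and hull: "injective_hull A (quot_module (ring_as_module A) I) E"
  obtains e where "essential_generator A I E e"
proof -
  let ?A = "ring_as_module A" let ?N = "quot_module (ring_as_module A) I"
  have inj: "injective_module A E" using hull by (simp add: injective_hull_def)
  then have E: "module A E" by (simp add: injective_module_def)
  interpret cring A by fact
  interpret A: module A ?A by (rule module_ring_as_module) fact
  interpret E: module A E by fact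
  interpret I: ideal I A by fact
  have I': "submodule I A ?A" by (rule A.submoduleI') (auto intro: I.I_l_closed)
  note N = module_quot_module[OF A.module_axioms I']
  obtain j where j: "j \<in> mod_hom A ?N E" "inj_on j (carrier ?N)"
    and ess: "essential_submodule A (j ` carrier ?N) E"
    using hull by (auto simp: injective_hull_def)
  note jD = mod_homD[OF j(1)]
  define p where "p a = I +>\<^bsub>?A\<^esub> a" for a
  note pD = mod_homD[OF A.quot_module_proj(1)[OF I'], folded p_def]
  have pim: "p ` carrier A = carrier ?N" using A.quot_module_proj(2)[OF I'] by (simp add: p_def)
  have pc: "p a \<in> carrier ?N" if "a \<in> carrier A" for a using pD(1)[of a] that by simp
  have p0: "p a = \<zero>\<^bsub>?N\<^esub> \<longleftrightarrow> a \<in> I" if "a \<in> carrier A" for a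
    using A.quot_module_proj(3)[OF I', of a] that by (simp add: p_def)
  define e where "e = j (p \<one>\<^bsub>A\<^esub>)"
  have e: "e \<in> carrier E" unfolding e_def by (intro jD(1) pc) simp
  have je: "j (p a) = a \<odot>\<^bsub>E\<^esub> e" if a: "a \<in> carrier A" for a
    using jD(3)[OF a pc[OF one_closed]] pD(3)[OF a, of "\<one>\<^bsub>A\<^esub>"] a by (simp add: e_def)
  have "a \<odot>\<^bsub>E\<^esub> e = \<zero>\<^bsub>E\<^esub> \<longleftrightarrow> a \<in> I" if a: "a \<in> carrier A" for a
  proof -
    have "j \<zero>\<^bsub>?N\<^esub> = \<zero>\<^bsub>E\<^esub>" by (rule mod_hom_zero[OF N E j(1)])
    moreover have "\<zero>\<^bsub>?N\<^esub> \<in> carrier ?N" using N by (simp add: module_def abelian_group_def abelian_monoid.zero_closed)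
    ultimately have "j (p a) = \<zero>\<^bsub>E\<^esub> \<longleftrightarrow> p a = \<zero>\<^bsub>?N\<^esub>" using j(2) pc[OF a] by (metis inj_onD)
    then show ?thesis using je[OF a] p0[OF a] by simp
  qed
  moreover have "\<exists>a\<in>carrier A. \<exists>b\<in>carrier A. a \<odot>\<^bsub>E\<^esub> x = b \<odot>\<^bsub>E\<^esub> e \<and> a \<odot>\<^bsub>E\<^esub> x \<noteq> \<zero>\<^bsub>E\<^esub>"
    if x: "x \<in> carrier E" "x \<noteq> \<zero>\<^bsub>E\<^esub>" for x
  proof -
    \<comment> \<open>The cyclic submodule \<open>Ax\<close>, written as an extension of zero by one
      generator.\<close>
    let ?U = "adjoin A E {\<zero>\<^bsub>E\<^esub>} x"
    have U: "submodule ?U A E" "x \<in> ?U"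
      using E.adjoin_submodule[OF E.zero_submodule x(1)] E.adjoin_self[OF E.zero_submodule x(1)] by auto
    have V: "submodule (j ` carrier ?N) A E"
      and "?U \<inter> j ` carrier ?N = {\<zero>\<^bsub>E\<^esub>} \<longrightarrow> ?U = {\<zero>\<^bsub>E\<^esub>}"
      using ess U(1) by (auto simp: essential_submodule_def)
    then have "?U \<inter> j ` carrier ?N \<noteq> {\<zero>\<^bsub>E\<^esub>}" using U(2) x(2) by auto
    moreover have "\<zero>\<^bsub>E\<^esub> \<in> ?U \<inter> j ` carrier ?N" using E.submoduleD(2)[OF V] E.submoduleD(2)[OF U(1)] by simp
    ultimately obtain z where z: "z \<in> ?U" "z \<in> j ` carrier ?N" "z \<noteq> \<zero>\<^bsub>E\<^esub>" by auto
    obtain a where a: "a \<in> carrier A" "z = a \<odot>\<^bsub>E\<^esub> x" using z(1) x(1) by (auto elim!: adjoinE)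
    obtain b where b: "b \<in> carrier A" "z = b \<odot>\<^bsub>E\<^esub> e" using z(2) je by (auto simp: pim[symmetric])
    show ?thesis using a b z(3) by metis
  qed
  ultimately show thesis using that e unfolding essential_generator_def by blast
qed

text \<open>If \<open>I\<close> kills \<open>x\<close> and \<open>a x = b e\<close> is nonzero, then
  \<open>a\<close> lies outside \<open>I\<close>, and dividing by \<open>a\<close> modulo
  \<open>I\<close> expresses \<open>x\<close> itself as a multiple of \<open>e\<close>.\<close>

lemma essential_generator_annihilated:
  assumes E: "module A E" and I: "maximalideal I A" and e: "essential_generator A I E e"
    and x: "x \<in> carrier E" "\<And>a. a \<in> I \<Longrightarrow> a \<odot>\<^bsub>E\<^esub> x = \<zero>\<^bsub>E\<^esub>"
  obtains b where "b \<in> carrier A" "x = b \<odot>\<^bsub>E\<^esub> e"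
proof (cases "x = \<zero>\<^bsub>E\<^esub>")
  interpret E: module A E by fact
  interpret I: maximalideal I A by fact
  have ec: "e \<in> carrier E" using e by (simp add: essential_generator_def)
  case True
  then show ?thesis using that[of "\<zero>\<^bsub>A\<^esub>"] ec by simp
next
  interpret E: module A E by fact
  interpret I: maximalideal I A by fact
  have ec: "e \<in> carrier E" using e by (simp add: essential_generator_def)
  case False
  then obtain a b where ab: "a \<in> carrier A" "b \<in> carrier A" "a \<odot>\<^bsub>E\<^esub> x = b \<odot>\<^bsub>E\<^esub> e" "a \<odot>\<^bsub>E\<^esub> x \<noteq> \<zero>\<^bsub>E\<^esub>"
    using e x(1) unfolding essential_generator_def by blast
  then have "a \<notin> I" using x(2) by auto
  then obtain c where c: "c \<in> carrier A" "c \<otimes>\<^bsub>A\<^esub> a \<ominus>\<^bsub>A\<^esub> \<one>\<^bsub>A\<^esub> \<in> I"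
    using maximalideal_inverse[OF E.R.is_cring I ab(1)] by blast
  have "(c \<otimes>\<^bsub>A\<^esub> a) \<odot>\<^bsub>E\<^esub> x \<ominus>\<^bsub>E\<^esub> x = \<zero>\<^bsub>E\<^esub>"
    using x(2)[OF c(2)] c(1) ab(1) x(1) by (simp add: E.smult_diff)
  then have "x = (c \<otimes>\<^bsub>A\<^esub> a) \<odot>\<^bsub>E\<^esub> x" using x(1) c(1) ab(1) by (simp add: E.diff_eq_zero_iff)
  also have "\<dots> = (c \<otimes>\<^bsub>A\<^esub> b) \<odot>\<^bsub>E\<^esub> e" using ab c x(1) ec by (simp add: E.smult_assoc1)
  finally show ?thesis using that ab c by blast
qed

lemma module_power_simps:
  "carrier (module_power M l) = {..<l} \<rightarrow>\<^sub>E carrier M"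
  "\<zero>\<^bsub>module_power M l\<^esub> = (\<lambda>i\<in>{..<l}. \<zero>\<^bsub>M\<^esub>)"
  "x \<oplus>\<^bsub>module_power M l\<^esub> y = (\<lambda>i\<in>{..<l}. x i \<oplus>\<^bsub>M\<^esub> y i)"
  "r \<odot>\<^bsub>module_power M l\<^esub> x = (\<lambda>i\<in>{..<l}. r \<odot>\<^bsub>M\<^esub> x i)"
  by (simp_all add: module_power_def)

section \<open>Local nilpotence and the socle of a power\<close>

context module
begin

lemma smult_left_commute:
  "r \<in> carrier R \<Longrightarrow> s \<in> carrier R \<Longrightarrow> x \<in> carrier M \<Longrightarrow> r \<odot>\<^bsub>M\<^esub> (s \<odot>\<^bsub>M\<^esub> x) = s \<odot>\<^bsub>M\<^esub> (r \<odot>\<^bsub>M\<^esub> x)"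
  by (simp add: smult_assoc1[symmetric] R.m_comm)

lemma annihilator_ideal:
  assumes x: "x \<in> carrier M"
  shows "ideal {a \<in> carrier R. a \<odot>\<^bsub>M\<^esub> x = \<zero>\<^bsub>M\<^esub>} R"
  by (rule idealI') (use x in \<open>auto simp: smult_l_distr smult_assoc1\<close>)

text \<open>The annihilators of \<open>a^k x\<close> increase with \<open>k\<close>, hence repeat at
  some \<open>k\<close>. If \<open>y = a^k x\<close> were nonzero, some nonzero \<open>s y\<close>
  would be a multiple of \<open>e\<close> and thus killed by \<open>a\<close>; then \<open>s\<close>
  would annihilate \<open>a y\<close> but not \<open>y\<close>.\<close>

lemma essential_generator_nilpotent:
  assumes R: "noetherian_ring R" and I: "ideal I R" and e: "essential_generator R I M e"
    and a: "a \<in> I" and x: "x \<in> carrier M"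
  shows "\<exists>k::nat. (a [^]\<^bsub>R\<^esub> k) \<odot>\<^bsub>M\<^esub> x = \<zero>\<^bsub>M\<^esub>"
proof -
  have aR: "a \<in> carrier R" using ideal.Icarr[OF I a] .
  have ec: "e \<in> carrier M" using e by (simp add: essential_generator_def)
  define A where "A k = {s \<in> carrier R. s \<odot>\<^bsub>M\<^esub> ((a [^]\<^bsub>R\<^esub> k) \<odot>\<^bsub>M\<^esub> x) = \<zero>\<^bsub>M\<^esub>}" for k :: nat
  have Suc: "(a [^]\<^bsub>R\<^esub> Suc k) \<odot>\<^bsub>M\<^esub> x = a \<odot>\<^bsub>M\<^esub> ((a [^]\<^bsub>R\<^esub> k) \<odot>\<^bsub>M\<^esub> x)" for k
    using aR x by (simp add: smult_assoc1[symmetric] R.m_comm)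
  have step: "A k \<subseteq> A (Suc k)" for k
  proof
    fix s assume "s \<in> A k"
    then have s: "s \<in> carrier R" "s \<odot>\<^bsub>M\<^esub> ((a [^]\<^bsub>R\<^esub> k) \<odot>\<^bsub>M\<^esub> x) = \<zero>\<^bsub>M\<^esub>" by (auto simp: A_def)
    have "s \<odot>\<^bsub>M\<^esub> (a \<odot>\<^bsub>M\<^esub> ((a [^]\<^bsub>R\<^esub> k) \<odot>\<^bsub>M\<^esub> x)) = a \<odot>\<^bsub>M\<^esub> (s \<odot>\<^bsub>M\<^esub> ((a [^]\<^bsub>R\<^esub> k) \<odot>\<^bsub>M\<^esub> x))"
      using s(1) aR x by (simp add: smult_assoc1[symmetric] R.m_ac)
    then show "s \<in> A (Suc k)" using s aR unfolding A_def Suc by simp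
  qed
  have id: "ideal (A k) R" for k unfolding A_def using annihilator_ideal aR x by simp
  obtain J where "J \<in> range A" "\<And>J'. J' \<in> range A \<Longrightarrow> J \<subseteq> J' \<Longrightarrow> J' = J"
    using ideal_exists_maximal[OF R, of "range A"] id by auto
  then obtain k where k: "A (Suc k) = A k" using step by (metis rangeE rangeI)
  define y where "y = (a [^]\<^bsub>R\<^esub> k) \<odot>\<^bsub>M\<^esub> x"
  have y: "y \<in> carrier M" using aR x by (simp add: y_def)
  have "y = \<zero>\<^bsub>M\<^esub>"
  proof (rule ccontr)
    assume "y \<noteq> \<zero>\<^bsub>M\<^esub>"
    then obtain s t where s: "s \<in> carrier R" "t \<in> carrier R" "s \<odot>\<^bsub>M\<^esub> y = t \<odot>\<^bsub>M\<^esub> e" "s \<odot>\<^bsub>M\<^esub> y \<noteq> \<zero>\<^bsub>M\<^esub>"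
      using e y unfolding essential_generator_def by blast
    have "s \<odot>\<^bsub>M\<^esub> (a \<odot>\<^bsub>M\<^esub> y) = a \<odot>\<^bsub>M\<^esub> (s \<odot>\<^bsub>M\<^esub> y)"
      by (rule smult_left_commute[OF s(1) aR y])
    also have "\<dots> = t \<odot>\<^bsub>M\<^esub> (a \<odot>\<^bsub>M\<^esub> e)"
      unfolding s(3) by (rule smult_left_commute[OF aR s(2) ec])
    also have "a \<odot>\<^bsub>M\<^esub> e = \<zero>\<^bsub>M\<^esub>" using e a aR by (simp add: essential_generator_def)
    finally have "s \<in> A (Suc k)" using s unfolding A_def Suc by (simp add: y_def)
    then show False using s(4) unfolding k by (simp add: A_def y_def)
  qed
  then show ?thesis unfolding y_def by blast
qed

text \<open>A multiple of \<open>x\<close> whose annihilator is maximal is killed by \<open>I\<close>.\<close>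

lemma exists_multiple_annihilated:
  assumes R: "noetherian_ring R" and I: "I \<subseteq> carrier R" and x: "x \<in> carrier M" "x \<noteq> \<zero>\<^bsub>M\<^esub>"
    and nil: "\<And>a r. a \<in> I \<Longrightarrow> r \<in> carrier R \<Longrightarrow> \<exists>k::nat. (a [^]\<^bsub>R\<^esub> k) \<odot>\<^bsub>M\<^esub> (r \<odot>\<^bsub>M\<^esub> x) = \<zero>\<^bsub>M\<^esub>"
  obtains r where "r \<in> carrier R" "r \<odot>\<^bsub>M\<^esub> x \<noteq> \<zero>\<^bsub>M\<^esub>" "\<And>a. a \<in> I \<Longrightarrow> a \<odot>\<^bsub>M\<^esub> (r \<odot>\<^bsub>M\<^esub> x) = \<zero>\<^bsub>M\<^esub>"
proof -
  define A where "A r = {a \<in> carrier R. a \<odot>\<^bsub>M\<^esub> (r \<odot>\<^bsub>M\<^esub> x) = \<zero>\<^bsub>M\<^esub>}" for r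
  define \<A> where "\<A> = A ` {r \<in> carrier R. r \<odot>\<^bsub>M\<^esub> x \<noteq> \<zero>\<^bsub>M\<^esub>}"
  have "A \<one>\<^bsub>R\<^esub> \<in> \<A>" unfolding \<A>_def using x by (intro imageI) simp
  moreover have "ideal J R" if "J \<in> \<A>" for J
    using that annihilator_ideal x(1) by (auto simp: \<A>_def A_def)
  ultimately obtain J where J: "J \<in> \<A>" "\<And>J'. J' \<in> \<A> \<Longrightarrow> J \<subseteq> J' \<Longrightarrow> J' = J"
    using ideal_exists_maximal[OF R, of \<A>] by blast
  then obtain r where r: "r \<in> carrier R" "r \<odot>\<^bsub>M\<^esub> x \<noteq> \<zero>\<^bsub>M\<^esub>" "J = A r" by (auto simp: \<A>_def)
  have "a \<odot>\<^bsub>M\<^esub> (r \<odot>\<^bsub>M\<^esub> x) = \<zero>\<^bsub>M\<^esub>" if a: "a \<in> I" for a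
  proof -
    have aR: "a \<in> carrier R" using a I by auto
    \<comment> \<open>For the least exponent \<open>k\<close>, which is positive,
      \<open>a^(k-1) r x\<close> is again a nonzero multiple of \<open>x\<close>. Its annihilator
      contains \<open>a\<close> and the annihilator of \<open>r x\<close>, so by maximality
      \<open>a\<close> already kills \<open>r x\<close>.\<close>
    define k where "k = (LEAST k::nat. (a [^]\<^bsub>R\<^esub> k) \<odot>\<^bsub>M\<^esub> (r \<odot>\<^bsub>M\<^esub> x) = \<zero>\<^bsub>M\<^esub>)"
    have k: "(a [^]\<^bsub>R\<^esub> k) \<odot>\<^bsub>M\<^esub> (r \<odot>\<^bsub>M\<^esub> x) = \<zero>\<^bsub>M\<^esub>"
      unfolding k_def by (rule LeastI_ex[OF nil[OF a r(1)]])
    have "k \<noteq> 0" using k r x by (metis R.nat_pow_0 smult_closed smult_one)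
    then obtain j where j: "k = Suc j" by (cases k) auto
    have j0: "(a [^]\<^bsub>R\<^esub> j) \<odot>\<^bsub>M\<^esub> (r \<odot>\<^bsub>M\<^esub> x) \<noteq> \<zero>\<^bsub>M\<^esub>"
      using not_less_Least[of j "\<lambda>k. (a [^]\<^bsub>R\<^esub> k) \<odot>\<^bsub>M\<^esub> (r \<odot>\<^bsub>M\<^esub> x) = \<zero>\<^bsub>M\<^esub>"] j unfolding k_def by simp
    let ?q = "a [^]\<^bsub>R\<^esub> j \<otimes>\<^bsub>R\<^esub> r"
    have q: "?q \<in> carrier R" "?q \<odot>\<^bsub>M\<^esub> x = (a [^]\<^bsub>R\<^esub> j) \<odot>\<^bsub>M\<^esub> (r \<odot>\<^bsub>M\<^esub> x)"
      using aR r x by (simp_all add: smult_assoc1)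
    have "A ?q \<in> \<A>" unfolding \<A>_def using q j0 by (intro imageI) simp
    moreover have "A r \<subseteq> A ?q"
    proof
      fix s assume "s \<in> A r"
      then have s: "s \<in> carrier R" "s \<odot>\<^bsub>M\<^esub> (r \<odot>\<^bsub>M\<^esub> x) = \<zero>\<^bsub>M\<^esub>" by (auto simp: A_def)
      have "s \<odot>\<^bsub>M\<^esub> (?q \<odot>\<^bsub>M\<^esub> x) = (a [^]\<^bsub>R\<^esub> j) \<odot>\<^bsub>M\<^esub> (s \<odot>\<^bsub>M\<^esub> (r \<odot>\<^bsub>M\<^esub> x))"
        using s(1) aR r(1) x by (simp add: smult_assoc1[symmetric] R.m_ac)
      then show "s \<in> A ?q" using s aR by (simp add: A_def)
    qed
    ultimately have "A ?q = A r" using J(2) r(3) by auto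
    moreover have "a \<in> A ?q"
      using k aR r(1) x unfolding j by (simp add: A_def smult_assoc1[symmetric] R.m_ac)
    ultimately show ?thesis by (simp add: A_def)
  qed
  then show thesis using that r by blast
qed

text \<open>Each step of the chain splits off one coordinate, by a homomorphism to \<open>F\<close> which vanishes on
  the previous submodule and maps the new element to the generator of the socle of \<open>F\<close>.\<close>

lemma simple_chain_socle_map:
  assumes F: "injective_module R F" and I: "maximalideal I R" and f: "essential_generator R I F f"
  shows "simple_chain R M I {\<zero>\<^bsub>M\<^esub>} l V \<Longrightarrow> (\<And>a v. a \<in> I \<Longrightarrow> v \<in> V \<Longrightarrow> a \<odot>\<^bsub>M\<^esub> v = \<zero>\<^bsub>M\<^esub>) \<Longrightarrow>
    \<exists>h\<in>mod_hom R M (module_power F l). (\<forall>v\<in>V. h v = \<zero>\<^bsub>module_power F l\<^esub> \<longrightarrow> v = \<zero>\<^bsub>M\<^esub>) \<and>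
      (\<forall>y\<in>carrier (module_power F l). (\<forall>a\<in>I. a \<odot>\<^bsub>module_power F l\<^esub> y = \<zero>\<^bsub>module_power F l\<^esub>) \<longrightarrow> y \<in> h ` V)"
proof (induction rule: simple_chain.induct)
  case zero
  interpret F: module R F using F by (simp add: injective_module_def)
  show ?case
    by (intro bexI[of _ "\<lambda>_. \<zero>\<^bsub>module_power F 0\<^esub>"] mod_homI)
      (auto simp: module_power_simps)
next
  case (step l V b)
  interpret F: module R F using F by (simp add: injective_module_def)
  interpret I: maximalideal I R by fact
  have P: "module R (module_power F n)" for n by (rule module_module_power[OF F.module_axioms])
  interpret P: module R "module_power F l" by (rule P)
  have V: "submodule V R M" using simple_chain_submodule[OF step(1) zero_submodule] by auto
  note VD = submoduleD[OF V]
  note b = step(2,3)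
  have Vsub: "V \<subseteq> adjoin R M V b" "b \<in> adjoin R M V b"
    using subset_adjoin[OF V b(1)] adjoin_self[OF V b(1)] by auto
  have kill: "a \<odot>\<^bsub>M\<^esub> b = \<zero>\<^bsub>M\<^esub>" if "a \<in> I" for a using step.prems that Vsub by auto
  obtain h where h: "h \<in> mod_hom R M (module_power F l)"
    and inj: "\<And>v. v \<in> V \<Longrightarrow> h v = \<zero>\<^bsub>module_power F l\<^esub> \<Longrightarrow> v = \<zero>\<^bsub>M\<^esub>"
    and onto: "\<And>y. y \<in> carrier (module_power F l) \<Longrightarrow>
      (\<And>a. a \<in> I \<Longrightarrow> a \<odot>\<^bsub>module_power F l\<^esub> y = \<zero>\<^bsub>module_power F l\<^esub>) \<Longrightarrow> y \<in> h ` V"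
  proof -
    have "\<exists>h\<in>mod_hom R M (module_power F l). (\<forall>v\<in>V. h v = \<zero>\<^bsub>module_power F l\<^esub> \<longrightarrow> v = \<zero>\<^bsub>M\<^esub>) \<and>
      (\<forall>y\<in>carrier (module_power F l). (\<forall>a\<in>I. a \<odot>\<^bsub>module_power F l\<^esub> y = \<zero>\<^bsub>module_power F l\<^esub>) \<longrightarrow> y \<in> h ` V)"
    proof (rule step.IH)
      show "a \<odot>\<^bsub>M\<^esub> v = \<zero>\<^bsub>M\<^esub>" if "a \<in> I" "v \<in> V" for a v
        using step.prems[OF that(1)] that(2) Vsub(1) by auto
    qed
    then obtain h where "h \<in> mod_hom R M (module_power F l)"
      "\<forall>v\<in>V. h v = \<zero>\<^bsub>module_power F l\<^esub> \<longrightarrow> v = \<zero>\<^bsub>M\<^esub>"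
      "\<forall>y\<in>carrier (module_power F l). (\<forall>a\<in>I. a \<odot>\<^bsub>module_power F l\<^esub> y = \<zero>\<^bsub>module_power F l\<^esub>) \<longrightarrow> y \<in> h ` V"
      by (elim bexE conjE)
    then show thesis by (intro that[of h]) simp_all
  qed
  note hD = mod_homD[OF h]
  have fc: "f \<in> carrier F" and f0: "\<And>a. a \<in> carrier R \<Longrightarrow> a \<odot>\<^bsub>F\<^esub> f = \<zero>\<^bsub>F\<^esub> \<longleftrightarrow> a \<in> I"
    using f by (simp_all add: essential_generator_def)
  \<comment> \<open>For \<open>r\<close> outside \<open>I\<close>, an inverse modulo
    \<open>I\<close> would bring \<open>r b\<close> back to \<open>b\<close>, because
    \<open>I\<close> kills \<open>b\<close>; then \<open>b\<close> would lie in \<open>V\<close>.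
    This is the compatibility that allows \<open>b\<close> to be sent to \<open>f\<close>.\<close>
  have rb: "r \<in> I" if r: "r \<in> carrier R" "r \<odot>\<^bsub>M\<^esub> b \<in> V" for r
  proof (rule ccontr)
    assume "r \<notin> I"
    then obtain s where s: "s \<in> carrier R" "s \<otimes>\<^bsub>R\<^esub> r \<ominus>\<^bsub>R\<^esub> \<one>\<^bsub>R\<^esub> \<in> I"
      using maximalideal_inverse[OF R.is_cring I r(1)] by blast
    have "(s \<otimes>\<^bsub>R\<^esub> r) \<odot>\<^bsub>M\<^esub> b \<ominus>\<^bsub>M\<^esub> b = \<zero>\<^bsub>M\<^esub>"
      using kill[OF s(2)] s(1) r(1) b by (simp add: smult_diff)
    then have "b = s \<odot>\<^bsub>M\<^esub> (r \<odot>\<^bsub>M\<^esub> b)" using s(1) r(1) b by (simp add: diff_eq_zero_iff smult_assoc1)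
    then show False using VD(4)[OF s(1) r(2)] b(2) by simp
  qed
  obtain g where g: "g \<in> mod_hom R M F" "\<And>w. w \<in> V \<Longrightarrow> g w = \<zero>\<^bsub>F\<^esub>" "g b = f"
    by (rule injective_module_functional[OF F V b(1) fc]) (use rb f0 in auto)
  note gD = mod_homD[OF g(1)]
  define k where "k x = (\<lambda>i\<in>{..<Suc l}. if i < l then h x i else g x)" for x
  have hc: "h x i \<in> carrier F" if "x \<in> carrier M" "i < l" for x i
    using hD(1)[OF that(1)] that(2) by (auto simp: module_power_simps PiE_def)
  have k: "k \<in> mod_hom R M (module_power F (Suc l))"
    by (rule mod_homI)
      (use hc gD in \<open>auto simp: module_power_simps k_def hD(2,3) intro!: restrict_ext\<close>)
  show ?case
  proof (intro bexI[OF _ k] conjI ballI impI)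
    fix v assume v: "v \<in> adjoin R M V b" "k v = \<zero>\<^bsub>module_power F (Suc l)\<^esub>"
    then obtain w r where w: "w \<in> V" "r \<in> carrier R" "v = w \<oplus>\<^bsub>M\<^esub> r \<odot>\<^bsub>M\<^esub> b" by (auto elim: adjoinE)
    have z: "k v i = \<zero>\<^bsub>F\<^esub>" if "i < Suc l" for i using v(2) that by (simp add: module_power_simps)
    have "g v = \<zero>\<^bsub>F\<^esub>" using z[of l] by (simp add: k_def)
    then have "r \<odot>\<^bsub>F\<^esub> f = \<zero>\<^bsub>F\<^esub>" using w gD g(2,3) VD(1) b fc by simp
    then have "r \<odot>\<^bsub>M\<^esub> b = \<zero>\<^bsub>M\<^esub>" using f0 kill w by simp
    then have vw: "v = w" using w VD(1) by simp
    have "h v = \<zero>\<^bsub>module_power F l\<^esub>"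
    proof (rule PiE_ext)
      show "h v \<in> {..<l} \<rightarrow>\<^sub>E carrier F" using hD(1)[of v] vw w VD(1) by (simp add: module_power_simps)
      show "\<zero>\<^bsub>module_power F l\<^esub> \<in> {..<l} \<rightarrow>\<^sub>E carrier F" using P.zero_closed by (simp add: module_power_simps)
      show "h v i = \<zero>\<^bsub>module_power F l\<^esub> i" if "i \<in> {..<l}" for i
        using z[of i] that by (simp add: k_def module_power_simps)
    qed
    then show "v = \<zero>\<^bsub>M\<^esub>" using inj w(1) vw by simp
  next
    fix y assume y: "y \<in> carrier (module_power F (Suc l))"
      and ky: "\<forall>a\<in>I. a \<odot>\<^bsub>module_power F (Suc l)\<^esub> y = \<zero>\<^bsub>module_power F (Suc l)\<^esub>"
    have yc: "y i \<in> carrier F" if "i < Suc l" for i using y that by (auto simp: module_power_simps PiE_def)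
    have ya: "a \<odot>\<^bsub>F\<^esub> y i = \<zero>\<^bsub>F\<^esub>" if "a \<in> I" "i < Suc l" for a i
      using fun_cong[OF ky[rule_format, OF that(1)], of i] that(2) by (simp add: module_power_simps)
    obtain r where r: "r \<in> carrier R" "y l = r \<odot>\<^bsub>F\<^esub> f"
      using essential_generator_annihilated[OF F.module_axioms I f yc[of l]] ya by auto
    \<comment> \<open>\<open>r b\<close> will supply the last coordinate of \<open>y\<close>, but
      \<open>h b\<close> need not vanish. Its contribution to the other coordinates is subtracted
      beforehand; what remains is still killed by \<open>I\<close> and so comes from
      \<open>V\<close>.\<close>
    define z where "z = (\<lambda>i\<in>{..<l}. y i \<ominus>\<^bsub>F\<^esub> r \<odot>\<^bsub>F\<^esub> h b i)"
    have "z \<in> h ` V"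
    proof (rule onto)
      show "z \<in> carrier (module_power F l)"
        using yc hc[OF b(1)] r by (auto simp: z_def module_power_simps F.minus_eq)
      fix a assume a: "a \<in> I"
      have "a \<odot>\<^bsub>F\<^esub> h b i = \<zero>\<^bsub>F\<^esub>" if "i < l" for i
      proof -
        have "h (a \<odot>\<^bsub>M\<^esub> b) = \<zero>\<^bsub>module_power F l\<^esub>"
          unfolding kill[OF a] by (rule mod_hom_zero[OF module_axioms P h])
        then have "(a \<odot>\<^bsub>module_power F l\<^esub> h b) i = \<zero>\<^bsub>module_power F l\<^esub> i" using hD(3)[OF I.Icarr[OF a] b(1)] by simp
        then show ?thesis using that by (simp add: module_power_simps)
      qed
      then have *: "a \<odot>\<^bsub>F\<^esub> (r \<odot>\<^bsub>F\<^esub> h b i) = \<zero>\<^bsub>F\<^esub>" if "i < l" for i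
        using that hc[OF b(1)] r I.Icarr[OF a]
          F.smult_left_commute[of a r] by simp
      show "a \<odot>\<^bsub>module_power F l\<^esub> z = \<zero>\<^bsub>module_power F l\<^esub>"
        using * ya[OF a] yc hc[OF b(1)] r I.Icarr[OF a]
        by (auto simp: z_def module_power_simps F.minus_eq F.smult_r_distr F.smult_r_minus intro!: restrict_ext)
    qed
    then obtain v where v: "v \<in> V" "h v = z" by auto
    have "k (v \<oplus>\<^bsub>M\<^esub> r \<odot>\<^bsub>M\<^esub> b) = y"
    proof (rule PiE_ext)
      show "k (v \<oplus>\<^bsub>M\<^esub> r \<odot>\<^bsub>M\<^esub> b) \<in> {..<Suc l} \<rightarrow>\<^sub>E carrier F"
        using mod_homD(1)[OF k, of "v \<oplus>\<^bsub>M\<^esub> r \<odot>\<^bsub>M\<^esub> b"] v VD(1) r b by (simp add: module_power_simps)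
      show "y \<in> {..<Suc l} \<rightarrow>\<^sub>E carrier F" using y by (simp add: module_power_simps)
      fix i assume i: "i \<in> {..<Suc l}"
      show "k (v \<oplus>\<^bsub>M\<^esub> r \<odot>\<^bsub>M\<^esub> b) i = y i"
      proof (cases "i < l")
        case True
        have "k (v \<oplus>\<^bsub>M\<^esub> r \<odot>\<^bsub>M\<^esub> b) i = z i \<oplus>\<^bsub>F\<^esub> r \<odot>\<^bsub>F\<^esub> h b i"
          using True v VD(1) r b hD(2,3) by (simp add: k_def module_power_simps)
        also have "\<dots> = y i" using True yc[of i] hc[OF b(1) True] r by (simp add: z_def F.diff_add_cancel)
        finally show ?thesis .
      next
        case False
        then have "i = l" using i by simp
        then show ?thesis using v VD(1) r b gD g(2,3) fc by (simp add: k_def)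
      qed
    qed
    then show "y \<in> k ` adjoin R M V b" using v(1) r(1) by (metis adjoinI imageI)
  qed
qed

end

text \<open>The coordinates are treated one after the other. If the next one is not yet zero, the
  multiplier is enlarged by an \<open>s\<close> that moves it into \<open>Af\<close>, which
  \<open>I\<close> kills, and keeps it nonzero; this coordinate witnesses that the whole vector
  stays nonzero. Coordinates already killed by \<open>I\<close> remain so.\<close>

lemma module_power_essential:
  assumes F: "module A F" and I: "ideal I A" and f: "essential_generator A I F f"
    and y: "y \<in> carrier (module_power F l)" "y \<noteq> \<zero>\<^bsub>module_power F l\<^esub>"
  obtains r where "r \<in> carrier A" "r \<odot>\<^bsub>module_power F l\<^esub> y \<noteq> \<zero>\<^bsub>module_power F l\<^esub>"
    "\<And>a. a \<in> I \<Longrightarrow> a \<odot>\<^bsub>module_power F l\<^esub> (r \<odot>\<^bsub>module_power F l\<^esub> y) = \<zero>\<^bsub>module_power F l\<^esub>"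
proof -
  interpret F: module A F by fact
  interpret I: ideal I A by fact
  interpret P: module A "module_power F l" by (rule module_module_power) fact
  have fc: "f \<in> carrier F" and f0: "\<And>a. a \<in> carrier A \<Longrightarrow> a \<odot>\<^bsub>F\<^esub> f = \<zero>\<^bsub>F\<^esub> \<longleftrightarrow> a \<in> I"
    using f by (simp_all add: essential_generator_def)
  have yc: "y i \<in> carrier F" if "i < l" for i using y that by (auto simp: module_power_simps PiE_def)
  have "\<exists>r\<in>carrier A. r \<odot>\<^bsub>module_power F l\<^esub> y \<noteq> \<zero>\<^bsub>module_power F l\<^esub> \<and> (\<forall>i<m. \<forall>a\<in>I. a \<odot>\<^bsub>F\<^esub> (r \<odot>\<^bsub>F\<^esub> y i) = \<zero>\<^bsub>F\<^esub>)"
    if "m \<le> l" for m using that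
  proof (induction m)
    case 0 then show ?case using y by (intro bexI[of _ "\<one>\<^bsub>A\<^esub>"]) auto
  next
    case (Suc m)
    then obtain r where r: "r \<in> carrier A" "r \<odot>\<^bsub>module_power F l\<^esub> y \<noteq> \<zero>\<^bsub>module_power F l\<^esub>"
      "\<And>i a. i < m \<Longrightarrow> a \<in> I \<Longrightarrow> a \<odot>\<^bsub>F\<^esub> (r \<odot>\<^bsub>F\<^esub> y i) = \<zero>\<^bsub>F\<^esub>" by auto
    have ym: "y m \<in> carrier F" using yc Suc by simp
    show ?case
    proof (cases "r \<odot>\<^bsub>F\<^esub> y m = \<zero>\<^bsub>F\<^esub>")
      case True
      then show ?thesis using r I.Icarr by (intro bexI[of _ r]) (auto simp: less_Suc_eq)
    next
      case False
      then obtain s t where s: "s \<in> carrier A" "t \<in> carrier A" "s \<odot>\<^bsub>F\<^esub> (r \<odot>\<^bsub>F\<^esub> y m) = t \<odot>\<^bsub>F\<^esub> f"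
        "s \<odot>\<^bsub>F\<^esub> (r \<odot>\<^bsub>F\<^esub> y m) \<noteq> \<zero>\<^bsub>F\<^esub>"
        using f r(1) ym unfolding essential_generator_def by (meson F.smult_closed)
      have "a \<odot>\<^bsub>F\<^esub> ((s \<otimes>\<^bsub>A\<^esub> r) \<odot>\<^bsub>F\<^esub> y i) = \<zero>\<^bsub>F\<^esub>" if i: "i < Suc m" and a: "a \<in> I" for i a
      proof (cases "i = m")
        case True
        have "a \<odot>\<^bsub>F\<^esub> (t \<odot>\<^bsub>F\<^esub> f) = t \<odot>\<^bsub>F\<^esub> (a \<odot>\<^bsub>F\<^esub> f)"
          by (rule F.smult_left_commute[OF I.Icarr[OF a] s(2) fc])
        also have "\<dots> = \<zero>\<^bsub>F\<^esub>" using f0[of a] I.Icarr[OF a] a s(2) by simp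
        finally show ?thesis using True s(1,3) r(1) ym by (simp add: F.smult_assoc1)
      next
        case False
        then have i: "i < m" "y i \<in> carrier F" using i yc Suc by auto
        have "a \<odot>\<^bsub>F\<^esub> ((s \<otimes>\<^bsub>A\<^esub> r) \<odot>\<^bsub>F\<^esub> y i) = s \<odot>\<^bsub>F\<^esub> (a \<odot>\<^bsub>F\<^esub> (r \<odot>\<^bsub>F\<^esub> y i))"
          using I.Icarr[OF a] s(1) r(1) i(2) by (simp add: F.smult_assoc1[symmetric] F.R.m_ac)
        then show ?thesis using r(3)[OF i(1) a] s(1) by simp
      qed
      moreover have "(s \<otimes>\<^bsub>A\<^esub> r) \<odot>\<^bsub>module_power F l\<^esub> y \<noteq> \<zero>\<^bsub>module_power F l\<^esub>"
      proof
        assume "(s \<otimes>\<^bsub>A\<^esub> r) \<odot>\<^bsub>module_power F l\<^esub> y = \<zero>\<^bsub>module_power F l\<^esub>"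
        from fun_cong[OF this, of m] show False
          using s r(1) ym Suc by (simp add: module_power_simps F.smult_assoc1)
      qed
      ultimately show ?thesis using s(1) r(1) by blast
    qed
  qed
  from this[OF order_refl] obtain r where r: "r \<in> carrier A" "r \<odot>\<^bsub>module_power F l\<^esub> y \<noteq> \<zero>\<^bsub>module_power F l\<^esub>"
    "\<And>i a. i < l \<Longrightarrow> a \<in> I \<Longrightarrow> a \<odot>\<^bsub>F\<^esub> (r \<odot>\<^bsub>F\<^esub> y i) = \<zero>\<^bsub>F\<^esub>" by auto
  show thesis
    by (rule that[OF r(1,2)]) (use r(3) in \<open>auto simp: module_power_simps intro!: restrict_ext\<close>)
qed

text \<open>An injective module has no proper essential extension. Injectivity appears as Baer's
  criterion, the form in which it passes from \<open>S\<close> to \<open>R\<close>. For a given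
  \<open>y\<close>, the preimage of \<open>r y\<close> depends linearly on \<open>r\<close> in the
  ideal where it exists, and the element \<open>e\<close> that represents this map satisfies
  \<open>y = h e\<close>.\<close>

lemma surjective_of_essential_image:
  assumes E: "module A E" and P: "module A P" and h: "h \<in> mod_hom A E P" "inj_on h (carrier E)"
    and baer: "\<And>J g. ideal J A \<Longrightarrow> g \<in> mod_hom A ((ring_as_module A)\<lparr>carrier := J\<rparr>) E \<Longrightarrow>
      \<exists>e\<in>carrier E. \<forall>a\<in>J. g a = a \<odot>\<^bsub>E\<^esub> e"
    and ess: "\<And>y. y \<in> carrier P \<Longrightarrow> y \<noteq> \<zero>\<^bsub>P\<^esub> \<Longrightarrow>
      \<exists>r\<in>carrier A. r \<odot>\<^bsub>P\<^esub> y \<noteq> \<zero>\<^bsub>P\<^esub> \<and> r \<odot>\<^bsub>P\<^esub> y \<in> h ` carrier E"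
  shows "h ` carrier E = carrier P"
proof
  interpret E: module A E by fact
  interpret P: module A P by fact
  note hD = mod_homD[OF h(1)]
  show "h ` carrier E \<subseteq> carrier P" using hD(1) by auto
  show "carrier P \<subseteq> h ` carrier E"
  proof
    fix y assume y: "y \<in> carrier P"
    define J where "J = {r \<in> carrier A. r \<odot>\<^bsub>P\<^esub> y \<in> h ` carrier E}"
    define g where "g r = the_inv_into (carrier E) h (r \<odot>\<^bsub>P\<^esub> y)" for r
    note im = E.hom_image_submodule[OF P h(1) E.carrier_is_submodule]
    note imD = P.submoduleD[OF im]
    have J: "ideal J A"
      by (rule E.idealI') (use imD y in \<open>auto simp: J_def P.smult_l_distr P.smult_assoc1\<close>)
    have gI: "g r = x" if "x \<in> carrier E" "h x = r \<odot>\<^bsub>P\<^esub> y" for r x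
      unfolding g_def that(2)[symmetric] by (rule the_inv_into_f_f[OF h(2) that(1)])
    have g: "g r \<in> carrier E" "h (g r) = r \<odot>\<^bsub>P\<^esub> y" if "r \<in> J" for r
      using that gI by (auto simp: J_def)
    have "g \<in> mod_hom A ((ring_as_module A)\<lparr>carrier := J\<rparr>) E"
    proof (rule mod_homI)
      fix r assume "r \<in> carrier ((ring_as_module A)\<lparr>carrier := J\<rparr>)"
      then have r: "r \<in> J" "r \<in> carrier A" by (auto simp: J_def)
      show "g r \<in> carrier E" using g r by simp
      { fix s assume "s \<in> carrier ((ring_as_module A)\<lparr>carrier := J\<rparr>)"
        then have s: "s \<in> J" "s \<in> carrier A" by (auto simp: J_def)
        have "g (r \<oplus>\<^bsub>A\<^esub> s) = g r \<oplus>\<^bsub>E\<^esub> g s"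
          using g[OF r(1)] g[OF s(1)] r(2) s(2) y by (intro gI) (simp_all add: hD(2) P.smult_l_distr)
        then show "g (r \<oplus>\<^bsub>(ring_as_module A)\<lparr>carrier := J\<rparr>\<^esub> s) = g r \<oplus>\<^bsub>E\<^esub> g s"
          by (simp add: ring_as_module_def) }
      { fix s assume s: "s \<in> carrier A"
        have "g (s \<otimes>\<^bsub>A\<^esub> r) = s \<odot>\<^bsub>E\<^esub> g r"
          using g[OF r(1)] r(2) s y by (intro gI) (simp_all add: hD(3) P.smult_assoc1)
        then show "g (s \<odot>\<^bsub>(ring_as_module A)\<lparr>carrier := J\<rparr>\<^esub> r) = s \<odot>\<^bsub>E\<^esub> g r"
          by (simp add: ring_as_module_def) }
    qed
    then obtain e where e: "e \<in> carrier E" "\<And>a. a \<in> J \<Longrightarrow> g a = a \<odot>\<^bsub>E\<^esub> e" using baer[OF J] by blast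
    have "y \<ominus>\<^bsub>P\<^esub> h e = \<zero>\<^bsub>P\<^esub>"
    proof (rule ccontr)
      assume "y \<ominus>\<^bsub>P\<^esub> h e \<noteq> \<zero>\<^bsub>P\<^esub>"
      then obtain r v where r: "r \<in> carrier A" "r \<odot>\<^bsub>P\<^esub> (y \<ominus>\<^bsub>P\<^esub> h e) \<noteq> \<zero>\<^bsub>P\<^esub>"
        and v: "v \<in> carrier E" "r \<odot>\<^bsub>P\<^esub> (y \<ominus>\<^bsub>P\<^esub> h e) = h v"
        using ess[of "y \<ominus>\<^bsub>P\<^esub> h e"] y hD(1)[OF e(1)] by auto
      have he: "h e \<in> carrier P" using hD(1)[OF e(1)] .
      have "h (v \<oplus>\<^bsub>E\<^esub> r \<odot>\<^bsub>E\<^esub> e) = r \<odot>\<^bsub>P\<^esub> (y \<ominus>\<^bsub>P\<^esub> h e) \<oplus>\<^bsub>P\<^esub> r \<odot>\<^bsub>P\<^esub> h e"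
        using v e r(1) by (simp add: hD(2,3))
      also have "\<dots> = r \<odot>\<^bsub>P\<^esub> y"
        using r(1) y he by (simp add: P.smult_r_distr[symmetric] P.diff_add_cancel)
      finally have 1: "h (v \<oplus>\<^bsub>E\<^esub> r \<odot>\<^bsub>E\<^esub> e) = r \<odot>\<^bsub>P\<^esub> y" .
      have c: "v \<oplus>\<^bsub>E\<^esub> r \<odot>\<^bsub>E\<^esub> e \<in> carrier E" using v(1) e(1) r(1) by simp
      have "r \<in> J" unfolding J_def using 1 c r(1) by (auto simp flip: 1)
      \<comment> \<open>\<open>g r\<close> is known twice: as the preimage \<open>v + r e\<close> of
        \<open>r y\<close>, and as \<open>r e\<close> by the choice of \<open>e\<close>. So
        \<open>v\<close> vanishes, although \<open>h v\<close> was nonzero.\<close>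
      then have "r \<odot>\<^bsub>E\<^esub> e = v \<oplus>\<^bsub>E\<^esub> r \<odot>\<^bsub>E\<^esub> e" using gI[OF c 1] e(2) by simp
      then have "v = \<zero>\<^bsub>E\<^esub>" using v(1) e(1) r(1) by (metis E.add.r_cancel_one' E.smult_closed)
      then show False using r(2) v(2) mod_hom_zero[OF E P h(1)] by simp
    qed
    then have "y = h e" using y hD(1)[OF e(1)] by (simp add: P.diff_eq_zero_iff)
    then show "y \<in> h ` carrier E" using e(1) by blast
  qed
qed

section \<open>Finite projective extensions\<close>

text \<open>A map that is linear only on a submodule is applied to a sum formed in the record with
  the smaller carrier; this compares such a sum with the one in \<open>M\<close>.\<close>

lemma (in module) finsum_submodule:
  assumes U: "submodule U R M" and "finite A" "f \<in> A \<rightarrow> U"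
  shows "finsum (M\<lparr>carrier := U\<rparr>) f A = finsum M f A \<and> finsum M f A \<in> U"
proof -
  interpret U: module R "M\<lparr>carrier := U\<rparr>" by (rule submodule.submodule_is_module[OF U module_axioms])
  note UD = submoduleD[OF U]
  show ?thesis using assms(2,3)
  proof (induction A rule: finite_induct)
    case empty then show ?case using UD(2) U.finsum_empty M.finsum_empty by simp
  next
    case (insert x A)
    then have f: "f \<in> A \<rightarrow> U" "f x \<in> U" "f \<in> A \<rightarrow> carrier M" "f x \<in> carrier M" using UD(1) by auto
    have "finsum (M\<lparr>carrier := U\<rparr>) f (insert x A) = f x \<oplus>\<^bsub>M\<^esub> finsum (M\<lparr>carrier := U\<rparr>) f A"
      using U.finsum_insert[OF insert(1,2), of f] f by simp
    moreover have "finsum M f (insert x A) = f x \<oplus>\<^bsub>M\<^esub> finsum M f A"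
      using M.finsum_insert[OF insert(1,2), of f] f by simp
    ultimately show ?case using insert.IH f UD(3) by simp
  qed
qed

text \<open>The surjection from the free module on a finite generating set splits by projectivity,
  and \<open>\<phi> c\<close> is the coordinate of the splitting at \<open>c\<close>.\<close>

lemma (in module) projective_dual_basis:
  assumes P: "projective_module R M" and fg: "fin_gen_module R M"
  obtains C \<phi> where "finite C" "C \<subseteq> carrier M" "\<And>c. c \<in> C \<Longrightarrow> \<phi> c \<in> mod_hom R M (ring_as_module R)"
    "\<And>x. x \<in> carrier M \<Longrightarrow> x = finsum M (\<lambda>c. \<phi> c x \<odot>\<^bsub>M\<^esub> c) C"
proof -
  obtain C where C: "finite C" "C \<subseteq> carrier M" "\<Inter>{U. submodule U R M \<and> C \<subseteq> U} = carrier M"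
    using fg by (auto simp: fin_gen_module_def)
  let ?F = "free_module R C"
  let ?e = "lin_ext R M (\<lambda>c. c)"
  have F: "module R ?F" by (rule module_free_module[OF R.is_cring])
  interpret F: module R ?F by (rule F)
  have Cm: "(\<lambda>c. c) \<in> C \<rightarrow> carrier M" using C(2) by auto
  have e: "?e \<in> mod_hom R ?F M" by (rule lin_ext_hom[OF module_axioms Cm])
  have im: "submodule (?e ` carrier ?F) R M"
    by (rule F.hom_image_submodule[OF module_axioms e F.carrier_is_submodule])
  have "c \<in> ?e ` carrier ?F" if c: "c \<in> C" for c
  proof -
    let ?x = "\<lambda>q. if q = c then \<one>\<^bsub>R\<^esub> else \<zero>\<^bsub>R\<^esub>"
    have sub: "{q. ?x q \<noteq> \<zero>\<^bsub>R\<^esub>} \<subseteq> {c}" by auto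
    have x: "?x \<in> carrier ?F" using c finite_subset[OF sub] by (auto simp: free_module_def)
    have "?e ?x = finsum M (\<lambda>q. ?x q \<odot>\<^bsub>M\<^esub> q) {c}"
      by (rule lin_ext_eq[OF module_axioms Cm x _ _ sub]) (use c in auto)
    also have "\<dots> = c" using c C(2) by auto
    finally show ?thesis using x by (metis image_eqI)
  qed
  then have surj: "?e ` carrier ?F = carrier M" using C(3) im submoduleD(1)[OF im] by blast
  have "(\<lambda>x. x) \<in> mod_hom R M M" by (simp add: mod_hom_def)
  then obtain s where s: "s \<in> mod_hom R M ?F" "\<And>x. x \<in> carrier M \<Longrightarrow> ?e (s x) = x"
    using projective_module_lift[OF P F module_axioms e surj] by blast
  note sD = mod_homD[OF s(1)]
  show thesis
  proof (rule that[of C "\<lambda>c x. s x c"])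
    show "(\<lambda>x. s x c) \<in> mod_hom R M (ring_as_module R)" for c
      using sD by (intro mod_homI) (simp_all add: free_module_def)
    show "x = finsum M (\<lambda>c. s x c \<odot>\<^bsub>M\<^esub> c) C" if x: "x \<in> carrier M" for x
      using lin_ext_eq[OF module_axioms Cm sD(1)[OF x] C(1) order_refl] s(2)[OF x] sD(1)[OF x]
      by (auto simp: free_module_def)
  qed (use C in auto)
qed

text \<open>\<open>\<mm>\<close> is an associated prime of \<open>A/I\<close>: since \<mm> is
  nilpotent elementwise on \<open>A/I\<close>, it kills some nonzero multiple of the class of
  \<open>1\<close>, and nothing outside a maximal ideal can kill that multiple as well.\<close>

lemma exists_element_annihilator_maximal:
  assumes A: "cring A" "noetherian_ring A" and \<mm>: "maximalideal \<mm> A" and I: "ideal I A" "I \<noteq> carrier A"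
    and nil: "\<And>a. a \<in> \<mm> \<Longrightarrow> \<exists>k::nat. a [^]\<^bsub>A\<^esub> k \<in> I"
  obtains b where "b \<in> carrier A" "b \<notin> I" "\<And>s. s \<in> carrier A \<Longrightarrow> s \<otimes>\<^bsub>A\<^esub> b \<in> I \<longleftrightarrow> s \<in> \<mm>"
proof -
  interpret cring A by fact
  interpret I: ideal I A by fact
  interpret \<mm>: maximalideal \<mm> A by fact
  interpret A: module A "ring_as_module A" by (rule module_ring_as_module) fact
  have I': "submodule I A (ring_as_module A)" by (rule A.submoduleI') (auto intro: I.I_l_closed)
  let ?N = "quot_module (ring_as_module A) I"
  interpret N: module A ?N by (rule module_quot_module[OF A.module_axioms I'])
  define p where "p a = I +>\<^bsub>ring_as_module A\<^esub> a" for a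
  note pD = mod_homD[OF A.quot_module_proj(1)[OF I'], folded p_def]
  have pc: "p a \<in> carrier ?N" if "a \<in> carrier A" for a using pD(1)[of a] that by simp
  have p0: "p a = \<zero>\<^bsub>?N\<^esub> \<longleftrightarrow> a \<in> I" if "a \<in> carrier A" for a
    using A.quot_module_proj(3)[OF I', of a] that by (simp add: p_def)
  have ps: "r \<odot>\<^bsub>?N\<^esub> p a = p (r \<otimes>\<^bsub>A\<^esub> a)" if "r \<in> carrier A" "a \<in> carrier A" for r a
    using pD(3)[of r a] that by simp
  have 1: "p \<one>\<^bsub>A\<^esub> \<noteq> \<zero>\<^bsub>?N\<^esub>" using p0[of "\<one>\<^bsub>A\<^esub>"] I.one_imp_carrier I(2) by auto
  obtain r where r: "r \<in> carrier A" "r \<odot>\<^bsub>?N\<^esub> p \<one>\<^bsub>A\<^esub> \<noteq> \<zero>\<^bsub>?N\<^esub>"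
    "\<And>a. a \<in> \<mm> \<Longrightarrow> a \<odot>\<^bsub>?N\<^esub> (r \<odot>\<^bsub>?N\<^esub> p \<one>\<^bsub>A\<^esub>) = \<zero>\<^bsub>?N\<^esub>"
  proof (rule N.exists_multiple_annihilated[OF A(2) \<mm>.a_subset pc[OF one_closed] 1])
    fix a r assume a: "a \<in> \<mm>" and r: "r \<in> carrier A"
    have aA: "a \<in> carrier A" by (rule \<mm>.Icarr[OF a])
    obtain k :: nat where "a [^]\<^bsub>A\<^esub> k \<in> I" using nil[OF a] by blast
    then have "a [^]\<^bsub>A\<^esub> k \<otimes>\<^bsub>A\<^esub> r \<in> I" using I.I_r_closed r by blast
    then have "(a [^]\<^bsub>A\<^esub> k) \<odot>\<^bsub>?N\<^esub> (r \<odot>\<^bsub>?N\<^esub> p \<one>\<^bsub>A\<^esub>) = \<zero>\<^bsub>?N\<^esub>"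
      using r aA p0 by (simp add: ps)
    then show "\<exists>k::nat. (a [^]\<^bsub>A\<^esub> k) \<odot>\<^bsub>?N\<^esub> (r \<odot>\<^bsub>?N\<^esub> p \<one>\<^bsub>A\<^esub>) = \<zero>\<^bsub>?N\<^esub>" by blast
  qed blast
  have rI: "r \<notin> I" using r(1,2) p0 by (simp add: ps)
  have mr: "s \<otimes>\<^bsub>A\<^esub> r \<in> I" if "s \<in> \<mm>" for s
    using r(3)[OF that] \<mm>.Icarr[OF that] r(1) p0 by (simp add: ps)
  have "s \<in> \<mm>" if s: "s \<in> carrier A" "s \<otimes>\<^bsub>A\<^esub> r \<in> I" for s
  proof (rule ccontr)
    assume "s \<notin> \<mm>"
    then obtain t where t: "t \<in> carrier A" "t \<otimes>\<^bsub>A\<^esub> s \<ominus>\<^bsub>A\<^esub> \<one>\<^bsub>A\<^esub> \<in> \<mm>"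
      using maximalideal_inverse[OF A(1) \<mm> s(1)] by blast
    \<comment> \<open>Both terms lie in \<open>I\<close>, the first by \<open>s r \<in> I\<close>,
      the second by \<open>t s - 1 \<in> \<mm>\<close>; their difference is
      \<open>r\<close>.\<close>
    have "t \<otimes>\<^bsub>A\<^esub> (s \<otimes>\<^bsub>A\<^esub> r) \<ominus>\<^bsub>A\<^esub> (t \<otimes>\<^bsub>A\<^esub> s \<ominus>\<^bsub>A\<^esub> \<one>\<^bsub>A\<^esub>) \<otimes>\<^bsub>A\<^esub> r \<in> I"
      using I.I_l_closed[OF s(2) t(1)] mr[OF t(2)] by (simp add: minus_eq)
    moreover have "t \<otimes>\<^bsub>A\<^esub> (s \<otimes>\<^bsub>A\<^esub> r) \<ominus>\<^bsub>A\<^esub> (t \<otimes>\<^bsub>A\<^esub> s \<ominus>\<^bsub>A\<^esub> \<one>\<^bsub>A\<^esub>) \<otimes>\<^bsub>A\<^esub> r = r"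
      using s(1) t(1) r(1) by algebra
    ultimately show False using rI by simp
  qed
  then show thesis using that r(1) rI mr by blast
qed

text \<open>\<open>R\<close> is the record of \<open>S\<close> with carrier \<open>K\<close>, so an
  \<open>S\<close>-module is an \<open>R\<close>-module as the very same record. Addition and
  multiplication are shared, whereas additive inverses are defined through the carrier and have to
  be compared (\<open>R_minus\<close>).\<close>

locale finite_extension = S?: cring S for S (structure) +
  fixes K
  assumes subring: "subring K S"
    and noetherian_subring: "noetherian_ring (S\<lparr>carrier := K\<rparr>)"
    and fin_gen: "fin_gen_module (S\<lparr>carrier := K\<rparr>) (ring_as_module S)"
begin

abbreviation "R \<equiv> S\<lparr>carrier := K\<rparr>"
abbreviation "SM \<equiv> ring_as_module S"

lemma K_carrier: "x \<in> K \<Longrightarrow> x \<in> carrier S"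
  using subringE(1)[OF subring] by auto

lemma R_cring: "cring R"
  using subcring_iff[OF subringE(1)[OF subring]] subcringI'[OF subring] by simp

lemma R_minus:
  assumes "x \<in> K" "y \<in> K" shows "x \<ominus>\<^bsub>R\<^esub> y = x \<ominus> y"
proof -
  interpret R: cring R by (rule R_cring)
  have "\<ominus>\<^bsub>R\<^esub> y = \<ominus> y"
    using R.minus_equality[of "\<ominus> y" y] assms subringE(5)[OF subring] K_carrier by (simp add: l_neg)
  then show ?thesis by (simp add: a_minus_def)
qed

lemma module_SM: "module S SM"
  by (rule module_ring_as_module) (rule S.is_cring)

lemma restrict_module:
  assumes "module S M" shows "module R M"
proof -
  interpret M: module S M by fact
  show ?thesis
    by (rule moduleI[OF R_cring M.abelian_group_axioms])
      (use K_carrier in \<open>simp_all add: M.smult_l_distr M.smult_r_distr M.smult_assoc1\<close>)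
qed

lemma restrict_submodule:
  assumes "module S M" "submodule U S M" shows "submodule U R M"
proof -
  interpret M: module S M by fact
  interpret R: module R M by (rule restrict_module) fact
  show ?thesis by (rule R.submoduleI') (use M.submoduleD[OF assms(2)] K_carrier in auto)
qed

lemma ideal_submodule:
  assumes "ideal I S" shows "submodule I S SM"
proof -
  interpret ideal I S by fact
  interpret SM: module S SM by (rule module_SM)
  show ?thesis by (rule SM.submoduleI') (auto intro: I_l_closed)
qed

lemma submodule_ideal:
  assumes "submodule I S SM" shows "ideal I S"
proof -
  interpret SM: module S SM by (rule module_SM)
  show ?thesis by (rule SM.idealI') (use SM.submoduleD[OF assms] in auto)
qed

lemma noetherian_submodule_SM: "noetherian_submodule R SM (carrier S)"
proof -
  interpret SM: module R SM by (rule restrict_module[OF module_SM])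
  show ?thesis using SM.noetherian_submodule_carrier[OF noetherian_subring fin_gen] by simp
qed

lemma noetherian: "noetherian_ring S"
proof (rule trivial_ideal_chain_imp_noetherian)
  fix C assume C: "C \<noteq> {}" "subset.chain {I. ideal I S} C"
  have "{I. ideal I S} \<subseteq> {U. submodule U R SM \<and> U \<subseteq> carrier S}"
    by (intro subsetI CollectI conjI)
      (simp_all add: restrict_submodule[OF module_SM ideal_submodule] ideal.Icarr)
  then have "subset.chain {U. submodule U R SM \<and> U \<subseteq> carrier S} C"
    using C(2) unfolding subset_chain_def by (blast intro: subset_trans)
  then show "\<Union>C \<in> C"
    using noetherian_submodule_SM[unfolded noetherian_submodule_def, rule_format, OF C(1)] by simp
qed

text \<open>An ideal \<open>J\<close> of \<open>R\<close> above the contraction with an element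
  \<open>a\<close> outside \<mm> must contain \<open>1\<close>. Modulo \<mm> an inverse
  \<open>c\<close> of \<open>a\<close> exists in \<open>S\<close>; the chain condition on
  \<open>R\<close>-submodules of \<open>S\<close> replaces it by one in \<open>R\<close>.\<close>

lemma maximalideal_contraction:
  assumes \<mm>: "maximalideal \<mm> S"
  shows "maximalideal (\<mm> \<inter> K) R"
proof -
  interpret \<mm>: maximalideal \<mm> S by fact
  interpret SM: module R SM by (rule restrict_module[OF module_SM])
  have n: "ideal (\<mm> \<inter> K) R"
    by (rule SM.idealI') (use subringE[OF subring] K_carrier in \<open>auto intro: \<mm>.I_l_closed\<close>)
  show ?thesis
  proof (rule maximalidealI[OF n])
    show "carrier R \<noteq> \<mm> \<inter> K"
      using \<mm>.one_imp_carrier \<mm>.I_notcarr subringE(3)[OF subring] by auto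
    fix J assume J: "ideal J R" "\<mm> \<inter> K \<subseteq> J" "J \<subseteq> carrier R"
    interpret J: ideal J R by fact
    show "J = \<mm> \<inter> K \<or> J = carrier R"
    proof (rule disjCI)
      assume "J \<noteq> carrier R"
      show "J = \<mm> \<inter> K"
      proof (rule ccontr)
        assume "J \<noteq> \<mm> \<inter> K"
        then obtain a where a: "a \<in> J" "a \<notin> \<mm>" "a \<in> K" using J by auto
        have aS: "a \<in> carrier S" using a K_carrier by simp
        obtain c where c: "c \<in> carrier S" "c \<otimes> a \<ominus> \<one> \<in> \<mm>"
          using maximalideal_inverse[OF S.is_cring \<mm> aS a(2)] by blast
        have pow: "a [^] j \<otimes> c [^] j \<ominus> \<one> \<in> \<mm>" for j :: nat
        proof (induction j)
          case 0 then show ?case by (simp add: minus_eq r_neg)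
        next
          case (Suc j)
          define u v where "u = a [^] j" and "v = c [^] j"
          have uv: "u \<in> carrier S" "v \<in> carrier S" using aS c(1) by (simp_all add: u_def v_def)
          have "(u \<otimes> a) \<otimes> (v \<otimes> c) \<ominus> \<one> = (c \<otimes> a) \<otimes> (u \<otimes> v \<ominus> \<one>) \<oplus> (c \<otimes> a \<ominus> \<one>)"
            using uv aS c(1) by algebra
          then show ?case using Suc c aS \<mm>.I_l_closed by (simp add: u_def v_def)
        qed
        \<comment> \<open>The elements \<open>s\<close> for which \<open>a^k s\<close> is congruent
          to an element of \<open>R\<close> modulo \<mm>. These submodules grow with
          \<open>k\<close> because \<open>a\<close> lies in \<open>R\<close>, and \<open>c^k\<close>
          lies in \<open>W k\<close>.\<close>
        define W where "W k = {s \<in> carrier S. \<exists>r\<in>K. a [^] k \<otimes> s \<ominus> r \<in> \<mm>}" for k :: nat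
        have aj: "a [^] k \<in> carrier S" for k :: nat using aS by simp
        have W: "submodule (W k) R SM" for k
        proof (rule SM.submoduleI')
          show "x \<in> W k \<Longrightarrow> x \<in> carrier SM" for x by (simp add: W_def)
          show "\<zero>\<^bsub>SM\<^esub> \<in> W k"
            using aj[of k] subringE(2)[OF subring] by (auto simp: W_def minus_eq intro!: bexI[of _ \<zero>])
          fix x assume "x \<in> W k"
          then obtain r where r: "x \<in> carrier S" "r \<in> K" "a [^] k \<otimes> x \<ominus> r \<in> \<mm>" by (auto simp: W_def)
          { fix y assume "y \<in> W k"
            then obtain t where t: "y \<in> carrier S" "t \<in> K" "a [^] k \<otimes> y \<ominus> t \<in> \<mm>" by (auto simp: W_def)
            have "a [^] k \<otimes> (x \<oplus> y) \<ominus> (r \<oplus> t) = (a [^] k \<otimes> x \<ominus> r) \<oplus> (a [^] k \<otimes> y \<ominus> t)"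
              using r t aj[of k] K_carrier[OF r(2)] K_carrier[OF t(2)] by algebra
            then have "a [^] k \<otimes> (x \<oplus> y) \<ominus> (r \<oplus> t) \<in> \<mm>" using \<mm>.a_closed[OF r(3) t(3)] by simp
            then show "x \<oplus>\<^bsub>SM\<^esub> y \<in> W k" using r t subringE(7)[OF subring] by (auto simp: W_def) }
          { fix t assume "t \<in> carrier R"
            then have t: "t \<in> K" by simp
            have "a [^] k \<otimes> (t \<otimes> x) \<ominus> (t \<otimes> r) = t \<otimes> (a [^] k \<otimes> x \<ominus> r)"
              using r t aj[of k] K_carrier[OF r(2)] K_carrier[OF t] by algebra
            then have "a [^] k \<otimes> (t \<otimes> x) \<ominus> (t \<otimes> r) \<in> \<mm>" using \<mm>.I_l_closed[OF r(3)] K_carrier[OF t] by simp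
            then show "t \<odot>\<^bsub>SM\<^esub> x \<in> W k" using r t K_carrier[OF t] subringE(6)[OF subring] by (auto simp: W_def) }
        qed
        have step: "W k \<subseteq> W (Suc k)" for k
        proof
          fix x assume "x \<in> W k"
          then obtain r where r: "x \<in> carrier S" "r \<in> K" "a [^] k \<otimes> x \<ominus> r \<in> \<mm>" by (auto simp: W_def)
          have "(a [^] k \<otimes> a) \<otimes> x \<ominus> a \<otimes> r = a \<otimes> (a [^] k \<otimes> x \<ominus> r)"
            using r aS aj[of k] K_carrier[OF r(2)] by algebra
          then have "a [^] Suc k \<otimes> x \<ominus> a \<otimes> r \<in> \<mm>" using \<mm>.I_l_closed[OF r(3) aS] by simp
          then show "x \<in> W (Suc k)" using r a subringE(6)[OF subring] unfolding W_def by blast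
        qed
        have mono: "W i \<subseteq> W j" if "i \<le> j" for i j using that by (rule lift_Suc_mono_le[of W, OF step])
        have "\<Union>(range W) \<in> range W"
        proof (rule noetherian_submodule_SM[unfolded noetherian_submodule_def, rule_format])
          show "subset.chain {U. submodule U R SM \<and> U \<subseteq> carrier S} (range W)"
            unfolding subset_chain_def
          proof (intro conjI ballI)
            fix Y Z assume "Y \<in> range W" "Z \<in> range W"
            then obtain i j where "Y = W i" "Z = W j" by auto
            then show "Y \<subseteq> Z \<or> Z \<subseteq> Y" using mono linorder_le_cases[of i j] by metis
          qed (use W in \<open>auto simp: W_def\<close>)
        qed simp
        then obtain k where k: "\<Union>(range W) = W k" by auto
        \<comment> \<open>Once the chain is stationary at \<open>k\<close>, there is an
          \<open>r\<close> in \<open>R\<close> congruent to \<open>a^k c^(k+1)\<close>, hence to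
          \<open>c\<close>. So \<open>a r\<close> is congruent to \<open>1\<close>.\<close>
        have "c [^] Suc k \<in> W (Suc k)"
          unfolding W_def using pow[of "Suc k"] c(1) subringE(3)[OF subring] by blast
        then have "c [^] Suc k \<in> W k" using k by blast
        then obtain r where r: "r \<in> K" "a [^] k \<otimes> c [^] Suc k \<ominus> r \<in> \<mm>" by (auto simp: W_def)
        have cj: "c [^] Suc k \<in> carrier S" using c by simp
        have rS: "r \<in> carrier S" by (rule K_carrier[OF r(1)])
        have "a \<otimes> r \<ominus> \<one> = ((a [^] k \<otimes> a) \<otimes> c [^] Suc k \<ominus> \<one>) \<ominus> a \<otimes> (a [^] k \<otimes> c [^] Suc k \<ominus> r)"
          using rS cj aS aj[of k] by algebra
        moreover have "(a [^] k \<otimes> a) \<otimes> c [^] Suc k \<ominus> \<one> \<in> \<mm>" using pow[of "Suc k"] by simp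
        ultimately have "a \<otimes> r \<ominus> \<one> \<in> \<mm>" using \<mm>.I_l_closed[OF r(2) aS] by (simp add: minus_eq)
        moreover have ar: "a \<otimes> r \<in> K" "\<one> \<in> K" using a r subringE[OF subring] by auto
        moreover have "a \<otimes> r \<ominus> \<one> \<in> K"
          using ar subringE[OF subring] by (simp add: minus_eq)
        ultimately have 1: "a \<otimes> r \<ominus> \<one> \<in> J" using J(2) by auto
        have 2: "a \<otimes> r \<in> J" using J.I_r_closed[OF a(1), of r] r(1) by simp
        have "a \<otimes> r \<ominus>\<^bsub>R\<^esub> (a \<otimes> r \<ominus> \<one>) \<in> J"
          using J.a_closed[OF 2 J.a_inv_closed[OF 1]] by (simp add: a_minus_def)
        moreover have "a \<otimes> r \<ominus>\<^bsub>R\<^esub> (a \<otimes> r \<ominus> \<one>) = \<one>"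
        proof -
          have "a \<otimes> r \<ominus>\<^bsub>R\<^esub> (a \<otimes> r \<ominus> \<one>) = a \<otimes> r \<ominus> (a \<otimes> r \<ominus> \<one>)"
            using R_minus[OF ar(1) \<open>a \<otimes> r \<ominus> \<one> \<in> K\<close>] .
          also have "\<dots> = \<one>" using aS rS by algebra
          finally show ?thesis .
        qed
        ultimately show False using J.one_imp_carrier \<open>J \<noteq> carrier R\<close> by simp
      qed
    qed
  qed
qed

text \<open>Noetherian induction over the ideals \<open>I \<supseteq> Q\<close>, from the unit ideal
  downwards. A proper \<open>I\<close> is enlarged to \<open>J = I + Sb\<close> with
  \<open>J/I\<close> isomorphic to \<open>S/\<mm>\<close>; dually, \<open>Ann I / Ann J\<close> is
  isomorphic to \<open>S/\<mm>\<close>. Both factors contribute the same number of steps over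
  \<open>R\<close>.\<close>

lemma simple_chain_duality:
  assumes \<mm>: "maximalideal \<mm> S" and inj: "injective_module S E" and e: "essential_generator S \<mm> E e"
    and Q: "ideal Q S" and nil: "\<And>a. a \<in> \<mm> \<Longrightarrow> \<exists>k::nat. a [^] k \<in> Q"
  shows "\<exists>l. simple_chain R SM (\<mm> \<inter> K) Q l (carrier S) \<and>
    simple_chain R E (\<mm> \<inter> K) {\<zero>\<^bsub>E\<^esub>} l {x \<in> carrier E. \<forall>a\<in>Q. a \<odot>\<^bsub>E\<^esub> x = \<zero>\<^bsub>E\<^esub>}"
proof -
  have E: "module S E" using inj by (simp add: injective_module_def)
  interpret E: module S E by fact
  interpret ER: module R E by (rule restrict_module) fact
  interpret SM: module S SM by (rule module_SM)
  interpret SMR: module R SM by (rule restrict_module[OF module_SM])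
  interpret \<mm>: maximalideal \<mm> S by fact
  have ec: "e \<in> carrier E" and e0: "\<And>a. a \<in> carrier S \<Longrightarrow> a \<odot>\<^bsub>E\<^esub> e = \<zero>\<^bsub>E\<^esub> \<longleftrightarrow> a \<in> \<mm>"
    using e by (simp_all add: essential_generator_def)
  define Ann where "Ann I = {x \<in> carrier E. \<forall>a\<in>I. a \<odot>\<^bsub>E\<^esub> x = \<zero>\<^bsub>E\<^esub>}" for I
  have Ann: "submodule (Ann I) R E" if "I \<subseteq> carrier S" for I
  proof (rule ER.submoduleI')
    fix r x assume r: "r \<in> carrier R" and x: "x \<in> Ann I"
    have "a \<odot>\<^bsub>E\<^esub> (r \<odot>\<^bsub>E\<^esub> x) = \<zero>\<^bsub>E\<^esub>" if a: "a \<in> I" for a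
      using E.smult_left_commute[of a r x] a r x \<open>I \<subseteq> carrier S\<close> K_carrier by (auto simp: Ann_def)
    then show "r \<odot>\<^bsub>E\<^esub> x \<in> Ann I" using r x by (simp add: Ann_def)
  qed (use that in \<open>auto simp: Ann_def E.smult_r_distr subset_iff\<close>)
  have \<mm>R: "submodule \<mm> R SM"
    by (rule restrict_submodule[OF module_SM ideal_submodule]) (rule \<mm>.ideal_axioms)
  have nS: "\<mm> \<inter> K \<subseteq> carrier R" by auto
  \<comment> \<open>The dimension of \<open>S/\<mm>\<close> over
    \<open>R/(\<mm> \<inter> K)\<close>. This one chain is transported to every factor, on the side
    of the ring and on the side of \<open>E\<close>.\<close>
  obtain d where d: "simple_chain R SM (\<mm> \<inter> K) \<mm> d (carrier S)"
  proof (rule SMR.simple_chain_exists[OF fin_gen \<mm>R])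
    show "r \<odot>\<^bsub>SM\<^esub> x \<in> \<mm>" if "r \<in> \<mm> \<inter> K" "x \<in> carrier SM" for r x
      using \<mm>.I_r_closed that by simp
  qed (use that in simp)
  define good where "good I \<longleftrightarrow> (\<exists>l. simple_chain R SM (\<mm> \<inter> K) I l (carrier S) \<and>
    simple_chain R E (\<mm> \<inter> K) {\<zero>\<^bsub>E\<^esub>} l (Ann I))" for I
  have "good I" if I: "ideal I S" "Q \<subseteq> I" for I
  proof (rule ccontr)
    assume "\<not> good I"
    define \<B> where "\<B> = {I. ideal I S \<and> Q \<subseteq> I \<and> \<not> good I}"
    have "\<B> \<noteq> {}" using I \<open>\<not> good I\<close> by (auto simp: \<B>_def)
    then obtain I where "I \<in> \<B>" and m: "\<And>J. J \<in> \<B> \<Longrightarrow> I \<subseteq> J \<Longrightarrow> J = I"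
      by (rule ideal_exists_maximal[OF noetherian]) (simp_all add: \<B>_def)
    then have I: "ideal I S" "Q \<subseteq> I" "\<not> good I" by (simp_all add: \<B>_def)
    have max: "J = I" if "ideal J S" "Q \<subseteq> J" "\<not> good J" "I \<subseteq> J" for J
      using m[of J] that by (simp add: \<B>_def)
    interpret I: ideal I S by fact
    have ne: "I \<noteq> carrier S"
    proof
      assume eq: "I = carrier S"
      have "x = \<zero>\<^bsub>E\<^esub>" if "x \<in> Ann (carrier S)" for x
        using that E.smult_one[of x] by (force simp: Ann_def)
      then have "Ann (carrier S) = {\<zero>\<^bsub>E\<^esub>}" by (auto simp: Ann_def)
      then have "good I" unfolding good_def eq using simple_chain.zero by metis
      then show False using I by simp
    qed
    have "\<exists>k::nat. a [^] k \<in> I" if "a \<in> \<mm>" for a using nil[OF that] I(2) by blast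
    then obtain b where b: "b \<in> carrier S" "b \<notin> I" "\<And>s. s \<in> carrier S \<Longrightarrow> s \<otimes> b \<in> I \<longleftrightarrow> s \<in> \<mm>"
      using exists_element_annihilator_maximal[OF S.is_cring noetherian \<mm> I(1) ne] by blast
    have IS: "submodule I S SM" by (rule ideal_submodule) fact
    define J where "J = adjoin S SM I b"
    have J: "submodule J S SM" "I \<subseteq> J" "b \<in> J"
      using SM.adjoin_submodule[OF IS] SM.subset_adjoin[OF IS] SM.adjoin_self[OF IS] b(1) by (auto simp: J_def)
    have JS: "ideal J S" by (rule submodule_ideal) fact
    have "J \<noteq> I" using J(3) b(2) by auto
    then have "good J" using max[OF JS] J(2) I(2) by auto
    then obtain l where l: "simple_chain R SM (\<mm> \<inter> K) J l (carrier S)"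
      "simple_chain R E (\<mm> \<inter> K) {\<zero>\<^bsub>E\<^esub>} l (Ann J)" by (auto simp: good_def)
    \<comment> \<open>Under multiplication by \<open>b\<close> the preimage of \<open>I\<close> is
      \<mm>, so the chain from \<mm> to \<open>S\<close> becomes one from \<open>I\<close> to
      \<open>J\<close>.\<close>
    have "(\<lambda>s. s \<otimes> b) \<in> mod_hom R SM SM"
      using b(1) K_carrier by (intro mod_homI) (auto simp: l_distr m_assoc)
    then have "simple_chain R SM (\<mm> \<inter> K) I d {y \<oplus>\<^bsub>SM\<^esub> w \<otimes> b | y w. y \<in> I \<and> w \<in> carrier S}"
      by (rule SMR.simple_chain_map[OF SMR.module_axioms _ \<mm>R restrict_submodule[OF module_SM IS] _ d nS])
        (use b(3) in simp)
    moreover have "{y \<oplus>\<^bsub>SM\<^esub> w \<otimes> b | y w. y \<in> I \<and> w \<in> carrier S} = J" by (simp add: J_def adjoin_def)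
    ultimately have 1: "simple_chain R SM (\<mm> \<inter> K) I (d + l) (carrier S)"
      using simple_chain_trans[OF l(1)] by simp
    \<comment> \<open>A functional on \<open>S\<close> is determined by its value at
      \<open>1\<close>. Injectivity of \<open>E\<close> thus yields an \<open>x\<close> with
      \<open>I x = 0\<close> and \<open>b x = e\<close>, which will generate \<open>Ann I\<close>
      modulo \<open>Ann J\<close>.\<close>
    obtain g where g: "g \<in> mod_hom S SM E" "\<And>w. w \<in> I \<Longrightarrow> g w = \<zero>\<^bsub>E\<^esub>" "g b = e"
      by (rule SM.injective_module_functional[OF inj IS _ ec]) (use b(1,3) e0 in auto)
    note gD = mod_homD[OF g(1)]
    define x where "x = g \<one>"
    have xc: "x \<in> carrier E" using gD(1) by (simp add: x_def)
    have gx: "g s = s \<odot>\<^bsub>E\<^esub> x" if "s \<in> carrier S" for s using gD(3)[of s \<one>] that by (simp add: x_def)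
    have bx: "b \<odot>\<^bsub>E\<^esub> x = e" using gx[OF b(1)] g(3) by simp
    have xI: "x \<in> Ann I" using gx g(2) xc I.Icarr by (auto simp: Ann_def)
    have JA: "y \<in> Ann J \<longleftrightarrow> y \<in> Ann I \<and> b \<odot>\<^bsub>E\<^esub> y = \<zero>\<^bsub>E\<^esub>" if y: "y \<in> carrier E" for y
    proof
      show "y \<in> Ann I \<and> b \<odot>\<^bsub>E\<^esub> y = \<zero>\<^bsub>E\<^esub>" if "y \<in> Ann J" using that J by (auto simp: Ann_def)
      assume a: "y \<in> Ann I \<and> b \<odot>\<^bsub>E\<^esub> y = \<zero>\<^bsub>E\<^esub>"
      have "c \<odot>\<^bsub>E\<^esub> y = \<zero>\<^bsub>E\<^esub>" if c: "c \<in> J" for c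
      proof -
        obtain i s where "i \<in> I" "s \<in> carrier S" "c = i \<oplus> s \<otimes> b"
          using c by (auto simp: J_def adjoin_def)
        then show ?thesis using a y b(1) I.Icarr by (simp add: Ann_def E.smult_l_distr E.smult_assoc1)
      qed
      then show "y \<in> Ann J" using y by (simp add: Ann_def)
    qed
    have smI: "s \<odot>\<^bsub>E\<^esub> y \<in> Ann I" if "s \<in> carrier S" "y \<in> Ann I" for s y
      using that E.smult_left_commute[of _ s y] I.Icarr by (auto simp: Ann_def)
    have h: "(\<lambda>s. s \<odot>\<^bsub>E\<^esub> x) \<in> mod_hom R SM E"
      using xc K_carrier by (intro mod_homI) (auto simp: E.smult_l_distr E.smult_assoc1)
    have JE: "submodule (Ann J) R E" using Ann ideal.Icarr[OF JS] by blast
    have IE: "submodule (Ann I) R E" using Ann I.a_subset by blast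
    have "simple_chain R E (\<mm> \<inter> K) (Ann J) d {y \<oplus>\<^bsub>E\<^esub> w \<odot>\<^bsub>E\<^esub> x | y w. y \<in> Ann J \<and> w \<in> carrier S}"
    proof (rule SMR.simple_chain_map[OF ER.module_axioms h \<mm>R JE _ d nS])
      fix s assume "s \<in> carrier SM"
      then have s: "s \<in> carrier S" by simp
      have "b \<odot>\<^bsub>E\<^esub> (s \<odot>\<^bsub>E\<^esub> x) = s \<odot>\<^bsub>E\<^esub> e" using E.smult_left_commute[OF b(1) s xc] bx by simp
      then show "s \<odot>\<^bsub>E\<^esub> x \<in> Ann J \<longleftrightarrow> s \<in> \<mm>" using JA[of "s \<odot>\<^bsub>E\<^esub> x"] smI[OF s xI] s xc e0[OF s] by simp
    qed
    moreover have "{y \<oplus>\<^bsub>E\<^esub> w \<odot>\<^bsub>E\<^esub> x | y w. y \<in> Ann J \<and> w \<in> carrier S} = Ann I"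
    proof (intro equalityI subsetI)
      show "z \<in> Ann I" if "z \<in> {y \<oplus>\<^bsub>E\<^esub> w \<odot>\<^bsub>E\<^esub> x | y w. y \<in> Ann J \<and> w \<in> carrier S}" for z
        using that JA ER.submoduleD(1)[OF JE] smI[OF _ xI] ER.submoduleD(3)[OF IE] by blast
      \<comment> \<open>\<mm> kills \<open>b z\<close> because \<open>\<mm> b \<subseteq> I\<close>,
        so \<open>b z = s e = b (s x)\<close> for some \<open>s\<close>. Then \<open>z - s x\<close>
        is killed by \<open>I\<close> and by \<open>b\<close>, hence by \<open>J\<close>.\<close>
      fix z assume z: "z \<in> Ann I"
      have zc: "z \<in> carrier E" using z by (simp add: Ann_def)
      have "a \<odot>\<^bsub>E\<^esub> (b \<odot>\<^bsub>E\<^esub> z) = \<zero>\<^bsub>E\<^esub>" if a: "a \<in> \<mm>" for a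
      proof -
        have "a \<otimes> b \<in> I" using b(3) a \<mm>.Icarr by blast
        then show ?thesis using z zc \<mm>.Icarr[OF a] b(1) by (simp add: Ann_def E.smult_assoc1[symmetric])
      qed
      then obtain s where s: "s \<in> carrier S" "b \<odot>\<^bsub>E\<^esub> z = s \<odot>\<^bsub>E\<^esub> e"
        using essential_generator_annihilated[OF E \<mm> e, of "b \<odot>\<^bsub>E\<^esub> z"] b(1) zc by auto
      have sx: "s \<odot>\<^bsub>E\<^esub> x \<in> Ann I" "s \<odot>\<^bsub>E\<^esub> x \<in> carrier E" using smI[OF s(1) xI] s(1) xc by auto
      have "b \<odot>\<^bsub>E\<^esub> (z \<ominus>\<^bsub>E\<^esub> s \<odot>\<^bsub>E\<^esub> x) = b \<odot>\<^bsub>E\<^esub> z \<ominus>\<^bsub>E\<^esub> b \<odot>\<^bsub>E\<^esub> (s \<odot>\<^bsub>E\<^esub> x)"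
        using b(1) zc sx by (simp add: E.minus_eq E.smult_r_distr E.smult_r_minus)
      also have "\<dots> = \<zero>\<^bsub>E\<^esub>"
        using s E.smult_left_commute[OF b(1) s(1) xc] bx ec by (simp add: E.diff_eq_zero_iff)
      finally have "z \<ominus>\<^bsub>E\<^esub> s \<odot>\<^bsub>E\<^esub> x \<in> Ann J" using JA ER.submoduleD(6)[OF IE z sx(1)] zc sx by simp
      moreover have "z = (z \<ominus>\<^bsub>E\<^esub> s \<odot>\<^bsub>E\<^esub> x) \<oplus>\<^bsub>E\<^esub> s \<odot>\<^bsub>E\<^esub> x" using zc sx by (simp add: E.diff_add_cancel)
      ultimately show "z \<in> {y \<oplus>\<^bsub>E\<^esub> w \<odot>\<^bsub>E\<^esub> x | y w. y \<in> Ann J \<and> w \<in> carrier S}" using s(1) by blast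
    qed
    ultimately have "simple_chain R E (\<mm> \<inter> K) {\<zero>\<^bsub>E\<^esub>} (l + d) (Ann I)"
      using simple_chain_trans[OF _ l(2)] by simp
    then have "good I" unfolding good_def using 1 by (auto simp: add.commute)
    then show False using I(3) by simp
  qed
  from this[OF Q order_refl] show ?thesis by (simp add: good_def Ann_def)
qed

text \<open>With a dual basis \<open>c\<close>, \<open>\<phi> c\<close> of \<open>S\<close> over \<open>R\<close>, an \<open>R\<close>-linear map \<open>g\<close> from an ideal \<open>J\<close> of \<open>R\<close>
  to \<open>E\<close> is extended to the \<open>S\<close>-linear map \<open>t \<mapsto> (\<Sum>c. c g (\<phi> c t))\<close> on \<open>J S\<close>.\<close>

lemma restricted_baer:
  assumes inj: "injective_module S E" and proj: "projective_module R SM"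
    and J: "ideal J R" and g: "g \<in> mod_hom R ((ring_as_module R)\<lparr>carrier := J\<rparr>) E"
  shows "\<exists>e\<in>carrier E. \<forall>a\<in>J. g a = a \<odot>\<^bsub>E\<^esub> e"
proof -
  have E: "module S E" using inj by (simp add: injective_module_def)
  interpret E: module S E by fact
  interpret ER: module R E by (rule restrict_module) fact
  interpret SM: module S SM by (rule module_SM)
  interpret SMR: module R SM by (rule restrict_module[OF module_SM])
  interpret J: ideal J R by fact
  have JK: "a \<in> K" "a \<in> carrier S" if "a \<in> J" for a using J.Icarr[OF that] K_carrier by auto
  have J0: "\<zero> \<in> J" using additive_subgroup.zero_closed[OF J.additive_subgroup_axioms] by simp
  have Ja: "a \<oplus> b \<in> J" if "a \<in> J" "b \<in> J" for a b using J.a_closed[OF that] by simp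
  have Jm: "r \<otimes> a \<in> J" "a \<otimes> r \<in> J" if "a \<in> J" "r \<in> K" for a r
    using J.I_l_closed[OF that(1), of r] J.I_r_closed[OF that(1), of r] that(2) by simp_all
  have gc: "g a \<in> carrier E" if "a \<in> J" for a using mod_homD(1)[OF g] that by simp
  have ga: "g (a \<oplus> b) = g a \<oplus>\<^bsub>E\<^esub> g b" if "a \<in> J" "b \<in> J" for a b
    using mod_homD(2)[OF g, of a b] that by (simp add: ring_as_module_def)
  have gm: "g (r \<otimes> a) = r \<odot>\<^bsub>E\<^esub> g a" if "a \<in> J" "r \<in> K" for a r
    using mod_homD(3)[OF g, of r a] that by (simp add: ring_as_module_def)
  obtain C \<phi> where C: "finite C" "C \<subseteq> carrier SM"
    and \<phi>: "\<And>c. c \<in> C \<Longrightarrow> \<phi> c \<in> mod_hom R SM (ring_as_module R)"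
    and dual: "\<And>x. x \<in> carrier SM \<Longrightarrow> x = finsum SM (\<lambda>c. \<phi> c x \<odot>\<^bsub>SM\<^esub> c) C"
  proof (rule SMR.projective_dual_basis[OF proj fin_gen])
    fix C \<phi> assume "finite C" "C \<subseteq> carrier SM" "\<And>c. c \<in> C \<Longrightarrow> \<phi> c \<in> mod_hom R SM (ring_as_module R)"
      "\<And>x. x \<in> carrier SM \<Longrightarrow> x = finsum SM (\<lambda>c. \<phi> c x \<odot>\<^bsub>SM\<^esub> c) C"
    then show thesis by (rule that)
  qed
  have CS: "c \<in> carrier S" if "c \<in> C" for c using C(2) that by auto
  have \<phi>c: "\<phi> c x \<in> K" if "c \<in> C" "x \<in> carrier S" for c x using mod_homD(1)[OF \<phi>[OF that(1)], of x] that by simp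
  have \<phi>a: "\<phi> c (x \<oplus> y) = \<phi> c x \<oplus> \<phi> c y" if "c \<in> C" "x \<in> carrier S" "y \<in> carrier S" for c x y
    using mod_homD(2)[OF \<phi>[OF that(1)], of x y] that by (simp add: ring_as_module_def)
  have \<phi>m: "\<phi> c (r \<otimes> x) = r \<otimes> \<phi> c x" if "c \<in> C" "r \<in> K" "x \<in> carrier S" for c r x
    using mod_homD(3)[OF \<phi>[OF that(1)], of r x] that by (simp add: ring_as_module_def)
  have \<phi>0: "\<phi> c \<zero> = \<zero>" if "c \<in> C" for c
    using \<phi>m[OF that subringE(2)[OF subring] zero_closed] \<phi>c[OF that zero_closed] K_carrier by simp
  \<comment> \<open>The extended ideal \<open>J S\<close>, described by coordinates with respect to
    the dual basis so that \<open>g\<close> can be applied to each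
    \<open>\<phi> c t\<close>.\<close>
  define T where "T = {t \<in> carrier S. \<forall>c\<in>C. \<phi> c t \<in> J}"
  have TR: "submodule T R SM"
    by (rule SMR.submoduleI') (use J0 Ja Jm K_carrier in \<open>auto simp: T_def \<phi>0 \<phi>a \<phi>m\<close>)
  note TD = SMR.submoduleD[OF TR]
  have TS: "t \<in> carrier S" if "t \<in> T" for t using that by (simp add: T_def)
  have T\<phi>: "\<phi> c t \<in> J" if "t \<in> T" "c \<in> C" for t c using that by (simp add: T_def)
  define H where "H t = finsum E (\<lambda>c. c \<odot>\<^bsub>E\<^esub> g (\<phi> c t)) C" for t
  have Hc: "(\<lambda>c. c \<odot>\<^bsub>E\<^esub> g (\<phi> c t)) \<in> C \<rightarrow> carrier E" if "t \<in> T" for t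
    using gc T\<phi>[OF that] CS by auto
  have HR: "H \<in> mod_hom R (SM\<lparr>carrier := T\<rparr>) E"
  proof (rule mod_homI)
    fix t assume "t \<in> carrier (SM\<lparr>carrier := T\<rparr>)"
    then have t: "t \<in> T" by simp
    show "H t \<in> carrier E" unfolding H_def by (rule E.finsum_closed) (rule Hc[OF t])
    { fix u assume "u \<in> carrier (SM\<lparr>carrier := T\<rparr>)"
      then have u: "u \<in> T" by simp
      have "H (t \<oplus> u) = finsum E (\<lambda>c. c \<odot>\<^bsub>E\<^esub> g (\<phi> c t) \<oplus>\<^bsub>E\<^esub> c \<odot>\<^bsub>E\<^esub> g (\<phi> c u)) C"
        unfolding H_def using Hc[OF t] Hc[OF u] T\<phi>[OF t] T\<phi>[OF u] TS[OF t] TS[OF u] CS gc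
        by (intro E.finsum_cong') (auto simp: \<phi>a ga E.smult_r_distr)
      also have "\<dots> = H t \<oplus>\<^bsub>E\<^esub> H u" unfolding H_def by (rule E.finsum_addf[OF Hc[OF t] Hc[OF u]])
      finally show "H (t \<oplus>\<^bsub>SM\<lparr>carrier := T\<rparr>\<^esub> u) = H t \<oplus>\<^bsub>E\<^esub> H u" by (simp add: ring_as_module_def) }
    { fix r assume "r \<in> carrier R"
      then have r: "r \<in> K" "r \<in> carrier S" using K_carrier by auto
      have "H (r \<otimes> t) = finsum E (\<lambda>c. r \<odot>\<^bsub>E\<^esub> (c \<odot>\<^bsub>E\<^esub> g (\<phi> c t))) C"
        unfolding H_def using Hc[OF t] T\<phi>[OF t] TS[OF t] CS gc r
        by (intro E.finsum_cong') (auto simp: \<phi>m gm E.smult_left_commute)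
      also have "\<dots> = r \<odot>\<^bsub>E\<^esub> H t" unfolding H_def by (rule E.finsum_smult_ldistr[symmetric, OF C(1) r(2) Hc[OF t]])
      finally show "H (r \<odot>\<^bsub>SM\<lparr>carrier := T\<rparr>\<^esub> t) = r \<odot>\<^bsub>E\<^esub> H t" by (simp add: ring_as_module_def) }
  qed
  have aT: "a \<otimes> u \<in> T" if "a \<in> J" "u \<in> carrier S" for a u
    using that JK \<phi>m \<phi>c Jm by (auto simp: T_def)
  \<comment> \<open>The coefficients \<open>\<phi> c u\<close> come out of \<open>g\<close>, and the
    dual basis reassembles them to \<open>u\<close>. For \<open>u = 1\<close> this says that
    \<open>H\<close> extends \<open>g\<close>.\<close>
  have Hau: "H (a \<otimes> u) = u \<odot>\<^bsub>E\<^esub> g a" if a: "a \<in> J" and u: "u \<in> carrier S" for a u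
  proof -
    have "H (a \<otimes> u) = finsum E (\<lambda>c. (\<phi> c u \<otimes> c) \<odot>\<^bsub>E\<^esub> g a) C"
      unfolding H_def
    proof (rule E.finsum_cong')
      show "c \<odot>\<^bsub>E\<^esub> g (\<phi> c (a \<otimes> u)) = (\<phi> c u \<otimes> c) \<odot>\<^bsub>E\<^esub> g a" if c: "c \<in> C" for c
      proof -
        have "g (\<phi> c (a \<otimes> u)) = g (\<phi> c u \<otimes> a)"
          using \<phi>m[OF c JK(1)[OF a] u] m_comm[OF JK(2)[OF a] K_carrier[OF \<phi>c[OF c u]]] by simp
        also have "\<dots> = \<phi> c u \<odot>\<^bsub>E\<^esub> g a" by (rule gm[OF a \<phi>c[OF c u]])
        finally show ?thesis
          using CS[OF c] K_carrier[OF \<phi>c[OF c u]] gc[OF a] by (simp add: E.smult_assoc1 E.smult_left_commute)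
      qed
    qed (use gc[OF a] K_carrier[OF \<phi>c[OF _ u]] CS in auto)
    also have "\<dots> = (finsum SM (\<lambda>c. \<phi> c u \<odot>\<^bsub>SM\<^esub> c) C) \<odot>\<^bsub>E\<^esub> g a"
    proof -
      have "(\<lambda>s. s \<odot>\<^bsub>E\<^esub> g a) \<in> mod_hom S SM E"
        using gc[OF a] by (intro mod_homI) (auto simp: E.smult_l_distr E.smult_assoc1)
      then show ?thesis
        using mod_hom_finsum[OF module_SM E, of "\<lambda>s. s \<odot>\<^bsub>E\<^esub> g a" C "\<lambda>c. \<phi> c u \<odot>\<^bsub>SM\<^esub> c"] C(1)
          K_carrier[OF \<phi>c[OF _ u]] CS by (simp add: Pi_def)
    qed
    also have "\<dots> = u \<odot>\<^bsub>E\<^esub> g a" using dual[of u] u by simp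
    finally show ?thesis .
  qed
  \<comment> \<open>Expanding \<open>t\<close> writes \<open>s t\<close> as a sum of products of
    \<open>\<phi> c t \<in> J\<close> with \<open>s c\<close>. The preceding formula evaluates
    \<open>H\<close> on each of them, so additivity over \<open>T\<close> leads to linearity over
    \<open>S\<close>.\<close>
  have HsT: "s \<otimes> t \<in> T \<and> H (s \<otimes> t) = finsum E (\<lambda>c. (s \<otimes> c) \<odot>\<^bsub>E\<^esub> g (\<phi> c t)) C"
    if s: "s \<in> carrier S" and t: "t \<in> T" for s t
  proof -
    have f: "(\<lambda>c. \<phi> c t \<otimes> (s \<otimes> c)) \<in> C \<rightarrow> T" using aT T\<phi>[OF t] CS s by auto
    have "(\<lambda>x. s \<otimes> x) \<in> mod_hom S SM SM"
      using s by (intro mod_homI) (auto simp: r_distr m_lcomm)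
    from mod_hom_finsum[OF module_SM module_SM this C(1), of "\<lambda>c. \<phi> c t \<odot>\<^bsub>SM\<^esub> c"]
    have "s \<otimes> finsum SM (\<lambda>c. \<phi> c t \<odot>\<^bsub>SM\<^esub> c) C = finsum SM (\<lambda>c. s \<otimes> (\<phi> c t \<odot>\<^bsub>SM\<^esub> c)) C"
      using K_carrier[OF \<phi>c[OF _ TS[OF t]]] CS by (simp add: Pi_def)
    also have "\<dots> = finsum SM (\<lambda>c. \<phi> c t \<otimes> (s \<otimes> c)) C"
      using K_carrier[OF \<phi>c[OF _ TS[OF t]]] CS s by (intro SM.finsum_cong') (auto simp: m_lcomm)
    finally have eq: "s \<otimes> t = finsum SM (\<lambda>c. \<phi> c t \<otimes> (s \<otimes> c)) C" using dual[of t] TS[OF t] by simp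
    note U = SMR.finsum_submodule[OF TR C(1) f]
    have "H (finsum (SM\<lparr>carrier := T\<rparr>) (\<lambda>c. \<phi> c t \<otimes> (s \<otimes> c)) C) = finsum E (\<lambda>c. H (\<phi> c t \<otimes> (s \<otimes> c))) C"
      using mod_hom_finsum[OF submodule.submodule_is_module[OF TR SMR.module_axioms] ER.module_axioms HR C(1)] f by simp
    also have "\<dots> = finsum E (\<lambda>c. (s \<otimes> c) \<odot>\<^bsub>E\<^esub> g (\<phi> c t)) C"
      using Hau T\<phi>[OF t] CS s gc by (intro E.finsum_cong') auto
    finally show ?thesis using eq U by simp
  qed
  have TSM: "submodule T S SM" by (rule SM.submoduleI') (use TD HsT in auto)
  have "H \<in> mod_hom S (SM\<lparr>carrier := T\<rparr>) E"
  proof (rule mod_homI)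
    fix s t assume "s \<in> carrier S" "t \<in> carrier (SM\<lparr>carrier := T\<rparr>)"
    then have s: "s \<in> carrier S" and t: "t \<in> T" by auto
    have "H (s \<otimes> t) = finsum E (\<lambda>c. s \<odot>\<^bsub>E\<^esub> (c \<odot>\<^bsub>E\<^esub> g (\<phi> c t))) C"
      using HsT[OF s t] T\<phi>[OF t] CS s gc by (auto simp: E.smult_assoc1 intro!: E.finsum_cong')
    also have "\<dots> = s \<odot>\<^bsub>E\<^esub> H t" unfolding H_def by (rule E.finsum_smult_ldistr[symmetric, OF C(1) s Hc[OF t]])
    finally show "H (s \<odot>\<^bsub>SM\<lparr>carrier := T\<rparr>\<^esub> t) = s \<odot>\<^bsub>E\<^esub> H t" by (simp add: ring_as_module_def)
  qed (use mod_homD(1,2)[OF HR] in auto)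
  moreover have "module S (SM\<lparr>carrier := T\<rparr>)" by (rule submodule.submodule_is_module[OF TSM module_SM])
  moreover have "id \<in> mod_hom S (SM\<lparr>carrier := T\<rparr>) SM"
    using TS by (auto simp: mod_hom_def ring_as_module_def)
  ultimately obtain h where h: "h \<in> mod_hom S SM E" "\<And>t. t \<in> T \<Longrightarrow> h t = H t"
    using injective_module_extend[OF inj _ module_SM, of "SM\<lparr>carrier := T\<rparr>" id H] by auto
  show ?thesis
  proof (intro bexI ballI)
    show "h \<one> \<in> carrier E" using mod_homD(1)[OF h(1)] by simp
    fix a assume a: "a \<in> J"
    have "h a = a \<odot>\<^bsub>E\<^esub> h \<one>" using mod_homD(3)[OF h(1), of a \<one>] JK[OF a] by simp
    moreover have "h a = g a" using h(2)[OF aT[OF a one_closed]] Hau[OF a one_closed] JK[OF a] gc[OF a] by simp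
    ultimately show "g a = a \<odot>\<^bsub>E\<^esub> h \<one>" by simp
  qed
qed

end

section \<open>The primary component at the maximal ideal\<close>

text \<open>Multiplying elements of the \<open>Q i\<close> outside \<open>P\<close>, one for each
  \<open>i\<close>, gives an element of all \<open>Q i\<close> that primality keeps outside
  \<open>P\<close>.\<close>

lemma primeideal_Inter_not_subset:
  assumes "primeideal P A" "finite J" "\<And>i. i \<in> J \<Longrightarrow> ideal (Q i) A \<and> \<not> Q i \<subseteq> P"
  shows "\<exists>u\<in>carrier A. u \<notin> P \<and> (\<forall>i\<in>J. u \<in> Q i)"
proof -
  interpret P: primeideal P A by fact
  show ?thesis using assms(2,3)
  proof (induction J rule: finite_induct)
    case empty
    then show ?case using P.I_notcarr P.Icarr by blast
  next
    case (insert i J)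
    then obtain u where u: "u \<in> carrier A" "u \<notin> P" "\<forall>j\<in>J. u \<in> Q j" by auto
    have i: "ideal (Q i) A" "\<not> Q i \<subseteq> P" using insert.prems by auto
    obtain v where v: "v \<in> Q i" "v \<notin> P" using i(2) by auto
    have vc: "v \<in> carrier A" by (rule ideal.Icarr[OF i(1) v(1)])
    have "u \<otimes>\<^bsub>A\<^esub> v \<notin> P" using P.I_prime u v vc by blast
    moreover have "u \<otimes>\<^bsub>A\<^esub> v \<in> Q i" by (rule ideal.I_l_closed[OF i(1) v(1) u(1)])
    moreover have "u \<otimes>\<^bsub>A\<^esub> v \<in> Q j" if "j \<in> J" for j
      using ideal.I_r_closed[of "Q j" A u v] insert.prems u(3) vc that by simp
    ultimately show ?case using u(1) vc by (intro bexI[of _ "u \<otimes>\<^bsub>A\<^esub> v"]) auto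
  qed
qed

section \<open>Incomparability and the comparison of the two hulls\<close>

context finite_extension
begin

text \<open>Incomparability: a descending chain \<open>Q + s\<^sup>k S\<close> with \<open>s \<in> \<mm>\<close> must stop because \<open>S/Q\<close> has finite
  length over \<open>R\<close>, and \<open>s\<^sup>k (1 - s t) \<in> Q\<close> forces \<open>s\<^sup>k \<in> Q\<close>.\<close>

lemma radical_eq_maximal:
  assumes \<mm>: "maximalideal \<mm> S" and Q: "primary_ideal S Q" and nQ: "\<mm> \<inter> K \<subseteq> Q" and Qm: "Q \<subseteq> \<mm>"
  shows "radical_ideal S Q = \<mm>"
proof
  interpret \<mm>: maximalideal \<mm> S by fact
  interpret P: primeideal \<mm> S by (rule maximalideal_prime) fact
  interpret Q: ideal Q S using Q by (simp add: primary_ideal_def)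
  interpret SM: module S SM by (rule module_SM)
  interpret SMR: module R SM by (rule restrict_module[OF module_SM])
  have pow: "a \<in> \<mm>" if "a \<in> carrier S" "a [^] k \<in> \<mm>" for a and k :: nat
    using that
  proof (induction k)
    case 0
    then show ?case using \<mm>.one_imp_carrier by simp
  next
    case (Suc k)
    then show ?case using P.I_prime[of "a [^] k" a] by auto
  qed
  show "radical_ideal S Q \<subseteq> \<mm>" using pow Qm by (auto simp: radical_ideal_def)
  show "\<mm> \<subseteq> radical_ideal S Q"
  proof
    fix s assume s: "s \<in> \<mm>"
    have sS: "s \<in> carrier S" by (rule \<mm>.Icarr[OF s])
    have QS: "submodule Q S SM" by (rule ideal_submodule) (rule Q.ideal_axioms)
    have QR: "submodule Q R SM" by (rule restrict_submodule[OF module_SM QS])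
    obtain l where l: "simple_chain R SM (\<mm> \<inter> K) Q l (carrier SM)"
    proof (rule SMR.simple_chain_exists[OF fin_gen QR])
      show "r \<odot>\<^bsub>SM\<^esub> x \<in> Q" if "r \<in> \<mm> \<inter> K" "x \<in> carrier SM" for r x
        using Q.I_r_closed[of r x] nQ that by auto
    qed (use that in simp)
    define D where "D k = adjoin S SM Q (s [^] k)" for k :: nat
    have D: "submodule (D k) S SM" "Q \<subseteq> D k" "s [^] k \<in> D k" for k
      using SM.adjoin_submodule[OF QS] SM.subset_adjoin[OF QS] SM.adjoin_self[OF QS] sS by (auto simp: D_def)
    have dec: "D (Suc k) \<subseteq> D k" for k
      unfolding D_def[of "Suc k"]
      by (rule SM.adjoin_least[OF D(1,2)]) (use SM.submoduleD(4)[OF D(1) sS D(3)] sS in \<open>simp add: m_comm\<close>)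
    have "\<exists>k. s [^] k \<in> D (Suc k)"
    proof (rule ccontr)
      assume neg: "\<not> (\<exists>k. s [^] k \<in> D (Suc k))"
      \<comment> \<open>The descending ideals are indexed backwards, from \<open>D (Suc l)\<close>
        up to \<open>D 0\<close>: these are \<open>Suc l\<close> strict inclusions above
        \<open>Q\<close>, one more than the length allows.\<close>
      have "Suc l \<le> l"
      proof (rule SMR.simple_chain_length_le[OF maximalideal_contraction[OF \<mm>] QR l])
        show "submodule (D (Suc l - i)) R SM \<and> Q \<subseteq> D (Suc l - i) \<and> D (Suc l - i) \<subseteq> carrier SM" for i
          using restrict_submodule[OF module_SM D(1)] D(2) SM.submoduleD(1)[OF D(1)] by blast
        show "D (Suc l - i) \<subset> D (Suc l - Suc i)" if "i < Suc l" for i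
        proof -
          have eq: "Suc l - i = Suc (l - i)" "Suc l - Suc i = l - i" using that by auto
          show ?thesis unfolding eq using dec neg D(3) by blast
        qed
      qed
      then show False by simp
    qed
    then obtain k q t where k: "q \<in> Q" "t \<in> carrier S" "s [^] k = q \<oplus> t \<otimes> s [^] Suc k"
      by (auto simp: D_def adjoin_def)
    have c: "q \<in> carrier S" "s [^] k \<in> carrier S" using k(1) Q.Icarr sS by auto
    have "s [^] k \<otimes> (\<one> \<ominus> s \<otimes> t) = s [^] k \<ominus> t \<otimes> (s [^] k \<otimes> s)"
      using c(2) sS k(2) by algebra
    also have "\<dots> = (q \<oplus> t \<otimes> (s [^] k \<otimes> s)) \<ominus> t \<otimes> (s [^] k \<otimes> s)" using k(3) by simp
    also have "\<dots> = q" using c k(2) sS by algebra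
    finally have "s [^] k \<otimes> (\<one> \<ominus> s \<otimes> t) \<in> Q" using k(1) by simp
    moreover have uc: "\<one> \<ominus> s \<otimes> t \<in> carrier S" using sS k(2) by simp
    ultimately have "s [^] k \<in> Q \<or> (\<exists>n::nat. (\<one> \<ominus> s \<otimes> t) [^] n \<in> Q)"
      using Q c(2) unfolding primary_ideal_def by blast
    moreover have "\<not> (\<exists>n::nat. (\<one> \<ominus> s \<otimes> t) [^] n \<in> Q)"
    proof
      assume "\<exists>n::nat. (\<one> \<ominus> s \<otimes> t) [^] n \<in> Q"
      then have "\<one> \<ominus> s \<otimes> t \<in> \<mm>" using pow[OF uc] Qm by blast
      then have "(\<one> \<ominus> s \<otimes> t) \<oplus> s \<otimes> t \<in> \<mm>" using \<mm>.I_r_closed[OF s k(2)] by simp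
      moreover have "(\<one> \<ominus> s \<otimes> t) \<oplus> s \<otimes> t = \<one>" using sS k(2) by algebra
      ultimately show False using \<mm>.one_imp_carrier \<mm>.I_notcarr by simp
    qed
    ultimately show "s \<in> radical_ideal S Q" using sS by (auto simp: radical_ideal_def)
  qed
qed

lemma annihilated_iff_primary_component:
  assumes \<mm>: "maximalideal \<mm> S" and E: "module S E" and e: "essential_generator S \<mm> E e"
    and dec: "minimal_primary_decomposition S (Idl (\<mm> \<inter> K)) Q c" "1 \<le> c" and Q1: "radical_ideal S (Q 1) = \<mm>"
    and x: "x \<in> carrier E"
  shows "(\<forall>a\<in>\<mm> \<inter> K. a \<odot>\<^bsub>E\<^esub> x = \<zero>\<^bsub>E\<^esub>) \<longleftrightarrow> (\<forall>a\<in>Q 1. a \<odot>\<^bsub>E\<^esub> x = \<zero>\<^bsub>E\<^esub>)"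
proof -
  interpret E: module S E by fact
  interpret \<mm>: maximalideal \<mm> S by fact
  interpret P: primeideal \<mm> S by (rule maximalideal_prime) fact
  have ec: "e \<in> carrier E" and e0: "\<And>a. a \<in> carrier S \<Longrightarrow> a \<odot>\<^bsub>E\<^esub> e = \<zero>\<^bsub>E\<^esub> \<longleftrightarrow> a \<in> \<mm>"
    using e by (simp_all add: essential_generator_def)
  have prim: "\<And>i. i \<in> {1..c} \<Longrightarrow> primary_ideal S (Q i)"
    and nS: "Idl (\<mm> \<inter> K) = carrier S \<inter> (\<Inter>i\<in>{1..c}. Q i)"
    and inj: "inj_on (\<lambda>i. radical_ideal S (Q i)) {1..c}"
    using dec(1) by (auto simp: minimal_primary_decomposition_def)
  have sub: "\<mm> \<inter> K \<subseteq> Idl (\<mm> \<inter> K)" using \<mm>.a_subset by (intro genideal_self) auto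
  have nQ: "\<mm> \<inter> K \<subseteq> Q i" if "i \<in> {1..c}" for i using sub nS that by auto
  have Qid: "ideal (Q i) S" if "i \<in> {1..c}" for i using prim[OF that] by (simp add: primary_ideal_def)
  \<comment> \<open>A component inside \<mm> would have radical \<mm> by incomparability, the same
    as \<open>Q 1\<close>, against the distinctness of the radicals in a minimal
    decomposition.\<close>
  have "\<not> Q i \<subseteq> \<mm>" if i: "i \<in> {2..c}" for i
  proof
    assume "Q i \<subseteq> \<mm>"
    then have "radical_ideal S (Q i) = radical_ideal S (Q 1)"
      using radical_eq_maximal[OF \<mm> prim nQ] i Q1 by auto
    then have "i = 1" using inj i by (auto dest: inj_onD)
    then show False using i by simp
  qed
  then have "\<exists>u\<in>carrier S. u \<notin> \<mm> \<and> (\<forall>i\<in>{2..c}. u \<in> Q i)"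
    by (intro primeideal_Inter_not_subset P.primeideal_axioms) (use Qid in auto)
  then obtain u where u: "u \<in> carrier S" "u \<notin> \<mm>" "\<forall>i\<in>{2..c}. u \<in> Q i" by blast
  \<comment> \<open>A nonzero \<open>y\<close> has a nonzero multiple \<open>a y = b e\<close>. If
    \<open>u y = 0\<close>, then \<open>u b\<close> lies in \<mm>, hence so does \<open>b\<close>,
    and \<open>b e\<close> would vanish.\<close>
  have uinj: "y = \<zero>\<^bsub>E\<^esub>" if y: "y \<in> carrier E" "u \<odot>\<^bsub>E\<^esub> y = \<zero>\<^bsub>E\<^esub>" for y
  proof (rule ccontr)
    assume "y \<noteq> \<zero>\<^bsub>E\<^esub>"
    then obtain a b where ab: "a \<in> carrier S" "b \<in> carrier S" "a \<odot>\<^bsub>E\<^esub> y = b \<odot>\<^bsub>E\<^esub> e" "a \<odot>\<^bsub>E\<^esub> y \<noteq> \<zero>\<^bsub>E\<^esub>"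
      using e y(1) unfolding essential_generator_def by blast
    have "(u \<otimes> b) \<odot>\<^bsub>E\<^esub> e = u \<odot>\<^bsub>E\<^esub> (a \<odot>\<^bsub>E\<^esub> y)" using ab u(1) ec by (simp add: E.smult_assoc1)
    also have "\<dots> = a \<odot>\<^bsub>E\<^esub> (u \<odot>\<^bsub>E\<^esub> y)" by (rule E.smult_left_commute[OF u(1) ab(1) y(1)])
    also have "\<dots> = \<zero>\<^bsub>E\<^esub>" using y(2) ab(1) by simp
    finally have "u \<otimes> b \<in> \<mm>" using e0[of "u \<otimes> b"] u(1) ab(2) by simp
    then have "b \<in> \<mm>" using P.I_prime u ab(2) by blast
    then show False using ab e0 by simp
  qed
  show ?thesis
  proof
    assume kill: "\<forall>a\<in>\<mm> \<inter> K. a \<odot>\<^bsub>E\<^esub> x = \<zero>\<^bsub>E\<^esub>"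
    let ?I = "{a \<in> carrier S. a \<odot>\<^bsub>E\<^esub> x = \<zero>\<^bsub>E\<^esub>}"
    have I: "Idl (\<mm> \<inter> K) \<subseteq> ?I"
      by (rule genideal_minimal[OF E.annihilator_ideal[OF x]]) (use kill \<mm>.Icarr in auto)
    show "\<forall>a\<in>Q 1. a \<odot>\<^bsub>E\<^esub> x = \<zero>\<^bsub>E\<^esub>"
    proof
      fix q assume q: "q \<in> Q 1"
      have 1: "1 \<in> {1..c}" using dec(2) by simp
      have qc: "q \<in> carrier S" by (rule ideal.Icarr[OF Qid[OF 1] q])
      \<comment> \<open>\<open>q\<close> provides membership in \<open>Q 1\<close> and
        \<open>u\<close> in the other components, so \<open>u q\<close> lies in the extended ideal
        and kills \<open>x\<close>; injectivity of \<open>u\<close> then removes the factor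
        \<open>u\<close>.\<close>
      have "u \<otimes> q \<in> Q i" if i: "i \<in> {1..c}" for i
      proof (cases "i = 1")
        case True
        then show ?thesis using ideal.I_l_closed[OF Qid[OF 1] q u(1)] by simp
      next
        case False
        then show ?thesis using ideal.I_r_closed[OF Qid[OF i] _ qc] u(3) i by auto
      qed
      then have "u \<otimes> q \<in> Idl (\<mm> \<inter> K)" unfolding nS using u(1) qc by auto
      then have "(u \<otimes> q) \<odot>\<^bsub>E\<^esub> x = \<zero>\<^bsub>E\<^esub>" using I by auto
      then show "q \<odot>\<^bsub>E\<^esub> x = \<zero>\<^bsub>E\<^esub>" using uinj[of "q \<odot>\<^bsub>E\<^esub> x"] u(1) qc x by (simp add: E.smult_assoc1)
    qed
  next
    assume "\<forall>a\<in>Q 1. a \<odot>\<^bsub>E\<^esub> x = \<zero>\<^bsub>E\<^esub>"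
    then show "\<forall>a\<in>\<mm> \<inter> K. a \<odot>\<^bsub>E\<^esub> x = \<zero>\<^bsub>E\<^esub>" using nQ[of 1] dec(2) by auto
  qed
qed

lemma nat_pow_restrict: "a [^]\<^bsub>R\<^esub> (k::nat) = a [^] k"
  by (induction k) simp_all

lemma restricted_injective_hull:
  assumes \<mm>: "maximalideal \<mm> S" and inj: "injective_module S E" and e: "essential_generator S \<mm> E e"
    and F: "injective_module R F" and f: "essential_generator R (\<mm> \<inter> K) F f"
    and proj: "projective_module R SM"
    and ch: "simple_chain R E (\<mm> \<inter> K) {\<zero>\<^bsub>E\<^esub>} l {x \<in> carrier E. \<forall>a\<in>\<mm> \<inter> K. a \<odot>\<^bsub>E\<^esub> x = \<zero>\<^bsub>E\<^esub>}"
  shows "mod_isomorphic R E (module_power F l)"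
proof -
  have E: "module S E" using inj by (simp add: injective_module_def)
  have FR: "module R F" using F by (simp add: injective_module_def)
  have P: "module R (module_power F l)" by (rule module_module_power[OF FR])
  interpret E: module S E by fact
  interpret ER: module R E by (rule restrict_module) fact
  interpret P: module R "module_power F l" by (rule P)
  let ?P = "module_power F l"
  note n = maximalideal_contraction[OF \<mm>]
  interpret n: maximalideal "\<mm> \<inter> K" R by (rule n)
  interpret \<mm>: maximalideal \<mm> S by fact
  define V where "V = {x \<in> carrier E. \<forall>a\<in>\<mm> \<inter> K. a \<odot>\<^bsub>E\<^esub> x = \<zero>\<^bsub>E\<^esub>}"
  have "\<exists>h\<in>mod_hom R E ?P. (\<forall>v\<in>V. h v = \<zero>\<^bsub>?P\<^esub> \<longrightarrow> v = \<zero>\<^bsub>E\<^esub>) \<and>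
      (\<forall>y\<in>carrier ?P. (\<forall>a\<in>\<mm> \<inter> K. a \<odot>\<^bsub>?P\<^esub> y = \<zero>\<^bsub>?P\<^esub>) \<longrightarrow> y \<in> h ` V)"
    by (rule ER.simple_chain_socle_map[OF F n f ch[folded V_def]]) (simp add: V_def)
  then obtain h where h: "h \<in> mod_hom R E ?P" and hV: "\<forall>v\<in>V. h v = \<zero>\<^bsub>?P\<^esub> \<longrightarrow> v = \<zero>\<^bsub>E\<^esub>"
    and onto: "\<forall>y\<in>carrier ?P. (\<forall>a\<in>\<mm> \<inter> K. a \<odot>\<^bsub>?P\<^esub> y = \<zero>\<^bsub>?P\<^esub>) \<longrightarrow> y \<in> h ` V"
    by (elim bexE conjE)
  note hD = mod_homD[OF h]
  have ker: "x = \<zero>\<^bsub>E\<^esub>" if x: "x \<in> carrier E" "h x = \<zero>\<^bsub>?P\<^esub>" for x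
  proof (rule ccontr)
    assume x0: "x \<noteq> \<zero>\<^bsub>E\<^esub>"
    have nK: "\<mm> \<inter> K \<subseteq> carrier R" by simp
    \<comment> \<open>Nilpotence of the action comes from the structure over \<open>S\<close>, but
      the multiplier has to lie in \<open>R\<close> for \<open>h\<close> to respect it; the chain
      condition of \<open>R\<close> supplies it. The multiple is then a nonzero element of
      \<open>V\<close> in the kernel.\<close>
    obtain r where r: "r \<in> carrier R" "r \<odot>\<^bsub>E\<^esub> x \<noteq> \<zero>\<^bsub>E\<^esub>"
      "\<And>a. a \<in> \<mm> \<inter> K \<Longrightarrow> a \<odot>\<^bsub>E\<^esub> (r \<odot>\<^bsub>E\<^esub> x) = \<zero>\<^bsub>E\<^esub>"
    proof (rule ER.exists_multiple_annihilated[OF noetherian_subring nK x(1) x0])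
      fix a r assume "a \<in> \<mm> \<inter> K" "r \<in> carrier R"
      then show "\<exists>k::nat. (a [^]\<^bsub>R\<^esub> k) \<odot>\<^bsub>E\<^esub> (r \<odot>\<^bsub>E\<^esub> x) = \<zero>\<^bsub>E\<^esub>"
        unfolding nat_pow_restrict
        by (intro E.essential_generator_nilpotent[OF noetherian \<mm>.ideal_axioms e]) (use x(1) in auto)
    qed blast
    have "r \<odot>\<^bsub>E\<^esub> x \<in> V" unfolding V_def using r x(1) ER.smult_closed by blast
    moreover have "h (r \<odot>\<^bsub>E\<^esub> x) = \<zero>\<^bsub>?P\<^esub>" using hD(3)[OF r(1) x(1)] x(2) P.smult_r_null[OF r(1)] by simp
    ultimately show False using hV r(2) by blast
  qed
  have hinj: "inj_on h (carrier E)"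
  proof (rule inj_onI)
    fix x y assume xy: "x \<in> carrier E" "y \<in> carrier E" "h x = h y"
    have "h (x \<ominus>\<^bsub>E\<^esub> y) = \<zero>\<^bsub>?P\<^esub>"
      unfolding ER.hom_diff[OF P h xy(1,2)] using hD(1)[OF xy(1)] hD(1)[OF xy(2)] xy(3)
      by (simp add: P.diff_eq_zero_iff)
    then show "x = y" using ker[of "x \<ominus>\<^bsub>E\<^esub> y"] xy by (simp add: E.diff_eq_zero_iff)
  qed
  have "h ` carrier E = carrier ?P"
  proof (rule surjective_of_essential_image[OF ER.module_axioms P h hinj restricted_baer[OF inj proj]])
    fix y assume y: "y \<in> carrier ?P" "y \<noteq> \<zero>\<^bsub>?P\<^esub>"
    \<comment> \<open>The multiple lies in the socle of the power, all of which is reached from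
      \<open>V\<close>; hence the image of \<open>h\<close> is essential.\<close>
    obtain r where r: "r \<in> carrier R" "r \<odot>\<^bsub>?P\<^esub> y \<noteq> \<zero>\<^bsub>?P\<^esub>"
      "\<And>a. a \<in> \<mm> \<inter> K \<Longrightarrow> a \<odot>\<^bsub>?P\<^esub> (r \<odot>\<^bsub>?P\<^esub> y) = \<zero>\<^bsub>?P\<^esub>"
      by (rule module_power_essential[OF FR n.ideal_axioms f y]) blast
    have "r \<odot>\<^bsub>?P\<^esub> y \<in> h ` V" using onto P.smult_closed[OF r(1) y(1)] r(3) by blast
    then have "r \<odot>\<^bsub>?P\<^esub> y \<in> h ` carrier E" by (auto simp: V_def)
    then show "\<exists>r\<in>carrier R. r \<odot>\<^bsub>?P\<^esub> y \<noteq> \<zero>\<^bsub>?P\<^esub> \<and> r \<odot>\<^bsub>?P\<^esub> y \<in> h ` carrier E" using r(1,2) by blast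
  qed
  then show ?thesis unfolding mod_isomorphic_def bij_betw_def using h hinj by blast
qed

end

text \<open>Hulls are determined only up to isomorphism, so \<open>E\<close> and \<open>F\<close>
  are arbitrary hulls on arbitrary types. Lengths are extended naturals while a power needs a
  natural exponent; the number \<open>l\<close> therefore comes together with the finiteness of the
  length.\<close>

theorem theorem4:
  fixes S :: "('a, 's) ring_scheme" and K \<mm> :: "'a set" and Q :: "nat \<Rightarrow> 'a set" and c :: nat
    and E :: "('a, 'e, 'm) module_scheme" and F :: "('a, 'f, 'n) module_scheme"
  defines "R \<equiv> S\<lparr>carrier := K\<rparr>"
  assumes "cring S" and "subring K S" and "regular_ring R"
    and "fin_gen_module R (ring_as_module S)" and "projective_module R (ring_as_module S)"
    and "maximalideal \<mm> S"
  defines "\<nn> \<equiv> \<mm> \<inter> carrier R"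
  assumes "minimal_primary_decomposition S (Idl\<^bsub>S\<^esub> \<nn>) Q c" and "1 \<le> c"
    and "radical_ideal S (Q 1) = \<mm>"
    and "injective_hull S (quot_module (ring_as_module S) \<mm>) E"
    and "injective_hull R (quot_module (ring_as_module R) \<nn>) F"
  shows "\<exists>l. module_length R (quot_module (ring_as_module S) (Q 1)) = enat l \<and>
             mod_isomorphic R E (module_power F l)"
proof -
  interpret finite_extension S K
    using assms(2-5) by (intro finite_extension.intro finite_extension_axioms.intro) (auto simp: R_def regular_ring_def)
  note \<mm> = assms(7)
  interpret \<mm>: maximalideal \<mm> S by (rule \<mm>)
  interpret SMR: module "S\<lparr>carrier := K\<rparr>" SM by (rule restrict_module[OF module_SM])
  have \<nn>: "\<nn> = \<mm> \<inter> K" by (simp add: \<nn>_def R_def)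
  note n = maximalideal_contraction[OF \<mm>]
  note dec = assms(9)[unfolded \<nn>]
  have inj: "injective_module S E" using assms(12) by (simp add: injective_hull_def)
  have F: "injective_module (S\<lparr>carrier := K\<rparr>) F" using assms(13) by (simp add: injective_hull_def R_def)
  obtain e where e: "essential_generator S \<mm> E e"
    by (rule injective_hull_essential_generator[OF assms(2) \<mm>.ideal_axioms assms(12)])
  obtain f where f: "essential_generator (S\<lparr>carrier := K\<rparr>) (\<mm> \<inter> K) F f"
    by (rule injective_hull_essential_generator[OF R_cring maximalideal.axioms(1)[OF n] assms(13)[unfolded R_def \<nn>[unfolded R_def]]])
  have Q: "ideal (Q 1) S"
    using dec \<open>1 \<le> c\<close> by (auto simp: minimal_primary_decomposition_def primary_ideal_def)
  have nil: "\<exists>k::nat. a [^]\<^bsub>S\<^esub> k \<in> Q 1" if "a \<in> \<mm>" for a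
    using that assms(11) by (auto simp: radical_ideal_def)
  obtain l where l: "simple_chain (S\<lparr>carrier := K\<rparr>) SM (\<mm> \<inter> K) (Q 1) l (carrier S)"
    and lE: "simple_chain (S\<lparr>carrier := K\<rparr>) E (\<mm> \<inter> K) {\<zero>\<^bsub>E\<^esub>} l {x \<in> carrier E. \<forall>a\<in>Q 1. a \<odot>\<^bsub>E\<^esub> x = \<zero>\<^bsub>E\<^esub>}"
    using simple_chain_duality[OF \<mm> inj e Q nil] by blast
  have QR: "submodule (Q 1) (S\<lparr>carrier := K\<rparr>) SM" by (rule restrict_submodule[OF module_SM ideal_submodule[OF Q]])
  have "module_length (S\<lparr>carrier := K\<rparr>) (quot_module SM (Q 1)) = enat l"
  proof (rule SMR.simple_chain_module_length[OF n QR])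
    show "simple_chain (S\<lparr>carrier := K\<rparr>) SM (\<mm> \<inter> K) (Q 1) l (carrier SM)" using l by simp
    show "module (S\<lparr>carrier := K\<rparr>) (quot_module SM (Q 1))" by (rule module_quot_module[OF SMR.module_axioms QR])
  qed (use SMR.quot_module_proj[OF QR] in auto)
  moreover have "mod_isomorphic (S\<lparr>carrier := K\<rparr>) E (module_power F l)"
  proof (rule restricted_injective_hull[OF \<mm> inj e F f])
    show "projective_module (S\<lparr>carrier := K\<rparr>) SM" using assms(6) by (simp add: R_def)
    \<comment> \<open>Duality counts the annihilator of \<open>Q 1\<close>, whereas the map into the
      power is built on the annihilator of the contracted ideal; the two sets coincide.\<close>
    have "{x \<in> carrier E. \<forall>a\<in>Q 1. a \<odot>\<^bsub>E\<^esub> x = \<zero>\<^bsub>E\<^esub>} = {x \<in> carrier E. \<forall>a\<in>\<mm> \<inter> K. a \<odot>\<^bsub>E\<^esub> x = \<zero>\<^bsub>E\<^esub>}"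
      using annihilated_iff_primary_component[OF \<mm> _ e dec \<open>1 \<le> c\<close> assms(11)] inj
      by (auto simp: injective_module_def)
    then show "simple_chain (S\<lparr>carrier := K\<rparr>) E (\<mm> \<inter> K) {\<zero>\<^bsub>E\<^esub>} l
        {x \<in> carrier E. \<forall>a\<in>\<mm> \<inter> K. a \<odot>\<^bsub>E\<^esub> x = \<zero>\<^bsub>E\<^esub>}"
      using lE by simp
  qed
  ultimately show ?thesis unfolding R_def by blast
qed

end
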